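(* There are infinitely many non-traceable 5-connected weakly locally maximal 1-planar graphs. Moreover, for the class $\Gamma$ of all 5-connected 1-planar graphs, the shortness exponent satisfies $\sigma(\Gamma) \leq \frac{\log 20}{\log 21}$.
   Context: All graphs are finite and simple. A 1-planar drawing of a graph is a drawing in the plane (vertices as distinct points, edges as Jordan arcs containing no vertex in their interior) in which each edge is crossed at most once by another edge; two crossing edges cross exactly once and have four distinct end vertices. A graph is 1-planar if it has a 1-planar drawing. A crossing (pair of crossing edges) is full if the four end vertices of its two edges induce $K_4$, and almost full if they induce $K_4^-$ ($K_4$ minus one edge). A graph is weakly locally maximal 1-planar if it has a 1-planar drawing in which every crossing is full or almost full. A graph is traceable if it has a path containing all its vertices. For an infinite family $\mathcal{G}$ of graphs, the shortness exponent is $\sigma(\mathcal{G}) = \liminf_{G \in \mathcal{G}} \frac{\log \mathrm{circ}(G)}{\log |V(G)|}$, where $\mathrm{circ}(G)$ is the number of vertices of a longest cycle of $G$. *)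

theory Defs
  imports
    "HOL-Analysis.Analysis"
    "HOL-Library.Liminf_Limsup"
    "Graph_Theory.Graph_Theory"
begin

text \<open>
  A finite simple graph is a \<^typ>\<open>'a pair_pre_digraph\<close> satisfying \<^locale>\<open>pair_graph\<close>: a finite,
  loop-free, symmetric digraph without parallel arcs. An undirected edge is represented by two
  opposite arcs, so drawings and crossings are formulated for the two-element sets in
  \<open>edges G\<close> rather than for arcs.
\<close>

definition edges :: "'a pair_pre_digraph \<Rightarrow> 'a set set" where
  "edges G = {{u, v} | u v. (u, v) \<in> parcs G}"

definition k_connected :: "nat \<Rightarrow> 'a pair_pre_digraph \<Rightarrow> bool" where
  "k_connected k G \<longleftrightarrow>
     k < card (pverts G) \<and>
     (\<forall>S \<subseteq> pverts G. card S < k \<longrightarrow>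
        Digraph_Component.connected (with_proj G \<restriction> (pverts G - S)))"

definition traceable :: "'a pair_pre_digraph \<Rightarrow> bool" where
  "traceable G \<longleftrightarrow>
     (\<exists>u p v. pre_digraph.apath (with_proj G) u p v \<and>
        set (pre_digraph.awalk_verts (with_proj G) u p) = pverts G)"

text \<open>
  \<^const>\<open>pre_digraph.cycle\<close> admits the closed walk along an edge and back, hence the restriction
  to length at least 3. A cycle has as many vertices as arcs.  The value for a forest is 0.
\<close>
definition circ :: "'a pair_pre_digraph \<Rightarrow> nat" where
  "circ G = Sup {length p | p. pre_digraph.cycle (with_proj G) p \<and> 3 \<le> length p}"


subsection \<open>Drawings\<close>

definition arc_interior :: "(real \<Rightarrow> complex) \<Rightarrow> complex set" where
  "arc_interior c = path_image c - {pathstart c, pathfinish c}"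

text \<open>
  The sets \<open>A\<close> and \<open>B\<close> cross at \<open>x\<close> (rather than merely touch): some neighbourhood of \<open>x\<close> is
  homeomorphic to a disc in such a way that \<open>A\<close> and \<open>B\<close> become two perpendicular diameters.
\<close>
definition crosses_at :: "complex set \<Rightarrow> complex set \<Rightarrow> complex \<Rightarrow> bool" where
  "crosses_at A B x \<longleftrightarrow>
     (\<exists>U h k. open U \<and> x \<in> U \<and> homeomorphism U (ball 0 1) h k \<and> h x = 0 \<and>
        h ` (A \<inter> U) = {z \<in> ball 0 1. Im z = 0} \<and>
        h ` (B \<inter> U) = {z \<in> ball 0 1. Re z = 0})"

text \<open>
  The vertex \<open>v\<close> is drawn at \<open>pos v\<close> and the edge \<open>e\<close> along \<open>crv e\<close>. Edges may meet in their
  interiors only by crossing there.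
\<close>
definition drawing ::
    "'a pair_pre_digraph \<Rightarrow> ('a \<Rightarrow> complex) \<Rightarrow> ('a set \<Rightarrow> real \<Rightarrow> complex) \<Rightarrow> bool" where
  "drawing G pos crv \<longleftrightarrow>
     inj_on pos (pverts G) \<and>
     (\<forall>e \<in> edges G.
        Path_Connected.arc (crv e) \<and>
        {pathstart (crv e), pathfinish (crv e)} = pos ` e \<and>
        arc_interior (crv e) \<inter> pos ` pverts G = {}) \<and>
     (\<forall>e \<in> edges G. \<forall>f \<in> edges G. e \<noteq> f \<longrightarrow>
        (\<forall>x \<in> arc_interior (crv e) \<inter> arc_interior (crv f).
           crosses_at (path_image (crv e)) (path_image (crv f)) x))"

definition crossings ::
    "'a pair_pre_digraph \<Rightarrow> ('a set \<Rightarrow> real \<Rightarrow> complex) \<Rightarrow> ('a set \<times> 'a set \<times> complex) set" where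
  "crossings G crv =
     {(e, f, x). e \<in> edges G \<and> f \<in> edges G \<and> e \<noteq> f \<and>
        x \<in> arc_interior (crv e) \<inter> arc_interior (crv f)}"

definition one_planar_drawing ::
    "'a pair_pre_digraph \<Rightarrow> ('a \<Rightarrow> complex) \<Rightarrow> ('a set \<Rightarrow> real \<Rightarrow> complex) \<Rightarrow> bool" where
  "one_planar_drawing G pos crv \<longleftrightarrow>
     drawing G pos crv \<and>
     (\<forall>e f g x y. (e, f, x) \<in> crossings G crv \<longrightarrow> (e, g, y) \<in> crossings G crv \<longrightarrow>
        f = g \<and> x = y) \<and>
     (\<forall>e f x. (e, f, x) \<in> crossings G crv \<longrightarrow> e \<inter> f = {})"

definition one_planar :: "'a pair_pre_digraph \<Rightarrow> bool" where
  "one_planar G \<longleftrightarrow> (\<exists>pos crv. one_planar_drawing G pos crv)"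


subsection \<open>Weak local maximality\<close>

definition K4_minus :: "('a, 'b) pre_digraph \<Rightarrow> bool" where
  "K4_minus H \<longleftrightarrow>
     graph H \<and>
     (\<exists>(K :: 'a pair_pre_digraph) u v.
        complete_digraph 4 (with_proj K) \<and> (u, v) \<in> parcs K \<and>
        verts H = pverts K \<and> arcs_ends H = parcs K - {(u, v), (v, u)})"

definition full_crossing :: "'a pair_pre_digraph \<Rightarrow> 'a set \<Rightarrow> 'a set \<Rightarrow> bool" where
  "full_crossing G e f \<longleftrightarrow> complete_digraph 4 (with_proj G \<restriction> (e \<union> f))"

definition almost_full_crossing :: "'a pair_pre_digraph \<Rightarrow> 'a set \<Rightarrow> 'a set \<Rightarrow> bool" where
  "almost_full_crossing G e f \<longleftrightarrow> K4_minus (with_proj G \<restriction> (e \<union> f))"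

definition weakly_locally_maximal_one_planar :: "'a pair_pre_digraph \<Rightarrow> bool" where
  "weakly_locally_maximal_one_planar G \<longleftrightarrow>
     (\<exists>pos crv. one_planar_drawing G pos crv \<and>
        (\<forall>e f x. (e, f, x) \<in> crossings G crv \<longrightarrow>
           full_crossing G e f \<or> almost_full_crossing G e f))"


subsection \<open>Infinite classes of graphs\<close>

text \<open>Every finite graph is isomorphic to one whose vertices are natural numbers.\<close>

definition iso_rel :: "nat pair_pre_digraph rel" where
  "iso_rel = {(G, H). digraph_iso (with_proj G) (with_proj H)}"

text \<open>
  The lower limit is taken within the class, as the number of vertices tends to infinity.
  Up to isomorphism there are finitely many graphs of each order, so this is the same as the
  lower limit over any enumeration of the isomorphism classes.
\<close>
definition shortness_exponent :: "nat pair_pre_digraph set \<Rightarrow> ereal" where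
  "shortness_exponent \<Gamma> =
     Liminf (inf (filtercomap (\<lambda>G. card (pverts G)) at_top) (principal \<Gamma>))
       (\<lambda>G. ereal (ln (real (circ G)) / ln (real (card (pverts G)))))"

end

theory Submission
  imports Defs
begin

text \<open>
  A template consists of \<open>s\<close> hubs, which are single vertices, and \<open>t\<close> blobs. Replacing every blob with a
  copy of a gadget, a graph with five terminals, gives a larger gadget whose terminals are the first
  five hubs. Without the hubs the graph falls apart into the copies, so a path visits at most
  \<open>s + 1\<close> of them in turn. Iterating a template with \<open>s = 23\<close> and \<open>t = 26\<close>, the longest path
  grows like \<open>24^k\<close> and the number of vertices like \<open>26^k\<close>, and \<open>ln 24 / ln 26 \<le> ln 20 / ln 21\<close>.

  The terminals of a gadget are drawn at the corners of a fixed convex pentagon that contains the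
  whole drawing, hence shrunken copies fit into the blobs of a straight-line drawing of the template.
  Gadgets are highly connected because every blob is wired to five distinct hubs and every hub has a
  fan of five disjoint paths to the terminals. Finally a gadget is placed in a 1-planar drawing of
  \<open>K5\<close> and wired to its five vertices, which makes the graph 5-connected.
\<close>

section \<open>Crossing segments\<close>

text \<open>The longest path falls behind the order only if a template has more than
  \<open>s + 1\<close> blobs, and crossings are what makes this possible. Each blob needs wires to
  five different hubs. If no wires crossed, contracting the blobs would give a planar bipartite
  graph with at least \<open>5 * t\<close> edges; such a graph has at most
  \<open>2 * (s + t) - 4\<close>, so \<open>t < s\<close>. Hence wires of neighbouring blobs have to
  cross. Nothing joins two blobs, so such a crossing is at best almost full, and then its two hubs
  must be adjacent and each must be linked to both terminals. This is where the links beyond five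
  per blob come from. A gadget alone need not be 5-connected: the terminals of the smallest one have
  degree four. The induction therefore carries a weaker property: four deletions leave every vertex
  joined to a surviving terminal, and three deletions leave the gadget connected.\<close>

definition cdet :: "complex \<Rightarrow> complex \<Rightarrow> real" where
  "cdet u v = Re u * Im v - Im u * Re v"

text \<open>In the basis formed by the two directions the segments become parallel to the axes, and
  a small enough neighbourhood of \<open>x\<close> contains only inner parts of them, so the unit
  disc shows a full diameter of each.\<close>

lemma crosses_at_segments:
  fixes a b c d x :: complex
  assumes x1: "x \<in> open_segment a b" and x2: "x \<in> open_segment c d"
    and D: "cdet (b - a) (d - c) \<noteq> 0"
  shows "crosses_at (closed_segment a b) (closed_segment c d) x"
proof -
  define u v where "u = b - a" and "v = d - c"
  define dt where "dt = cdet u v"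
  have dt: "dt \<noteq> 0" using D by (simp add: dt_def u_def v_def)
  \<comment> \<open>Cramer's rule: \<open>f\<close> gives the coordinates in the basis
    \<open>u\<close>, \<open>v\<close>, and \<open>g\<close> is its inverse.\<close>
  define f where "f = (\<lambda>w. Complex (cdet w v / dt) (cdet u w / dt))"
  define g where "g = (\<lambda>z. of_real (Re z) * u + of_real (Im z) * v)"
  have gf: "g (f w) = w" for w
  proof -
    have "cdet w v * Re u + cdet u w * Re v = dt * Re w" "cdet w v * Im u + cdet u w * Im v = dt * Im w"
      by (simp_all add: cdet_def dt_def algebra_simps)
    then show ?thesis using dt by (simp add: f_def g_def complex_eq_iff flip: add_divide_distrib)
  qed
  have fg: "f (g z) = z" for z
  proof -
    have "cdet (g z) v = Re z * dt" "cdet u (g z) = Im z * dt"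
      by (simp_all add: cdet_def dt_def g_def algebra_simps)
    then show ?thesis using dt by (simp add: f_def)
  qed
  obtain \<alpha> where \<alpha>: "0 < \<alpha>" "\<alpha> < 1" "x = a + of_real \<alpha> * u"
    using x1 by (auto simp: in_segment u_def scaleR_conv_of_real algebra_simps)
  obtain \<gamma> where \<gamma>: "0 < \<gamma>" "\<gamma> < 1" "x = c + of_real \<gamma> * v"
    using x2 by (auto simp: in_segment v_def scaleR_conv_of_real algebra_simps)
  \<comment> \<open>With \<open>\<alpha>\<close> and \<open>\<gamma>\<close> the positions of
    \<open>x\<close> on the two segments, \<open>x\<close> can move by up to
    \<open>\<epsilon>\<close> times \<open>u\<close> or \<open>v\<close> in either direction without
    leaving them.\<close>
  define \<epsilon> where "\<epsilon> = min (min \<alpha> (1 - \<alpha>)) (min \<gamma> (1 - \<gamma>))"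
  have \<epsilon>: "\<epsilon> > 0" using \<alpha> \<gamma> by (simp add: \<epsilon>_def)
  have \<epsilon>le: "\<epsilon> \<le> \<alpha>" "\<epsilon> \<le> 1 - \<alpha>" "\<epsilon> \<le> \<gamma>" "\<epsilon> \<le> 1 - \<gamma>" by (auto simp: \<epsilon>_def)
  define h where "h = (\<lambda>z. f (z - x) / of_real \<epsilon>)"
  define k where "k = (\<lambda>\<zeta>. x + g (of_real \<epsilon> * \<zeta>))"
  have hk: "h (k \<zeta>) = \<zeta>" for \<zeta> using \<epsilon> by (simp add: h_def k_def fg)
  have kh: "k (h z) = z" for z using \<epsilon> by (simp add: h_def k_def gf)
  have conth: "continuous_on S h" for S
    unfolding h_def f_def cdet_def Complex_eq using dt \<epsilon> by (intro continuous_intros) auto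
  have contk: "continuous_on S k" for S
    unfolding k_def g_def by (intro continuous_intros)
  define U where "U = h -` ball 0 1"
  have oU: "open U" unfolding U_def
    using continuous_open_vimage[of "ball 0 1" h] conth[of UNIV] by (auto simp: continuous_on_eq_continuous_at)
  have kU: "k \<zeta> \<in> U" if "\<zeta> \<in> ball 0 1" for \<zeta> using that by (simp add: U_def hk)
  have hom: "homeomorphism U (ball 0 1) h k"
    unfolding homeomorphism_def
  proof (intro conjI ballI)
    show "h ` U = ball 0 1"
    proof
      show "h ` U \<subseteq> ball 0 1" by (auto simp: U_def)
      show "ball 0 1 \<subseteq> h ` U"
      proof fix \<zeta> :: complex assume "\<zeta> \<in> ball 0 1" then show "\<zeta> \<in> h ` U" using kU hk by (metis imageI) qed
    qed
    show "k ` ball 0 1 = U"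
    proof
      show "k ` ball 0 1 \<subseteq> U" using kU by auto
      show "U \<subseteq> k ` ball 0 1"
      proof fix z assume "z \<in> U" then show "z \<in> k ` ball 0 1" using kh unfolding U_def by (metis vimageE imageI) qed
    qed
  qed (use conth contk kh hk in auto)
  have hx: "h x = 0" by (simp add: h_def f_def cdet_def complex_eq_iff)
  have xU: "x \<in> U" by (simp add: U_def hx)
  have abs1: "\<bar>Re \<zeta>\<bar> < 1" "\<bar>Im \<zeta>\<bar> < 1" if "\<zeta> \<in> ball 0 1" for \<zeta> :: complex
    using that abs_Re_le_cmod[of \<zeta>] abs_Im_le_cmod[of \<zeta>] by auto
  have seg1: "k \<zeta> \<in> closed_segment a b" if z: "\<zeta> \<in> ball 0 1" "Im \<zeta> = 0" for \<zeta>
  proof -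
    have "k \<zeta> = a + of_real (\<alpha> + \<epsilon> * Re \<zeta>) * u" using z(2) by (simp add: k_def g_def \<alpha>(3) algebra_simps)
    moreover have "\<bar>\<epsilon> * Re \<zeta>\<bar> \<le> \<epsilon>" using abs1[OF z(1)] \<epsilon> by (simp add: abs_mult mult_left_le)
    ultimately show ?thesis using \<epsilon>le
      unfolding in_segment u_def by (intro exI[of _ "\<alpha> + \<epsilon> * Re \<zeta>"]) (auto simp: scaleR_conv_of_real algebra_simps abs_le_iff)
  qed
  have seg2: "k \<zeta> \<in> closed_segment c d" if z: "\<zeta> \<in> ball 0 1" "Re \<zeta> = 0" for \<zeta>
  proof -
    have "k \<zeta> = c + of_real (\<gamma> + \<epsilon> * Im \<zeta>) * v" using z(2) by (simp add: k_def g_def \<gamma>(3) algebra_simps)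
    moreover have "\<bar>\<epsilon> * Im \<zeta>\<bar> \<le> \<epsilon>" using abs1[OF z(1)] \<epsilon> by (simp add: abs_mult mult_left_le)
    ultimately show ?thesis using \<epsilon>le
      unfolding in_segment v_def by (intro exI[of _ "\<gamma> + \<epsilon> * Im \<zeta>"]) (auto simp: scaleR_conv_of_real algebra_simps abs_le_iff)
  qed
  have im: "Im (h z) = 0" if "z \<in> closed_segment a b" for z
  proof -
    from that obtain \<tau> where "z = a + of_real \<tau> * u" by (auto simp: in_segment u_def scaleR_conv_of_real algebra_simps)
    then have "z - x = of_real (\<tau> - \<alpha>) * u" by (simp add: \<alpha>(3) algebra_simps)
    then have "cdet u (z - x) = 0" by (simp only: cdet_def) simp
    then show ?thesis by (simp add: h_def f_def)
  qed
  have re: "Re (h z) = 0" if "z \<in> closed_segment c d" for z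
  proof -
    from that obtain \<tau> where "z = c + of_real \<tau> * v" by (auto simp: in_segment v_def scaleR_conv_of_real algebra_simps)
    then have "z - x = of_real (\<tau> - \<gamma>) * v" by (simp add: \<gamma>(3) algebra_simps)
    then have "cdet (z - x) v = 0" by (simp only: cdet_def) simp
    then show ?thesis by (simp add: h_def f_def)
  qed
  have A: "h ` (closed_segment a b \<inter> U) = {z \<in> ball 0 1. Im z = 0}"
  proof
    show "h ` (closed_segment a b \<inter> U) \<subseteq> {z \<in> ball 0 1. Im z = 0}" using im by (auto simp: U_def)
    show "{z \<in> ball 0 1. Im z = 0} \<subseteq> h ` (closed_segment a b \<inter> U)"
    proof
      fix z assume "z \<in> {z \<in> ball 0 1. Im z = (0::real)}"
      then have "k z \<in> closed_segment a b \<inter> U" using seg1 kU by auto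
      then show "z \<in> h ` (closed_segment a b \<inter> U)" using hk by (metis imageI)
    qed
  qed
  have B: "h ` (closed_segment c d \<inter> U) = {z \<in> ball 0 1. Re z = 0}"
  proof
    show "h ` (closed_segment c d \<inter> U) \<subseteq> {z \<in> ball 0 1. Re z = 0}" using re by (auto simp: U_def)
    show "{z \<in> ball 0 1. Re z = 0} \<subseteq> h ` (closed_segment c d \<inter> U)"
    proof
      fix z assume "z \<in> {z \<in> ball 0 1. Re z = (0::real)}"
      then have "k z \<in> closed_segment c d \<inter> U" using seg2 kU by auto
      then show "z \<in> h ` (closed_segment c d \<inter> U)" using hk by (metis imageI)
    qed
  qed
  show ?thesis unfolding crosses_at_def using oU xU hom hx A B by blast
qed

lemma cdet_scale: "cdet (of_real s * u) (of_real t * v) = s * t * cdet u v"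
  by (simp add: cdet_def algebra_simps)

lemma cdet_eq_0_parallel:
  assumes "cdet u v = 0" "u \<noteq> 0"
  obtains t where "v = of_real t * u"
proof -
  have "v = of_real ((Re u * Re v + Im u * Im v) / (Re u ^ 2 + Im u ^ 2)) * u"
  proof -
    have nz: "Re u ^ 2 + Im u ^ 2 \<noteq> 0" using assms(2) by (simp add: complex_eq_iff sum_power2_eq_zero_iff)
    have e: "Re u * Im v = Im u * Re v" using assms(1) by (simp add: cdet_def)
    have "Re v * (Re u ^ 2 + Im u ^ 2) = (Re u * Re v + Im u * Im v) * Re u"
      using e by (simp add: power2_eq_square algebra_simps)
    moreover have "Im v * (Re u ^ 2 + Im u ^ 2) = (Re u * Re v + Im u * Im v) * Im u"
      using e by (simp add: power2_eq_square algebra_simps)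
    ultimately show ?thesis using nz by (simp add: complex_eq_iff field_simps)
  qed
  then show thesis using that by blast
qed

text \<open>Parallel segments with a common point lie on one line. As intervals of that line whose
  interiors overlap, they coincide when no end point of one is interior to the other, contrary to
  \<open>ne\<close>.\<close>

lemma segments_meet_not_parallel:
  fixes a b c d x :: complex
  assumes x1: "x \<in> open_segment a b" and x2: "x \<in> open_segment c d"
    and off: "c \<notin> open_segment a b" "d \<notin> open_segment a b" "a \<notin> open_segment c d" "b \<notin> open_segment c d"
    and ne: "{a, b} \<noteq> {c, d}"
  shows "cdet (b - a) (d - c) \<noteq> 0"
proof
  assume z: "cdet (b - a) (d - c) = 0"
  define u where "u = b - a"
  have u: "u \<noteq> 0" using x1 by (auto simp: u_def in_segment)
  obtain l where l: "d - c = of_real l * u" using cdet_eq_0_parallel[OF z] u by (auto simp: u_def)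
  obtain \<alpha> where \<alpha>: "0 < \<alpha>" "\<alpha> < 1" "x = a + of_real \<alpha> * u"
    using x1 by (auto simp: in_segment u_def scaleR_conv_of_real algebra_simps)
  obtain \<gamma> where \<gamma>: "0 < \<gamma>" "\<gamma> < 1" "x = c + of_real \<gamma> * (d - c)"
    using x2 by (auto simp: in_segment scaleR_conv_of_real algebra_simps)
  \<comment> \<open>On the line with \<open>a\<close> at 0 and \<open>b\<close> at 1, the point
    \<open>c\<close> is at \<open>\<mu>\<close> and \<open>d\<close> at
    \<open>\<mu> + l\<close>.\<close>
  define \<mu> where "\<mu> = \<alpha> - \<gamma> * l"
  have c: "c = a + of_real \<mu> * u" using \<alpha>(3) \<gamma>(3) l by (simp add: \<mu>_def algebra_simps)
  have d: "d = a + of_real (\<mu> + l) * u" using c l by (simp add: algebra_simps)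
  have l0: "l \<noteq> 0" using l x2 by (auto simp: in_segment)
  have inab: "a + of_real r * u \<in> open_segment a b" if "0 < r" "r < 1" for r
    using that u unfolding in_segment u_def
    by (auto intro!: exI[of _ r] simp: scaleR_conv_of_real algebra_simps)
  have incd: "a + of_real (\<mu> + r * l) * u \<in> open_segment c d" if "0 < r" "r < 1" for r
    using that l0 u unfolding in_segment c d
    by (auto intro!: exI[of _ r] simp: scaleR_conv_of_real algebra_simps)
  have m: "\<mu> \<le> 0 \<or> 1 \<le> \<mu>" using off(1) inab[of \<mu>] c by force
  have ml: "\<mu> + l \<le> 0 \<or> 1 \<le> \<mu> + l" using off(2) inab[of "\<mu> + l"] d by force
  have za: "\<not> (0 < -\<mu> / l \<and> -\<mu> / l < 1)" using off(3) incd[of "-\<mu> / l"] l0 by auto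
  have zb: "\<not> (0 < (1-\<mu>) / l \<and> (1-\<mu>) / l < 1)"
    using off(4) incd[of "(1-\<mu>) / l"] l0 by (auto simp: u_def)
  have al: "\<alpha> = \<mu> + \<gamma> * l" by (simp add: \<mu>_def)
  have "(\<mu> = 0 \<and> \<mu> + l = 1) \<or> (\<mu> = 1 \<and> \<mu> + l = 0)"
  proof (cases "l > 0")
    case True
    have "\<gamma> * l < l" "\<gamma> * l > 0" using True \<gamma> by auto
    then have "\<mu> \<le> 0" "1 \<le> \<mu> + l" using m ml al \<alpha> by linarith+
    moreover have "\<not> (\<mu> < 0)" using za True \<open>1 \<le> \<mu> + l\<close> by (auto simp: field_simps)
    moreover have "\<not> (1 < \<mu> + l)" using zb True \<open>\<mu> \<le> 0\<close> by (auto simp: field_simps)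
    ultimately show ?thesis by linarith
  next
    case False
    then have n: "l < 0" using l0 by simp
    have "\<gamma> * l > l" "\<gamma> * l < 0" using n \<gamma> by (auto simp: mult_less_0_iff)
    then have "1 \<le> \<mu>" "\<mu> + l \<le> 0" using m ml al \<alpha> by linarith+
    moreover have "\<not> (\<mu> > 1)" using zb n \<open>\<mu> + l \<le> 0\<close> by (auto simp: field_simps)
    moreover have "\<not> (\<mu> + l < 0)" using za n \<open>1 \<le> \<mu>\<close> by (auto simp: field_simps)
    ultimately show ?thesis by linarith
  qed
  then have "{a, b} = {c, d}"
  proof
    assume "\<mu> = 0 \<and> \<mu> + l = 1"
    then have "\<mu> = 0" "l = 1" by auto
    then have "c = a" "d = b" using c d by (simp_all add: u_def)
    then show ?thesis by auto
  next
    assume "\<mu> = 1 \<and> \<mu> + l = 0"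
    then have "c = b" "d = a" using c d by (simp_all add: u_def del: of_real_add)
    then show ?thesis by auto
  qed
  then show False using ne by simp
qed

text \<open>The difference of two common points is a multiple of both directions, and these are
  independent.\<close>

lemma segments_meet_once:
  fixes a b c d x y :: complex
  assumes "cdet (b - a) (d - c) \<noteq> 0"
    and "x \<in> closed_segment a b" "y \<in> closed_segment a b" "x \<in> closed_segment c d" "y \<in> closed_segment c d"
  shows "x = y"
proof -
  obtain \<alpha> where \<alpha>: "x = a + of_real \<alpha> * (b - a)"
    using assms(2) by (auto simp: in_segment scaleR_conv_of_real algebra_simps)
  obtain \<beta> where \<beta>: "y = a + of_real \<beta> * (b - a)"
    using assms(3) by (auto simp: in_segment scaleR_conv_of_real algebra_simps)
  obtain \<gamma> where \<gamma>: "x = c + of_real \<gamma> * (d - c)"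
    using assms(4) by (auto simp: in_segment scaleR_conv_of_real algebra_simps)
  obtain \<delta> where \<delta>: "y = c + of_real \<delta> * (d - c)"
    using assms(5) by (auto simp: in_segment scaleR_conv_of_real algebra_simps)
  have 1: "x - y = of_real (\<alpha> - \<beta>) * (b - a)" by (subst \<alpha>, subst \<beta>) (simp add: algebra_simps)
  have 2: "x - y = of_real (\<gamma> - \<delta>) * (d - c)" by (subst \<gamma>, subst \<delta>) (simp add: algebra_simps)
  have "(\<alpha> - \<beta>) * (\<gamma> - \<delta>) * cdet (b - a) (d - c) = cdet (x - y) (x - y)"
    by (metis 1 2 cdet_scale)
  then have "\<alpha> - \<beta> = 0 \<or> \<gamma> - \<delta> = 0" using assms(1) by (simp add: cdet_def)
  then have "x - y = 0" using 1 2 by (elim disjE) simp_all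
  then show ?thesis by simp
qed

section \<open>Straight-line drawings\<close>

text \<open>Full and almost full crossings in one condition: the pair \<open>c\<close>,
  \<open>d\<close> may or may not be an edge. Distinctness also forces crossing edges to have four
  different ends.\<close>

definition near_K4 :: "('a \<times> 'a) set \<Rightarrow> 'a set \<Rightarrow> bool" where
  "near_K4 E A \<longleftrightarrow> (\<exists>a b c d. A = {a, b, c, d} \<and> distinct [a, b, c, d] \<and>
     (a, b) \<in> E \<and> (a, c) \<in> E \<and> (a, d) \<in> E \<and> (b, c) \<in> E \<and> (b, d) \<in> E)"

definition segs_meet :: "('a \<Rightarrow> complex) \<Rightarrow> 'a \<times> 'a \<Rightarrow> 'a \<times> 'a \<Rightarrow> bool" where
  "segs_meet p e f \<longleftrightarrow>
     open_segment (p (fst e)) (p (snd e)) \<inter> open_segment (p (fst f)) (p (snd f)) \<noteq> {}"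

text \<open>No transversality is demanded: two segments that meet in their relative interiors without
  being parallel cross, and parallel ones would contain each other's end points.\<close>

locale straight_drawing =
  fixes V :: "nat set" and E :: "(nat \<times> nat) set" and p :: "nat \<Rightarrow> complex"
  assumes finite_V: "finite V" and E_sub: "E \<subseteq> V \<times> V" and sym_E: "sym E"
    and irrefl_E: "(u, u) \<notin> E"
    and inj_p: "inj_on p V"
    and off_edge: "(u, v) \<in> E \<Longrightarrow> w \<in> V \<Longrightarrow> p w \<notin> open_segment (p u) (p v)"
    and crossing_near_K4: "(u, v) \<in> E \<Longrightarrow> (x, y) \<in> E \<Longrightarrow> {u, v} \<noteq> {x, y} \<Longrightarrow>
      segs_meet p (u, v) (x, y) \<Longrightarrow> near_K4 E {u, v, x, y}"
    and crossing_unique: "(u, v) \<in> E \<Longrightarrow> (x, y) \<in> E \<Longrightarrow> (x', y') \<in> E \<Longrightarrow>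
      {u, v} \<noteq> {x, y} \<Longrightarrow> {u, v} \<noteq> {x', y'} \<Longrightarrow>
      segs_meet p (u, v) (x, y) \<Longrightarrow> segs_meet p (u, v) (x', y') \<Longrightarrow> {x, y} = {x', y'}"

text \<open>Edges are sets, whereas a path has a direction; the numerical order of the two ends
  supplies one.\<close>

definition straight_edge :: "(nat \<Rightarrow> complex) \<Rightarrow> nat set \<Rightarrow> real \<Rightarrow> complex" where
  "straight_edge p e = linepath (p (Min e)) (p (Max e))"

lemma straight_edge_props:
  shows "path_image (straight_edge p {u, v}) = closed_segment (p u) (p v)"
    and "{pathstart (straight_edge p {u, v}), pathfinish (straight_edge p {u, v})} = p ` {u, v}"
    and "arc_interior (straight_edge p {u, v}) = open_segment (p u) (p v)"
    and "p u \<noteq> p v \<Longrightarrow> Path_Connected.arc (straight_edge p {u, v})"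
proof -
  have *: "straight_edge p {u, v} = (if u \<le> v then linepath (p u) (p v) else linepath (p v) (p u))"
    by (auto simp: straight_edge_def min_def max_def)
  show "path_image (straight_edge p {u, v}) = closed_segment (p u) (p v)"
    unfolding * by (auto simp: closed_segment_commute)
  show "{pathstart (straight_edge p {u, v}), pathfinish (straight_edge p {u, v})} = p ` {u, v}"
    unfolding * by auto
  show "arc_interior (straight_edge p {u, v}) = open_segment (p u) (p v)"
    unfolding * arc_interior_def by (auto simp: open_segment_def closed_segment_commute)
  show "p u \<noteq> p v \<Longrightarrow> Path_Connected.arc (straight_edge p {u, v})"
    unfolding * by (auto intro: arc_linepath)
qed

lemma near_K4_card: "near_K4 E A \<Longrightarrow> card A = 4"
  by (auto simp: near_K4_def)

lemma near_K4_disjoint: "near_K4 E {u, v, x, y} \<Longrightarrow> {u, v} \<inter> {x, y} = {}"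
proof -
  assume n: "near_K4 E {u, v, x, y}"
  have "card {u, v, x, y} = 4" using near_K4_card[OF n] .
  then show ?thesis by (auto simp: card_insert_if split: if_splits)
qed

lemma pair_graphI:
  assumes "finite V" "E \<subseteq> V \<times> V" "sym E" "\<And>u. (u, u) \<notin> E"
  shows "pair_graph \<lparr>pverts = V, parcs = E\<rparr>"
proof -
  have "finite E" using assms(1,2) by (meson finite_SigmaI finite_subset)
  moreover have "pair_wf_digraph \<lparr>pverts = V, parcs = E\<rparr>" by unfold_locales (use assms(2) in auto)
  ultimately show ?thesis
    unfolding pair_graph_def pair_digraph_def pair_pseudo_graph_def pair_fin_digraph_def
      pair_sym_digraph_def pair_loopfree_digraph_def pair_fin_digraph_axioms_def
      pair_sym_digraph_axioms_def pair_loopfree_digraph_axioms_def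
    using assms by (auto simp: symmetric_def)
qed

context straight_drawing
begin

abbreviation "G \<equiv> \<lparr>pverts = V, parcs = E\<rparr>"

lemma edges_G: "edges G = {{u, v} | u v. (u, v) \<in> E}"
  by (simp add: edges_def)

lemma E_V: "(u, v) \<in> E \<Longrightarrow> u \<in> V \<and> v \<in> V \<and> u \<noteq> v \<and> p u \<noteq> p v"
  using E_sub irrefl_E inj_p by (auto simp: inj_on_def)

lemma pair_graph_G: "pair_graph G"
  using finite_V E_sub sym_E irrefl_E by (rule pair_graphI)

lemma crossings_G:
  assumes "(e, f, x) \<in> crossings G (straight_edge p)"
  obtains a b c d where "e = {a, b}" "f = {c, d}" "(a, b) \<in> E" "(c, d) \<in> E" "e \<noteq> f"
    "x \<in> open_segment (p a) (p b)" "x \<in> open_segment (p c) (p d)" "segs_meet p (a, b) (c, d)"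
proof -
  from assms have *: "e \<in> edges G" "f \<in> edges G" "e \<noteq> f"
    "x \<in> arc_interior (straight_edge p e)" "x \<in> arc_interior (straight_edge p f)"
    by (auto simp: crossings_def)
  obtain a b where ab: "e = {a, b}" "(a, b) \<in> E" using *(1) unfolding edges_G by blast
  obtain c d where cd: "f = {c, d}" "(c, d) \<in> E" using *(2) unfolding edges_G by blast
  then have "x \<in> open_segment (p a) (p b)" "x \<in> open_segment (p c) (p d)"
    using * ab cd by (simp_all add: straight_edge_props)
  with * ab cd show thesis by (intro that[of a b c d]) (auto simp: segs_meet_def)
qed

lemma not_parallel:
  assumes "(a, b) \<in> E" "(c, d) \<in> E" "{a, b} \<noteq> {c, d}"
    "x \<in> open_segment (p a) (p b)" "x \<in> open_segment (p c) (p d)"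
  shows "cdet (p b - p a) (p d - p c) \<noteq> 0"
proof (rule segments_meet_not_parallel[OF assms(4,5)])
  show "{p a, p b} \<noteq> {p c, p d}"
    using inj_p E_V[OF assms(1)] E_V[OF assms(2)] assms(3)
    by (auto simp: doubleton_eq_iff inj_on_def)
qed (use off_edge assms E_V in auto)

lemma one_planar_drawing_G: "one_planar_drawing G p (straight_edge p)"
  unfolding one_planar_drawing_def drawing_def
proof (intro conjI ballI impI allI)
  show "inj_on p (pverts G)" using inj_p by simp
  fix e assume "e \<in> edges G"
  then obtain u v where e: "e = {u, v}" "(u, v) \<in> E" by (auto simp: edges_G)
  show "Path_Connected.arc (straight_edge p e)" using e E_V straight_edge_props(4) by auto
  show "{pathstart (straight_edge p e), pathfinish (straight_edge p e)} = p ` e"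
    using e straight_edge_props(2) by auto
  show "arc_interior (straight_edge p e) \<inter> p ` pverts G = {}"
    using e off_edge by (auto simp: straight_edge_props)
  fix f x assume "f \<in> edges G" and ef: "e \<noteq> f"
    and x: "x \<in> arc_interior (straight_edge p e) \<inter> arc_interior (straight_edge p f)"
  then obtain c d where f: "f = {c, d}" "(c, d) \<in> E" by (auto simp: edges_G)
  have "x \<in> open_segment (p u) (p v)" "x \<in> open_segment (p c) (p d)"
    using x e f by (auto simp: straight_edge_props)
  then show "crosses_at (path_image (straight_edge p e)) (path_image (straight_edge p f)) x"
    using crosses_at_segments not_parallel e f ef by (auto simp: straight_edge_props)
next
  fix e f g x y
  assume 1: "(e, f, x) \<in> crossings G (straight_edge p)" and 2: "(e, g, y) \<in> crossings G (straight_edge p)"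
  obtain a b c d where e: "e = {a, b}" "f = {c, d}" "(a, b) \<in> E" "(c, d) \<in> E" "e \<noteq> f"
    "x \<in> open_segment (p a) (p b)" "x \<in> open_segment (p c) (p d)" "segs_meet p (a, b) (c, d)"
    using crossings_G[OF 1] by blast
  obtain a' b' c' d' where g: "e = {a', b'}" "g = {c', d'}" "(a', b') \<in> E" "(c', d') \<in> E" "e \<noteq> g"
    "y \<in> open_segment (p a') (p b')" "y \<in> open_segment (p c') (p d')" "segs_meet p (a', b') (c', d')"
    using crossings_G[OF 2] by blast
  have os: "open_segment (p a') (p b') = open_segment (p a) (p b)"
    using e(1) g(1) by (auto simp: doubleton_eq_iff open_segment_commute)
  have m: "segs_meet p (a, b) (c', d')" using g(8) os by (simp add: segs_meet_def)
  have fg: "f = g" using crossing_unique[OF e(3,4) g(4) _ _ e(8) m] e(1,2,5) g(2,5) by auto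
  then show "f = g" .
  have os2: "open_segment (p c') (p d') = open_segment (p c) (p d)"
    using e(2) g(2) fg by (auto simp: doubleton_eq_iff open_segment_commute)
  have "cdet (p b - p a) (p d - p c) \<noteq> 0" using not_parallel[OF e(3,4) _ e(6,7)] e(1,2,5) by auto
  then show "x = y"
    using segments_meet_once e(6,7) g(6,7) os os2 open_closed_segment by metis
next
  fix e f x assume 1: "(e, f, x) \<in> crossings G (straight_edge p)"
  obtain a b c d where e: "e = {a, b}" "f = {c, d}" "(a, b) \<in> E" "(c, d) \<in> E" "e \<noteq> f"
    "x \<in> open_segment (p a) (p b)" "x \<in> open_segment (p c) (p d)" "segs_meet p (a, b) (c, d)"
    using crossings_G[OF 1] by blast
  then show "e \<inter> f = {}" using near_K4_disjoint crossing_near_K4 by metis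
qed

text \<open>Only the pair \<open>c\<close>, \<open>d\<close> is undecided. If it is an edge, the
  crossing is full; otherwise the induced graph is the complete graph \<open>K\<close> without the
  arcs between \<open>c\<close> and \<open>d\<close>.\<close>

lemma near_K4_full:
  assumes n: "near_K4 E (e \<union> f)"
  shows "full_crossing G e f \<or> almost_full_crossing G e f"
proof -
  obtain a b c d where A: "e \<union> f = {a, b, c, d}" "distinct [a, b, c, d]"
    "(a, b) \<in> E" "(a, c) \<in> E" "(a, d) \<in> E" "(b, c) \<in> E" "(b, d) \<in> E"
    using n by (auto simp: near_K4_def)
  define A where "A = {a, b, c, d}"
  have AV: "A \<subseteq> V" using A E_V by (auto simp: A_def)
  define K :: "nat pair_pre_digraph" where "K = \<lparr>pverts = A, parcs = {(u, v). (u, v) \<in> A \<times> A \<and> u \<noteq> v}\<rparr>"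
  have K: "complete_digraph 4 (with_proj K)"
    unfolding complete_digraph_pair_def K_def using A by (auto simp: A_def)
  have sy: "(v, u) \<in> E" if "(u, v) \<in> E" for u v using symD[OF sym_E that] .
  have r: "with_proj G \<restriction> A = with_proj \<lparr>pverts = A, parcs = {e \<in> E. fst e \<in> A \<and> snd e \<in> A}\<rparr>"
    by (simp add: induce_subgraph_def with_proj_def)
  have pA: "pair_graph \<lparr>pverts = A, parcs = {e \<in> E. fst e \<in> A \<and> snd e \<in> A}\<rparr>"
  proof (rule pair_graphI)
    show "sym {e \<in> E. fst e \<in> A \<and> snd e \<in> A}" by (rule symI, clarsimp) (rule symD[OF sym_E])
    show "finite A" by (simp add: A_def)
    show "{e \<in> E. fst e \<in> A \<and> snd e \<in> A} \<subseteq> A \<times> A" by force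
    show "(u, u) \<notin> {e \<in> E. fst e \<in> A \<and> snd e \<in> A}" for u using irrefl_E by blast
  qed
  have g: "graph (with_proj \<lparr>pverts = A, parcs = {e \<in> E. fst e \<in> A \<and> snd e \<in> A}\<rparr>)"
  proof -
    interpret pA: pair_graph "\<lparr>pverts = A, parcs = {e \<in> E. fst e \<in> A \<and> snd e \<in> A}\<rparr>" by (rule pA)
    show ?thesis by unfold_locales
  qed
  have nd: "a \<noteq> b" "a \<noteq> c" "a \<noteq> d" "b \<noteq> c" "b \<noteq> d" "c \<noteq> d" using A(2) by auto
  have cdc: "(d, c) \<in> E \<longleftrightarrow> (c, d) \<in> E" using sy by blast
  note EE = A(3-7) A(3-7)[THEN sy] irrefl_E cdc
  have p': "(x, y) \<in> E \<longleftrightarrow> x \<noteq> y \<and> ((c, d) \<in> E \<or> (x, y) \<noteq> (c, d) \<and> (x, y) \<noteq> (d, c))"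
    if "x \<in> A" "y \<in> A" for x y
  proof -
    have "x = a \<or> x = b \<or> x = c \<or> x = d" "y = a \<or> y = b \<or> y = c \<or> y = d"
      using that by (auto simp: A_def)
    then show ?thesis by (elim disjE) (simp_all add: EE nd nd[symmetric])
  qed
  have p: "{e \<in> E. fst e \<in> A \<and> snd e \<in> A} =
     (if (c, d) \<in> E then parcs K else parcs K - {(c, d), (d, c)})"
    by (rule set_eqI, clarify, simp only: K_def) (use p' in \<open>auto split: if_splits\<close>)
  show ?thesis
  proof (cases "(c, d) \<in> E")
    case True
    then have "with_proj G \<restriction> (e \<union> f) = with_proj K" using p r A(1) by (simp add: K_def A_def)
    then have "full_crossing G e f" using K by (simp add: full_crossing_def)
    then show ?thesis ..
  next
    case False
    have "(c, d) \<in> parcs K" using A by (auto simp: K_def A_def)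
    moreover have "{e \<in> E. fst e \<in> A \<and> snd e \<in> A} = parcs K - {(c, d), (d, c)}"
      using p False by simp
    moreover have "pverts K = A" by (simp add: K_def)
    ultimately have "K4_minus (with_proj G \<restriction> A)"
      unfolding K4_minus_def using g K by (intro conjI exI[of _ K] exI[of _ c] exI[of _ d]) (simp_all only: r with_proj_simps pair_pre_digraph.simps)
    then show ?thesis using A(1) by (simp add: almost_full_crossing_def A_def)
  qed
qed

lemma wlm_G: "weakly_locally_maximal_one_planar G"
  unfolding weakly_locally_maximal_one_planar_def
proof (intro exI conjI allI impI)
  show "one_planar_drawing G p (straight_edge p)" by (rule one_planar_drawing_G)
  fix e f x assume "(e, f, x) \<in> crossings G (straight_edge p)"
  then obtain a b c d where e: "e = {a, b}" "f = {c, d}" "(a, b) \<in> E" "(c, d) \<in> E" "e \<noteq> f"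
    "segs_meet p (a, b) (c, d)"
    using crossings_G by metis
  then have "near_K4 E (e \<union> f)" using crossing_near_K4[of a b c d] by (simp add: insert_commute)
  then show "full_crossing G e f \<or> almost_full_crossing G e f" by (rule near_K4_full)
qed

end

section \<open>Blowing up a template\<close>

text \<open>Vertices are encoded so that \<open>hub a\<close> and \<open>cpy i v\<close> are distinct and determine \<open>a\<close>, \<open>i\<close>, \<open>v\<close>:
  the copy number \<open>i\<close> of a gadget has the vertices \<open>cpy i v\<close>, and the terminals of a gadget are
  \<open>hub 0\<close>, \dots, \<open>hub 4\<close>.\<close>

definition hub :: "nat \<Rightarrow> nat" where "hub a = sum_encode (Inl a)"
definition cpy :: "nat \<Rightarrow> nat \<Rightarrow> nat" where "cpy i v = sum_encode (Inr (prod_encode (i, v)))"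

lemma hub_cpy_simps [simp]:
  "hub a = hub b \<longleftrightarrow> a = b" "cpy i v = cpy j w \<longleftrightarrow> i = j \<and> v = w" "hub a \<noteq> cpy i v" "cpy i v \<noteq> hub a"
  by (auto simp: hub_def cpy_def sum_encode_eq prod_encode_eq)

definition blow_verts :: "nat \<Rightarrow> nat \<Rightarrow> nat set \<Rightarrow> nat set" where
  "blow_verts s t V = hub ` {..<s} \<union> (\<Union>i<t. cpy i ` V)"

definition blow_edges :: "nat \<Rightarrow> (nat \<times> nat) set \<Rightarrow> (nat \<times> nat) set \<Rightarrow> (nat \<times> nat) set" where
  "blow_edges t F E = F \<union> (\<Union>i<t. map_prod (cpy i) (cpy i) ` E)"

definition blow_pos ::
    "(nat \<Rightarrow> complex) \<Rightarrow> (nat \<Rightarrow> complex) \<Rightarrow> (nat \<Rightarrow> complex) \<Rightarrow> (nat \<Rightarrow> complex) \<Rightarrow> nat \<Rightarrow> complex" where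
  "blow_pos q c \<beta> p v = (case sum_decode v of Inl a \<Rightarrow> q a
     | Inr m \<Rightarrow> (case prod_decode m of (i, w) \<Rightarrow> c i + \<beta> i * p w))"

lemma blow_pos_simps [simp]:
  "blow_pos q c \<beta> p (hub a) = q a" "blow_pos q c \<beta> p (cpy i w) = c i + \<beta> i * p w"
  by (simp_all add: blow_pos_def hub_def cpy_def)

text \<open>Positions of the terminals alone. They suffice to place the ends of all template edges,
  so a template is drawn without knowing the gadget.\<close>

definition terminal_pos :: "(nat \<Rightarrow> complex) \<Rightarrow> nat \<Rightarrow> complex" where
  "terminal_pos \<tau> = blow_pos \<tau> (\<lambda>_. 0) (\<lambda>_. 0) (\<lambda>_. 0)"

definition template_nodes :: "nat \<Rightarrow> nat \<Rightarrow> nat set" where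
  "template_nodes s t = hub ` {..<s} \<union> (\<Union>i<t. (\<lambda>j. cpy i (hub j)) ` {..<5})"

section \<open>Similarities of the plane and the drawing of a blow-up\<close>

lemma open_segment_affine:
  fixes c \<beta> a b :: complex
  assumes "\<beta> \<noteq> 0"
  shows "open_segment (c + \<beta> * a) (c + \<beta> * b) = (\<lambda>z. c + \<beta> * z) ` open_segment a b"
proof -
  have l: "linear (\<lambda>z. \<beta> * z)" by (simp add: bounded_linear.linear bounded_linear_mult_right)
  have i: "inj (\<lambda>z. \<beta> * z)" using assms by (auto simp: inj_def)
  have "open_segment (c + \<beta> * a) (c + \<beta> * b) = (\<lambda>z. c + z) ` open_segment (\<beta> * a) (\<beta> * b)"
    by (rule open_segment_translation)
  also have "open_segment (\<beta> * a) (\<beta> * b) = (\<lambda>z. \<beta> * z) ` open_segment a b"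
    by (rule open_segment_linear_image[OF l i])
  finally show ?thesis by (simp add: image_image)
qed

lemma affine_image_hull:
  fixes c \<beta> :: complex
  shows "(\<lambda>z. c + \<beta> * z) ` (convex hull A) = convex hull ((\<lambda>z. c + \<beta> * z) ` A)"
proof -
  have l: "linear (\<lambda>z. \<beta> * z)" by (simp add: bounded_linear.linear bounded_linear_mult_right)
  have "convex hull ((\<lambda>z. c + z) ` (\<lambda>z. \<beta> * z) ` A) = (\<lambda>z. c + z) ` (\<lambda>z. \<beta> * z) ` (convex hull A)"
    by (simp only: convex_hull_linear_image[OF l] convex_hull_translation)
  then show ?thesis by (simp only: image_image)
qed

lemma segs_meet_affine:
  assumes "\<beta> \<noteq> 0"
  shows "segs_meet (\<lambda>v. c + \<beta> * p v) e f \<longleftrightarrow> segs_meet p e f"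
proof -
  have "inj (\<lambda>z. c + \<beta> * z)" using assms by (auto simp: inj_def)
  then show ?thesis unfolding segs_meet_def open_segment_affine[OF assms]
    by (subst image_Int[symmetric]) auto
qed

lemma straight_drawing_affine:
  assumes "straight_drawing V E p" "\<beta> \<noteq> 0"
  shows "straight_drawing V E (\<lambda>v. c + \<beta> * p v)"
proof -
  interpret straight_drawing V E p by fact
  have i: "inj (\<lambda>z. c + \<beta> * z)" using assms(2) by (auto simp: inj_def)
  show ?thesis
  proof
    show "inj_on (\<lambda>v. c + \<beta> * p v) V" using inj_p assms(2) by (auto simp: inj_on_def)
    show "c + \<beta> * p w \<notin> open_segment (c + \<beta> * p u) (c + \<beta> * p v)" if "(u, v) \<in> E" "w \<in> V" for u v w
      using off_edge[OF that] inj_image_mem_iff[OF i] unfolding open_segment_affine[OF assms(2)] by simp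
    show "finite V" "E \<subseteq> V \<times> V" "sym E" "(u, u) \<notin> E" for u
      by (rule finite_V E_sub sym_E irrefl_E)+
    show "near_K4 E {u, v, x, y}"
      if "(u, v) \<in> E" "(x, y) \<in> E" "{u, v} \<noteq> {x, y}" "segs_meet (\<lambda>v. c + \<beta> * p v) (u, v) (x, y)"
      for u v x y
      using crossing_near_K4[OF that(1-3)] that(4) segs_meet_affine[OF assms(2)] by blast
    show "{x, y} = {x', y'}"
      if "(u, v) \<in> E" "(x, y) \<in> E" "(x', y') \<in> E" "{u, v} \<noteq> {x, y}" "{u, v} \<noteq> {x', y'}"
        "segs_meet (\<lambda>v. c + \<beta> * p v) (u, v) (x, y)" "segs_meet (\<lambda>v. c + \<beta> * p v) (u, v) (x', y')"
      for u v x y x' y'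
      by (rule crossing_unique[OF that(1-5)]) (use that(6,7) segs_meet_affine[OF assms(2)] in blast)+
  qed
qed

locale straight_gadget = straight_drawing +
  fixes \<tau> :: "nat \<Rightarrow> complex"
  assumes terminal: "j < 5 \<Longrightarrow> hub j \<in> V" "j < 5 \<Longrightarrow> p (hub j) = \<tau> j"
    and in_hull: "v \<in> V \<Longrightarrow> p v \<in> convex hull (\<tau> ` {..<5})"

text \<open>\<open>K i\<close> is the pentagon reserved for copy \<open>i\<close>, and
  \<open>P\<close> gives the positions of the template nodes. All conditions speak of these
  pentagons and never of the gadget inside, so one check covers every level of the iteration. An
  edge avoids even the pentagon on which it ends, except for the terminal itself.\<close>

locale drawn_template =
  fixes s t :: nat and F :: "(nat \<times> nat) set" and q c \<beta> \<tau> :: "nat \<Rightarrow> complex"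
  fixes K :: "nat \<Rightarrow> complex set" and P :: "nat \<Rightarrow> complex"
  defines "K \<equiv> \<lambda>i. (\<lambda>z. c i + \<beta> i * z) ` (convex hull (\<tau> ` {..<5}))"
  defines "P \<equiv> blow_pos q c \<beta> (terminal_pos \<tau>)"
  assumes scale_nz: "i < t \<Longrightarrow> \<beta> i \<noteq> 0"
    and F_sub: "F \<subseteq> template_nodes s t \<times> template_nodes s t"
    and sym_F: "sym F" and irrefl_F: "(u, u) \<notin> F"
    and inj_q: "inj_on q {..<s}"
    and hub_off_blob: "a < s \<Longrightarrow> i < t \<Longrightarrow> q a \<notin> K i"
    and blobs_disjoint: "i < t \<Longrightarrow> j < t \<Longrightarrow> i \<noteq> j \<Longrightarrow> K i \<inter> K j = {}"
    and edge_off_blob: "(u, v) \<in> F \<Longrightarrow> i < t \<Longrightarrow> open_segment (P u) (P v) \<inter> K i = {}"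
    and hub_off_edge: "(u, v) \<in> F \<Longrightarrow> a < s \<Longrightarrow> q a \<notin> open_segment (P u) (P v)"
    and template_near_K4: "(u, v) \<in> F \<Longrightarrow> (x, y) \<in> F \<Longrightarrow> {u, v} \<noteq> {x, y} \<Longrightarrow>
      segs_meet P (u, v) (x, y) \<Longrightarrow> near_K4 F {u, v, x, y}"
    and template_unique: "(u, v) \<in> F \<Longrightarrow> (x, y) \<in> F \<Longrightarrow> (x', y') \<in> F \<Longrightarrow>
      {u, v} \<noteq> {x, y} \<Longrightarrow> {u, v} \<noteq> {x', y'} \<Longrightarrow>
      segs_meet P (u, v) (x, y) \<Longrightarrow> segs_meet P (u, v) (x', y') \<Longrightarrow> {x, y} = {x', y'}"

lemma near_K4_image:
  assumes "near_K4 E A" "inj f" shows "near_K4 (map_prod f f ` E) (f ` A)"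
proof -
  obtain a b c d where A: "A = {a, b, c, d}" "distinct [a, b, c, d]"
    "(a, b) \<in> E" "(a, c) \<in> E" "(a, d) \<in> E" "(b, c) \<in> E" "(b, d) \<in> E"
    using assms(1) by (auto simp: near_K4_def)
  have "f ` A = {f a, f b, f c, f d}" using A(1) by simp
  moreover have "distinct [f a, f b, f c, f d]" using A(2) assms(2) by (simp add: inj_eq)
  moreover have "(f u, f v) \<in> map_prod f f ` E" if "(u, v) \<in> E" for u v using that by force
  ultimately show ?thesis unfolding near_K4_def using A(3-7) by blast
qed

lemma near_K4_mono: "near_K4 E A \<Longrightarrow> E \<subseteq> E' \<Longrightarrow> near_K4 E' A"
  unfolding near_K4_def by blast

lemma inj_cpy: "inj (cpy i)" by (auto simp: inj_def)

locale blow_up = drawn_template s t F q c \<beta> \<tau> K P + straight_gadget V E p \<tau>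
  for s t F q c \<beta> \<tau> K P V E p
begin

abbreviation "p' \<equiv> blow_pos q c \<beta> p"

lemma p'_node: "v \<in> template_nodes s t \<Longrightarrow> p' v = P v"
  by (auto simp: template_nodes_def P_def terminal_pos_def terminal)

lemma F_nodes: "(u, v) \<in> F \<Longrightarrow> u \<in> template_nodes s t \<and> v \<in> template_nodes s t"
  using F_sub by blast

lemma p'_F: "(u, v) \<in> F \<Longrightarrow> p' u = P u \<and> p' v = P v"
  using F_nodes p'_node by blast

lemma p'_blob: "v \<in> V \<Longrightarrow> p' (cpy i v) \<in> K i"
  unfolding K_def using in_hull by auto

lemma convex_K: "convex (K i)"
  unfolding K_def affine_image_hull by simp

lemma inner_segment:
  assumes "(u, v) \<in> E" shows "open_segment (p' (cpy i u)) (p' (cpy i v)) \<subseteq> K i"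
proof -
  have "u \<in> V" "v \<in> V" using assms E_sub by auto
  then have "closed_segment (p' (cpy i u)) (p' (cpy i v)) \<subseteq> K i"
    by (intro closed_segment_subset p'_blob convex_K)
  then show ?thesis using segment_open_subset_closed by blast
qed

lemma segs_meet_F:
  assumes "(u, v) \<in> F" "(x, y) \<in> F" shows "segs_meet p' (u, v) (x, y) \<longleftrightarrow> segs_meet P (u, v) (x, y)"
  using p'_F[OF assms(1)] p'_F[OF assms(2)] by (simp add: segs_meet_def)

lemma segs_meet_F_inner:
  assumes "(u, v) \<in> F" "(x, y) \<in> E" "i < t" shows "\<not> segs_meet p' (u, v) (cpy i x, cpy i y)"
proof -
  have "open_segment (p' u) (p' v) \<inter> K i = {}" using edge_off_blob[OF assms(1,3)] p'_F[OF assms(1)] by simp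
  then show ?thesis using inner_segment[OF assms(2), of i] unfolding segs_meet_def fst_conv snd_conv by blast
qed

lemma segs_meet_sym: "segs_meet r e f \<longleftrightarrow> segs_meet r f e"
  by (auto simp: segs_meet_def)

lemma segs_meet_inner:
  assumes "(u, v) \<in> E" "(x, y) \<in> E" "i < t" "j < t" "segs_meet p' (cpy i u, cpy i v) (cpy j x, cpy j y)"
  shows "i = j \<and> segs_meet p (u, v) (x, y)"
proof
  show ij: "i = j"
  proof (rule ccontr)
    assume "i \<noteq> j"
    then have "K i \<inter> K j = {}" using blobs_disjoint assms by blast
    then show False using inner_segment[OF assms(1), of i] inner_segment[OF assms(2), of j] assms(5)
      unfolding segs_meet_def fst_conv snd_conv by blast
  qed
  have "segs_meet (\<lambda>v. c i + \<beta> i * p v) (u, v) (x, y)" using assms(5) ij by (simp add: segs_meet_def)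
  then show "segs_meet p (u, v) (x, y)" using segs_meet_affine[OF scale_nz[OF assms(3)]] by blast
qed

lemma blow_edges_cases:
  assumes "(u, v) \<in> blow_edges t F E"
  obtains (long) "(u, v) \<in> F" | (inner) i x y where "i < t" "(x, y) \<in> E" "u = cpy i x" "v = cpy i y"
  using assms by (auto simp: blow_edges_def)

lemma blow_verts_cases:
  assumes "w \<in> blow_verts s t V"
  obtains (hub) a where "a < s" "w = hub a" | (cpy) i x where "i < t" "x \<in> V" "w = cpy i x"
  using assms by (auto simp: blow_verts_def)

lemma nodes_in_blow_verts: "template_nodes s t \<subseteq> blow_verts s t V"
  using terminal(1) by (auto simp: template_nodes_def blow_verts_def)

text \<open>The pentagons are disjoint from one another and from the interiors of template edges.
  Hence edges can cross only within the template or within one copy, and each crossing condition is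
  inherited from there.\<close>

lemma meet_cases:
  assumes "(u, v) \<in> blow_edges t F E" "(x, y) \<in> blow_edges t F E" "segs_meet p' (u, v) (x, y)"
  obtains (long) "(u, v) \<in> F" "(x, y) \<in> F" "segs_meet P (u, v) (x, y)"
  | (inner) i u1 v1 x1 y1 where "i < t" "(u1, v1) \<in> E" "(x1, y1) \<in> E"
     "u = cpy i u1" "v = cpy i v1" "x = cpy i x1" "y = cpy i y1" "segs_meet p (u1, v1) (x1, y1)"
  using assms(1)
proof (cases rule: blow_edges_cases)
  case l1: long
  show thesis using assms(2)
  proof (cases rule: blow_edges_cases)
    case long then show thesis using l1 assms(3) segs_meet_F that(1) by blast
  next
    case (inner i x y) then show thesis using l1 assms(3) segs_meet_F_inner by blast
  qed
next
  case i1: (inner i u1 v1)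
  show thesis using assms(2)
  proof (cases rule: blow_edges_cases)
    case long then show thesis using i1 assms(3) segs_meet_F_inner segs_meet_sym by blast
  next
    case (inner j x1 y1)
    then have "i = j \<and> segs_meet p (u1, v1) (x1, y1)"
      using i1 assms(3) segs_meet_inner by blast
    then show thesis using i1 inner that(2) by blast
  qed
qed

lemma straight_drawing_blow: "straight_drawing (blow_verts s t V) (blow_edges t F E) p'"
proof
  show "finite (blow_verts s t V)" using finite_V by (simp add: blow_verts_def)
  show "blow_edges t F E \<subseteq> blow_verts s t V \<times> blow_verts s t V"
  proof clarify
    fix u v assume "(u, v) \<in> blow_edges t F E"
    then show "u \<in> blow_verts s t V \<and> v \<in> blow_verts s t V"
    proof (cases rule: blow_edges_cases)
      case long then show ?thesis using F_nodes nodes_in_blow_verts by blast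
    next
      case (inner i x y)
      then have "x \<in> V" "y \<in> V" using E_sub by auto
      then show ?thesis using inner by (auto simp: blow_verts_def)
    qed
  qed
  show "sym (blow_edges t F E)"
  proof (rule symI)
    fix u v assume "(u, v) \<in> blow_edges t F E"
    then show "(v, u) \<in> blow_edges t F E"
    proof (cases rule: blow_edges_cases)
      case long then show ?thesis using symD[OF sym_F] by (auto simp: blow_edges_def)
    next
      case (inner i x y)
      then have "(y, x) \<in> E" using symD[OF sym_E] by blast
      then show ?thesis using inner by (force simp: blow_edges_def)
    qed
  qed
  show "(u, u) \<notin> blow_edges t F E" for u
    using irrefl_F irrefl_E by (auto simp: blow_edges_def)
  show "inj_on p' (blow_verts s t V)"
  proof (rule inj_onI)
    fix v w assume "v \<in> blow_verts s t V" "w \<in> blow_verts s t V" and e: "p' v = p' w"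
    from this(1) show "v = w"
    proof (cases rule: blow_verts_cases)
      case h1: (hub a)
      show ?thesis using \<open>w \<in> _\<close>
      proof (cases rule: blow_verts_cases)
        case (hub b) then show ?thesis using h1 e inj_q by (auto simp: inj_on_def)
      next
        case (cpy i x) then show ?thesis using h1 e hub_off_blob p'_blob by (metis blow_pos_simps(1))
      qed
    next
      case c1: (cpy i x)
      show ?thesis using \<open>w \<in> _\<close>
      proof (cases rule: blow_verts_cases)
        case (hub b) then show ?thesis using c1 e hub_off_blob p'_blob by (metis blow_pos_simps(1))
      next
        case (cpy j y)
        have "i = j"
          using c1 cpy e blobs_disjoint[of i j] p'_blob[of x i] p'_blob[of y j] by auto
        then show ?thesis using c1 cpy e scale_nz inj_p by (auto simp: inj_on_def)
      qed
    qed
  qed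
  show "p' w \<notin> open_segment (p' u) (p' v)" if "(u, v) \<in> blow_edges t F E" and w: "w \<in> blow_verts s t V" for u v w
    using that(1)
  proof (cases rule: blow_edges_cases)
    case long
    note pF = p'_F[OF long]
    show ?thesis using w
    proof (cases rule: blow_verts_cases)
      case (hub a) then show ?thesis using hub_off_edge[OF long, of a] pF by simp
    next
      case (cpy i x) then show ?thesis using edge_off_blob[OF long, of i] p'_blob[of x i] pF by auto
    qed
  next
    case (inner i x y)
    have sub: "open_segment (p' u) (p' v) \<subseteq> K i" using inner_segment inner by blast
    show ?thesis using w
    proof (cases rule: blow_verts_cases)
      case (hub a) then show ?thesis using sub hub_off_blob[of a i] inner by auto
    next
      case (cpy j z)
      show ?thesis
      proof (cases "i = j")
        case True
        have "p z \<notin> open_segment (p x) (p y)" using off_edge inner cpy by blast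
        moreover have "inj (\<lambda>z. c i + \<beta> i * z)" using scale_nz[of i] inner by (auto simp: inj_def)
        ultimately have "c i + \<beta> i * p z \<notin> (\<lambda>z. c i + \<beta> i * z) ` open_segment (p x) (p y)"
          using inj_image_mem_iff by fast
        then show ?thesis using inner cpy True open_segment_affine[OF scale_nz[of i]] by simp
      next
        case False then show ?thesis using sub p'_blob[of z j] blobs_disjoint[of i j] inner cpy by auto
      qed
    qed
  qed
  show "near_K4 (blow_edges t F E) {u, v, x, y}"
    if e: "(u, v) \<in> blow_edges t F E" "(x, y) \<in> blow_edges t F E" "{u, v} \<noteq> {x, y}"
      "segs_meet p' (u, v) (x, y)" for u v x y
    using e(1,2,4)
  proof (cases rule: meet_cases)
    case long
    then have "near_K4 F {u, v, x, y}" using template_near_K4 e(3) by blast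
    then show ?thesis by (rule near_K4_mono) (simp add: blow_edges_def)
  next
    case (inner i u1 v1 x1 y1)
    have "{u1, v1} \<noteq> {x1, y1}" using e(3) inner by auto
    then have "near_K4 E {u1, v1, x1, y1}" using crossing_near_K4[OF inner(2,3)] inner(8) by blast
    then have "near_K4 (map_prod (cpy i) (cpy i) ` E) (cpy i ` {u1, v1, x1, y1})"
      by (rule near_K4_image[OF _ inj_cpy])
    moreover have "map_prod (cpy i) (cpy i) ` E \<subseteq> blow_edges t F E"
      using inner(1) by (auto simp: blow_edges_def)
    ultimately have "near_K4 (blow_edges t F E) (cpy i ` {u1, v1, x1, y1})" by (rule near_K4_mono)
    then show ?thesis using inner(4-7) by simp
  qed
  show "{x, y} = {x', y'}"
    if e: "(u, v) \<in> blow_edges t F E" "(x, y) \<in> blow_edges t F E" "(x', y') \<in> blow_edges t F E"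
      "{u, v} \<noteq> {x, y}" "{u, v} \<noteq> {x', y'}" "segs_meet p' (u, v) (x, y)" "segs_meet p' (u, v) (x', y')"
    for u v x y x' y'
    using e(1,2,6)
  proof (cases rule: meet_cases)
    case l1: long
    show ?thesis using e(1,3,7)
    proof (cases rule: meet_cases)
      case long then show ?thesis using l1 template_unique e(4,5) by blast
    next
      case (inner i u1 v1 x1 y1)
      have "\<not> segs_meet p' (u, v) (x', y')" using segs_meet_F_inner[OF l1(1) inner(3,1)] inner by simp
      then show ?thesis using e(7) by simp
    qed
  next
    case i1: (inner i u1 v1 x1 y1)
    show ?thesis using e(1,3,7)
    proof (cases rule: meet_cases)
      case long
      have "\<not> segs_meet p' (u, v) (x, y)" using segs_meet_F_inner[OF long(1) i1(3,1)] i1 by simp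
      then show ?thesis using e(6) by simp
    next
      case (inner j u2 v2 x2 y2)
      have ij: "j = i" "u2 = u1" "v2 = v1" using i1 inner by auto
      have "{x1, y1} = {x2, y2}"
        by (rule crossing_unique[OF i1(2,3) inner(3)[unfolded ij]])
          (use e(4,5) i1 inner ij in auto)
      then have "cpy i ` {x1, y1} = cpy i ` {x2, y2}" by simp
      then show ?thesis using i1 inner ij by simp
    qed
  qed
qed

lemma blow_in_hull:
  assumes "\<And>a. a < s \<Longrightarrow> q a \<in> H" "\<And>i j. i < t \<Longrightarrow> j < 5 \<Longrightarrow> c i + \<beta> i * \<tau> j \<in> H" "convex H"
    "v \<in> blow_verts s t V"
  shows "p' v \<in> H"
  using assms(4)
proof (cases rule: blow_verts_cases)
  case (hub a) then show ?thesis using assms(1) by simp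
next
  case (cpy i x)
  have "K i = convex hull ((\<lambda>z. c i + \<beta> i * z) ` \<tau> ` {..<5})"
    unfolding K_def by (rule affine_image_hull)
  also have "\<dots> \<subseteq> H" using assms(2,3) cpy by (intro hull_minimal) auto
  finally show ?thesis using p'_blob cpy by auto
qed

end

text \<open>With integer coordinates the result fills a pentagon enlarged by \<open>r\<close>.
  Dividing by \<open>r\<close> returns the terminals to \<open>\<tau>\<close>, so that the drawing
  can be inserted into the next template.\<close>

lemma straight_gadget_blow:
  assumes "straight_drawing V E p" "r \<noteq> 0"
    and "\<And>j. j < 5 \<Longrightarrow> hub j \<in> V" "\<And>j. j < 5 \<Longrightarrow> p (hub j) = r * \<tau> j"
    and "\<And>v. v \<in> V \<Longrightarrow> p v \<in> (\<lambda>z. r * z) ` (convex hull (\<tau> ` {..<5}))"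
  shows "straight_gadget V E (\<lambda>v. p v / r) \<tau>"
proof -
  have "straight_drawing V E (\<lambda>v. 0 + inverse r * p v)"
    using assms(1,2) by (intro straight_drawing_affine) auto
  then have "straight_drawing V E (\<lambda>v. p v / r)" by (simp add: divide_inverse mult.commute)
  moreover have "straight_gadget_axioms V (\<lambda>v. p v / r) \<tau>"
  proof
    show "hub j \<in> V" "p (hub j) / r = \<tau> j" if "j < 5" for j using assms(2-4) that by auto
    show "p v / r \<in> convex hull (\<tau> ` {..<5})" if v: "v \<in> V" for v
    proof -
      obtain z where "z \<in> convex hull (\<tau> ` {..<5})" "p v = r * z" using assms(5)[OF v] by blast
      then show ?thesis using assms(2) by simp
    qed
  qed
  ultimately show ?thesis by (simp add: straight_gadget_def)
qed

section \<open>Connectivity\<close>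

text \<open>Reachability after the deletion of \<open>X\<close>. Being reflexive, it holds even from
  a deleted vertex to itself, so survival of the ends is always stated separately.\<close>

definition joined :: "(nat \<times> nat) set \<Rightarrow> nat set \<Rightarrow> nat \<Rightarrow> nat \<Rightarrow> bool" where
  "joined E X u v \<longleftrightarrow> (u, v) \<in> (E \<inter> (- X) \<times> (- X))\<^sup>*"

lemma joined_refl [simp]: "joined E X u u"
  by (simp add: joined_def)

lemma joined_trans [trans]: "joined E X u v \<Longrightarrow> joined E X v w \<Longrightarrow> joined E X u w"
  by (simp add: joined_def)

lemma joined_edge: "(u, v) \<in> E \<Longrightarrow> u \<notin> X \<Longrightarrow> v \<notin> X \<Longrightarrow> joined E X u v"
  by (auto simp: joined_def)

lemma joined_sym: "sym E \<Longrightarrow> joined E X u v \<Longrightarrow> joined E X v u"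
proof -
  assume "sym E"
  then have "sym (E \<inter> (- X) \<times> (- X))" unfolding sym_def by blast
  then show "joined E X u v \<Longrightarrow> joined E X v u"
    unfolding joined_def using sym_rtrancl symD by metis
qed

lemma joined_mono:
  assumes "joined E Y u v" "E \<subseteq> E'" "X \<subseteq> Y" shows "joined E' X u v"
  using assms unfolding joined_def by (meson Compl_anti_mono Int_mono Sigma_mono rtrancl_mono subsetD)

lemma joined_image:
  assumes "joined E (f -` X) u v" shows "joined (map_prod f f ` E) X (f u) (f v)"
  using assms unfolding joined_def
proof (induction rule: rtrancl_induct)
  case (step y z)
  then have "(f y, f z) \<in> map_prod f f ` E \<inter> (- X) \<times> (- X)" by force
  with step.IH show ?case by (rule rtrancl_into_rtrancl)
qed simp

text \<open>The two bounds fit together under blow-up: if a copy contains all of four deleted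
  vertices, every hub survives and reaching some terminal is enough; otherwise the copy loses at
  most three vertices and is still connected.\<close>

locale connected_gadget =
  fixes V :: "nat set" and E :: "(nat \<times> nat) set"
  assumes fin_V: "finite V" and EV: "E \<subseteq> V \<times> V" and symE: "sym E"
    and term_V: "j < 5 \<Longrightarrow> hub j \<in> V"
    and to_terminal: "X \<subseteq> V \<Longrightarrow> card X \<le> 4 \<Longrightarrow> v \<in> V - X \<Longrightarrow> \<exists>j<5. hub j \<notin> X \<and> joined E X v (hub j)"
    and conn3: "X \<subseteq> V \<Longrightarrow> card X \<le> 3 \<Longrightarrow> u \<in> V - X \<Longrightarrow> v \<in> V - X \<Longrightarrow> joined E X u v"

text \<open>Two disjoint pairs omit one vertex of the 5-cycle. The other four form a path, and a
  path split into two classes has an edge between them. The proof runs through all cases.\<close>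

lemma cyclic_neighbours:
  fixes i i' j j' :: nat
  assumes "i < 5" "i' < 5" "j < 5" "j' < 5" "i \<noteq> i'" "j \<noteq> j'" "{i, i'} \<inter> {j, j'} = {}"
  shows "\<exists>x\<in>{i, i'}. \<exists>y\<in>{j, j'}. y = (x + 1) mod 5 \<or> x = (y + 1) mod 5"
proof -
  have "\<forall>i\<in>set [0..<5]. \<forall>i'\<in>set [0..<5]. \<forall>j\<in>set [0..<5]. \<forall>j'\<in>set [0..<5].
      i = i' \<or> j = j' \<or> i = j \<or> i = j' \<or> i' = j \<or> i' = j' \<or>
      (\<exists>x\<in>set [i, i']. \<exists>y\<in>set [j, j']. y = (x + 1) mod 5 \<or> x = (y + 1) mod 5)"
    by code_simp
  then have "i = i' \<or> j = j' \<or> i = j \<or> i = j' \<or> i' = j \<or> i' = j' \<or>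
      (\<exists>x\<in>set [i, i']. \<exists>y\<in>set [j, j']. y = (x + 1) mod 5 \<or> x = (y + 1) mod 5)"
    using assms(1-4) by (simp only: set_upt atLeastLessThan_iff Ball_def le0 simp_thms)
  then show ?thesis using assms(5-7) by auto
qed

text \<open>If four deleted vertices always leave every vertex joined to a surviving terminal, then after
  three deletions every surviving terminal is joined to a second one; two components would thus contain
  at least four terminals, and the ring through the terminals connects them.\<close>

lemma connected_gadgetI:
  assumes fin: "finite V" and EV: "E \<subseteq> V \<times> V" and symE: "sym E"
    and term_V: "\<And>j. j < 5 \<Longrightarrow> hub j \<in> V"
    and A: "\<And>X v. X \<subseteq> V \<Longrightarrow> card X \<le> 4 \<Longrightarrow> v \<in> V - X \<Longrightarrow> \<exists>j<5. hub j \<notin> X \<and> joined E X v (hub j)"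
    and ring: "\<And>j. j < 5 \<Longrightarrow> (hub j, hub ((j + 1) mod 5)) \<in> E"
    and deg: "\<And>j. j < 5 \<Longrightarrow> \<exists>N. card N = 4 \<and> hub j \<notin> N \<and> (\<forall>v\<in>N. (hub j, v) \<in> E)"
  shows "connected_gadget V E"
proof
  fix X u v assume X: "X \<subseteq> V" "card X \<le> 3" and u: "u \<in> V - X" and v: "v \<in> V - X"
  have finX: "finite X" using X fin finite_subset by blast
  have second: "\<exists>j<5. j \<noteq> i \<and> hub j \<notin> X \<and> joined E X (hub i) (hub j)" if i: "i < 5" "hub i \<notin> X" for i
  proof -
    obtain N where N: "card N = 4" "hub i \<notin> N" "\<And>v. v \<in> N \<Longrightarrow> (hub i, v) \<in> E" using deg[OF i(1)] by blast
    have "\<not> N \<subseteq> X" using card_mono[OF finX, of N] N(1) X(2) by linarith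
    then obtain w where w: "w \<in> N" "w \<notin> X" by blast
    then have e: "(hub i, w) \<in> E" "w \<noteq> hub i" using N by auto
    have wV: "w \<in> V - insert (hub i) X" using e w EV by auto
    \<comment> \<open>Deleting \<open>hub i\<close> as well stays within four deletions, and the
      terminal that the surviving neighbour \<open>w\<close> then reaches is different from
      \<open>i\<close>.\<close>
    have "card (insert (hub i) X) \<le> 4" using X(2) finX by (simp add: card_insert_if)
    then obtain j where j: "j < 5" "hub j \<notin> insert (hub i) X" "joined E (insert (hub i) X) w (hub j)"
      using A[of "insert (hub i) X" w] wV X(1) term_V[OF i(1)] by auto
    have "joined E X w (hub j)" using joined_mono[OF j(3), of E X] by blast
    moreover have "joined E X (hub i) w" using joined_edge e w i by blast
    ultimately show ?thesis using j joined_trans by (intro exI[of _ j]) auto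
  qed
  obtain i where i: "i < 5" "hub i \<notin> X" "joined E X u (hub i)" using A[OF X(1) _ u] X(2) by auto
  obtain j where j: "j < 5" "hub j \<notin> X" "joined E X v (hub j)" using A[OF X(1) _ v] X(2) by auto
  obtain i' where i': "i' < 5" "i' \<noteq> i" "hub i' \<notin> X" "joined E X (hub i) (hub i')" using second i by blast
  obtain j' where j': "j' < 5" "j' \<noteq> j" "hub j' \<notin> X" "joined E X (hub j) (hub j')" using second j by blast
  have "\<exists>x\<in>{i, i'}. \<exists>y\<in>{j, j'}. joined E X (hub x) (hub y)"
  proof (cases "{i, i'} \<inter> {j, j'} = {}")
    case False then obtain x where "x \<in> {i, i'}" "x \<in> {j, j'}" by blast
    then show ?thesis using joined_refl by blast
  next
    case True
    then obtain x y where xy: "x \<in> {i, i'}" "y \<in> {j, j'}" "y = (x + 1) mod 5 \<or> x = (y + 1) mod 5"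
      using cyclic_neighbours[of i i' j j'] i i' j j' by blast
    have b: "x < 5" "y < 5" "hub x \<notin> X" "hub y \<notin> X" using xy i i' j j' by auto
    have "joined E X (hub x) (hub y)"
      using xy(3)
    proof
      assume "y = (x + 1) mod 5" then show ?thesis using ring[OF b(1)] b joined_edge by auto
    next
      assume "x = (y + 1) mod 5" then show ?thesis using ring[OF b(2)] b joined_edge joined_sym[OF symE] by auto
    qed
    then show ?thesis using xy by blast
  qed
  then obtain x y where xy: "x \<in> {i, i'}" "y \<in> {j, j'}" "joined E X (hub x) (hub y)" by blast
  have "joined E X u (hub x)" using xy(1) i(3) i'(4) joined_trans by blast
  moreover have "joined E X (hub y) v"
    using xy(2) j(3) j'(4) joined_trans joined_sym[OF symE] by blast
  ultimately show "joined E X u v" using xy(3) joined_trans by blast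
qed (rule fin EV symE term_V A; assumption)+

section \<open>The template with every copy contracted to one node, numbered after the hubs\<close>

definition node_of :: "nat \<Rightarrow> nat \<Rightarrow> nat" where
  "node_of s v = (case sum_decode v of Inl a \<Rightarrow> a | Inr m \<Rightarrow> s + fst (prod_decode m))"

lemma node_of_simps [simp]: "node_of s (hub a) = a" "node_of s (cpy i v) = s + i"
  by (simp_all add: node_of_def hub_def cpy_def)

definition node_adj :: "nat \<Rightarrow> (nat \<times> nat) set \<Rightarrow> nat \<Rightarrow> nat \<Rightarrow> bool" where
  "node_adj s F m n \<longleftrightarrow> (\<exists>(x, y)\<in>F. node_of s x = m \<and> node_of s y = n)"

text \<open>The lists omit the common start \<open>v\<close>. Since they are disjoint as lists of
  contracted nodes, one deleted vertex, wherever it lies in a copy, spoils at most one of the five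
  paths.\<close>

definition fan_to_terminals :: "nat \<Rightarrow> (nat \<times> nat) set \<Rightarrow> nat \<Rightarrow> nat list list \<Rightarrow> bool" where
  "fan_to_terminals s F v ps \<longleftrightarrow> length ps = 5 \<and> distinct (concat ps) \<and>
     (\<forall>p\<in>set ps. p \<noteq> [] \<and> successively (node_adj s F) (v # p) \<and> last p < 5)"

text \<open>Pigeonhole: an element of \<open>N\<close> lies in at most one of the disjoint
  lists.\<close>

lemma disjoint_list_avoids:
  "distinct (concat ps) \<Longrightarrow> finite N \<Longrightarrow> card N < length ps \<Longrightarrow> \<exists>p\<in>set ps. set p \<inter> N = {}"
proof (induction ps arbitrary: N)
  case (Cons p ps)
  show ?case
  proof (cases "set p \<inter> N = {}")
    case False
    then have "card (N - set p) < card N" using Cons.prems(2) by (intro psubset_card_mono) auto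
    then obtain r where r: "r \<in> set ps" "set r \<inter> (N - set p) = {}"
      using Cons.IH[of "N - set p"] Cons.prems by auto
    moreover have "set r \<inter> set p = {}" using Cons.prems(1) r(1) by fastforce
    ultimately have "r \<in> set (p # ps) \<and> set r \<inter> N = {}" by auto
    then show ?thesis by blast
  qed auto
qed simp

text \<open>\<open>w i j\<close> is the hub wired to terminal \<open>j\<close> of copy
  \<open>i\<close>. The condition \<open>hubbed\<close> forbids edges between copies; it is what
  makes a path pass through a hub when it changes the copy.\<close>

locale template =
  fixes s t :: nat and F :: "(nat \<times> nat) set" and w :: "nat \<Rightarrow> nat \<Rightarrow> nat"
  assumes nodes: "F \<subseteq> template_nodes s t \<times> template_nodes s t" and F_sym: "sym F"
    and hubbed: "(u, v) \<in> F \<Longrightarrow> u \<in> hub ` {..<s} \<or> v \<in> hub ` {..<s}"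
    and wire: "i < t \<Longrightarrow> j < 5 \<Longrightarrow> (cpy i (hub j), hub (w i j)) \<in> F"
    and wire_inj: "i < t \<Longrightarrow> inj_on (w i) {..<5}"

locale template_gadget = template + connected_gadget
begin

abbreviation "V' \<equiv> blow_verts s t V"
abbreviation "E' \<equiv> blow_edges t F E"

lemma V'_cases:
  assumes "x \<in> V'"
  obtains (hub) a where "a < s" "x = hub a" | (cpy) i y where "i < t" "y \<in> V" "x = cpy i y"
  using assms by (auto simp: blow_verts_def)

lemma nodes_V': "template_nodes s t \<subseteq> V'"
  using term_V by (auto simp: template_nodes_def blow_verts_def)

lemma F_V': "(u, v) \<in> F \<Longrightarrow> u \<in> V' \<and> v \<in> V'"
  using nodes nodes_V' by blast

lemma wire_hub: assumes "i < t" "j < 5" shows "w i j < s"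
proof -
  have "hub (w i j) \<in> template_nodes s t" using wire[OF assms] nodes by auto
  then show ?thesis by (auto simp: template_nodes_def)
qed

lemma finite_V': "finite V'" using fin_V by (simp add: blow_verts_def)

lemma E'_V': "E' \<subseteq> V' \<times> V'"
proof clarify
  fix u v assume "(u, v) \<in> E'"
  then consider "(u, v) \<in> F" | i x y where "i < t" "(x, y) \<in> E" "u = cpy i x" "v = cpy i y"
    by (auto simp: blow_edges_def)
  then show "u \<in> V' \<and> v \<in> V'"
  proof cases
    case 1 then show ?thesis using F_V' by blast
  next
    case (2 i x y)
    then have "x \<in> V" "y \<in> V" using EV by auto
    then show ?thesis using 2 by (auto simp: blow_verts_def)
  qed
qed

lemma sym_E': "sym E'"
proof (rule symI)
  fix u v assume "(u, v) \<in> E'"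
  then consider "(u, v) \<in> F" | i x y where "i < t" "(x, y) \<in> E" "u = cpy i x" "v = cpy i y"
    by (auto simp: blow_edges_def)
  then show "(v, u) \<in> E'"
  proof cases
    case 1 then show ?thesis using symD[OF F_sym] by (simp add: blow_edges_def)
  next
    case (2 i x y)
    have "(cpy i y, cpy i x) \<in> map_prod (cpy i) (cpy i) ` E" using symD[OF symE 2(2)] by force
    then have "(v, u) \<in> (\<Union>i<t. map_prod (cpy i) (cpy i) ` E)"
      unfolding 2(3,4) by (rule UN_I[rotated]) (use 2(1) in simp)
    then show ?thesis unfolding blow_edges_def by (rule UnI2)
  qed
qed

lemma joined_copy:
  assumes "joined E (cpy i -` X) u v" "i < t" shows "joined E' X (cpy i u) (cpy i v)"
  using joined_mono[OF joined_image[OF assms(1)], of E' X] assms(2) by (auto simp: blow_edges_def)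

lemma vimage_copy:
  assumes "X \<subseteq> V'" "i < t"
  shows "cpy i -` X \<subseteq> V" "card (cpy i -` X) \<le> card X"
proof -
  show "cpy i -` X \<subseteq> V" using assms by (auto simp: blow_verts_def)
  have "finite X" using assms(1) finite_V' finite_subset by blast
  then show "card (cpy i -` X) \<le> card X"
    using card_vimage_inj_on_le[of "cpy i" UNIV X] by (simp add: inj_cpy inj_on_def)
qed

text \<open>If the copy has lost at most three vertices, it is connected, and four deletions cannot
  block all five wires, as these have distinct ends. Otherwise the four deletions all lie in the
  copy, no hub is lost, and any surviving terminal leads out.\<close>

lemma copy_to_hub:
  assumes X: "X \<subseteq> V'" "card X \<le> 4" and i: "i < t" and v: "v \<in> V" "cpy i v \<notin> X"
  shows "\<exists>a<s. hub a \<notin> X \<and> joined E' X (cpy i v) (hub a)"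
proof -
  define Y where "Y = cpy i -` X"
  have finX: "finite X" using X finite_V' finite_subset by blast
  have Y: "Y \<subseteq> V" "card Y \<le> card X" using vimage_copy[OF X(1) i] by (simp_all add: Y_def)
  have finY: "finite Y" using Y fin_V finite_subset by blast
  have vY: "v \<in> V - Y" using v by (simp add: Y_def)
  have "\<exists>j<5. hub j \<notin> Y \<and> hub (w i j) \<notin> X \<and> joined E Y v (hub j)"
  proof (cases "card Y \<le> 3")
    case True
    define B where "B = {j. j < 5 \<and> (hub j \<in> Y \<or> hub (w i j) \<in> X)}"
    \<comment> \<open>Sends the index of a blocked wire to a deleted end of it; distinct wires share
      no end, so this is injective.\<close>
    define g where "g = (\<lambda>j. if hub j \<in> Y then cpy i (hub j) else hub (w i j))"
    have "inj_on g B" using wire_inj[OF i] by (auto simp: g_def B_def inj_on_def)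
    moreover have "g ` B \<subseteq> X" by (auto simp: g_def B_def Y_def)
    ultimately have "card B \<le> card X" using finX by (simp add: card_inj_on_le)
    then have "card B < card {..<5::nat}" using X(2) by simp
    then have "\<not> {..<5} \<subseteq> B" using card_mono[of B "{..<5}"] by (auto simp: B_def)
    then obtain j where j: "j < 5" "hub j \<notin> Y" "hub (w i j) \<notin> X" by (auto simp: B_def)
    moreover have "joined E Y v (hub j)" using conn3[OF Y(1) True vY] j term_V by blast
    ultimately show ?thesis by blast
  next
    case False
    then have "card (cpy i ` Y) = card X"
      using Y(2) X(2) card_image[of "cpy i" Y] by (simp add: inj_on_def)
    then have "X = cpy i ` Y" using card_subset_eq[of X "cpy i ` Y"] finX by (auto simp: Y_def)
    then have "hub a \<notin> X" for a by auto
    moreover obtain j where "j < 5" "hub j \<notin> Y" "joined E Y v (hub j)"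
      using to_terminal[OF Y(1) _ vY] Y(2) X(2) by auto
    ultimately show ?thesis by blast
  qed
  then obtain j where j: "j < 5" "hub j \<notin> Y" "hub (w i j) \<notin> X" "joined E Y v (hub j)" by blast
  have "joined E' X (cpy i v) (cpy i (hub j))" using joined_copy[OF _ i] j(4) by (simp add: Y_def)
  moreover have "joined E' X (cpy i (hub j)) (hub (w i j))"
    using wire[OF i j(1)] j(2,3) by (intro joined_edge) (auto simp: blow_edges_def Y_def)
  ultimately have "joined E' X (cpy i v) (hub (w i j))" by (rule joined_trans)
  then show ?thesis using wire_hub[OF i j(1)] j(3) by blast
qed

lemma joined_same_node:
  assumes "u \<in> V'" "v \<in> V'" "node_of s u = node_of s v" "X \<subseteq> V'" "node_of s u \<notin> node_of s ` X"
  shows "joined E' X u v"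
  using assms(1)
proof (cases rule: V'_cases)
  case h: (hub a)
  show ?thesis using assms(2)
  proof (cases rule: V'_cases)
    case (hub b) then show ?thesis using h assms(3) by simp
  next
    case (cpy i x) then show ?thesis using h assms(3) by simp
  qed
next
  case c: (cpy i x)
  show ?thesis using assms(2)
  proof (cases rule: V'_cases)
    case (hub b) then show ?thesis using c assms(3) by simp
  next
    case (cpy j y)
    have ji: "j = i" using cpy c assms(3) by simp
    have e: "cpy i -` X = {}" using assms(5) c by force
    have "joined E (cpy i -` X) x y" unfolding e by (rule conn3) (use c cpy in auto)
    then show ?thesis using joined_copy c cpy ji by auto
  qed
qed

text \<open>A copy without deleted vertices is connected, so a walk through untouched contracted
  nodes lifts: inside each copy it is continued from the end of one template edge to the start of
  the next.\<close>

lemma joined_along_nodes: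
  assumes "successively (node_adj s F) (m # p)" "X \<subseteq> V'" "u \<in> V'" "u \<notin> X" "node_of s u = m"
    "m \<notin> node_of s ` X" "set p \<inter> node_of s ` X = {}" "z \<in> V'" "node_of s z = last (m # p)"
  shows "joined E' X u z"
  using assms
proof (induction p arbitrary: m u)
  case Nil then show ?case using joined_same_node by auto
next
  case (Cons n p)
  obtain x y where xy: "(x, y) \<in> F" "node_of s x = m" "node_of s y = n"
    using Cons.prems(1) by (auto simp: node_adj_def)
  have xyV: "x \<in> V'" "y \<in> V'" using F_V' xy by auto
  have xX: "x \<notin> X" "y \<notin> X" using xy Cons.prems(6,7) by auto
  have "joined E' X u x" using joined_same_node[of u x X] xy xyV Cons.prems by simp
  also have "joined E' X x y" using xy(1) xX by (intro joined_edge) (auto simp: blow_edges_def)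
  also have "joined E' X y z" using Cons.IH[of n y] Cons.prems xyV xy xX by auto
  finally show ?case .
qed

text \<open>At most four contracted nodes contain deleted vertices, so one of the five disjoint
  paths of the fan is untouched.\<close>

lemma hub_to_terminal:
  assumes X: "X \<subseteq> V'" "card X \<le> 4" and a: "a < s" "hub a \<notin> X" "5 \<le> s"
    and fan: "fan_to_terminals s F a ps"
  shows "\<exists>j<5. hub j \<notin> X \<and> joined E' X (hub a) (hub j)"
proof -
  have finX: "finite X" using X finite_V' finite_subset by blast
  have aX: "a \<notin> node_of s ` X"
  proof
    assume "a \<in> node_of s ` X"
    then obtain x where x: "x \<in> X" "node_of s x = a" by auto
    then have "x \<in> V'" using X by auto
    then have "x = hub a" by (cases rule: V'_cases) (use x a in auto)
    then show False using x a by simp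
  qed
  have "card (node_of s ` X) < length ps"
    using card_image_le[OF finX, of "node_of s"] X(2) fan by (simp add: fan_to_terminals_def)
  then obtain p where p: "p \<in> set ps" "set p \<inter> node_of s ` X = {}"
    using disjoint_list_avoids[of ps "node_of s ` X"] fan finX by (auto simp: fan_to_terminals_def)
  have p': "p \<noteq> []" "successively (node_adj s F) (a # p)" "last p < 5"
    using fan p(1) by (auto simp: fan_to_terminals_def)
  have "hub (last p) \<in> V'" "hub a \<in> V'" using p' a by (auto simp: blow_verts_def)
  moreover have "hub (last p) \<notin> X"
  proof
    assume "hub (last p) \<in> X"
    then have "last p \<in> node_of s ` X" by force
    then show False using p(2) last_in_set[OF p'(1)] by blast
  qed
  ultimately show ?thesis using joined_along_nodes[OF p'(2) X(1), of "hub a" "hub (last p)"] p p' a aX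
    by (intro exI[of _ "last p"]) auto
qed

lemma connected_gadget_blow:
  assumes s5: "5 \<le> s" and fans: "\<And>a. 5 \<le> a \<Longrightarrow> a < s \<Longrightarrow> \<exists>ps. fan_to_terminals s F a ps"
    and ring: "\<And>j. j < 5 \<Longrightarrow> (hub j, hub ((j + 1) mod 5)) \<in> F"
    and deg: "\<And>j. j < 5 \<Longrightarrow> \<exists>N. card N = 4 \<and> hub j \<notin> N \<and> (\<forall>v\<in>N. (hub j, v) \<in> F)"
  shows "connected_gadget V' E'"
proof (rule connected_gadgetI)
  have FE: "F \<subseteq> E'" by (auto simp: blow_edges_def)
  show "finite V'" "E' \<subseteq> V' \<times> V'" "sym E'" by (rule finite_V' E'_V' sym_E')+
  show "hub j \<in> V'" if "j < 5" for j using that s5 by (auto simp: blow_verts_def)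
  show "(hub j, hub ((j + 1) mod 5)) \<in> E'" if "j < 5" for j using ring[OF that] FE by blast
  show "\<exists>N. card N = 4 \<and> hub j \<notin> N \<and> (\<forall>v\<in>N. (hub j, v) \<in> E')" if "j < 5" for j
    using deg[OF that] FE by blast
  fix X v assume X: "X \<subseteq> V'" "card X \<le> 4" and v: "v \<in> V' - X"
  have h: "\<exists>j<5. hub j \<notin> X \<and> joined E' X (hub a) (hub j)" if a: "a < s" "hub a \<notin> X" for a
  proof (cases "a < 5")
    case True then show ?thesis using a by (intro exI[of _ a]) auto
  next
    case False
    then obtain ps where "fan_to_terminals s F a ps" using fans a by fastforce
    then show ?thesis using hub_to_terminal[OF X a s5] by blast
  qed
  have "v \<in> V'" using v by blast
  then show "\<exists>j<5. hub j \<notin> X \<and> joined E' X v (hub j)"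
  proof (cases rule: V'_cases)
    case (hub a) then show ?thesis using h v by blast
  next
    case (cpy i x)
    then obtain a where "a < s" "hub a \<notin> X" "joined E' X v (hub a)" using copy_to_hub[OF X, of i x] v by blast
    moreover obtain j where "j < 5" "hub j \<notin> X" "joined E' X (hub a) (hub j)" using h calculation by blast
    ultimately have "joined E' X v (hub j)" using joined_trans by metis
    then show ?thesis using \<open>j < 5\<close> \<open>hub j \<notin> X\<close> by blast
  qed
qed

text \<open>Serves the outermost template, whose five hubs form \<open>K5\<close>: every vertex
  reaches a surviving hub, and surviving hubs are adjacent, which replaces the fans.\<close>

lemma joined_if_hubs_complete:
  assumes K: "\<And>a b. a < s \<Longrightarrow> b < s \<Longrightarrow> a \<noteq> b \<Longrightarrow> (hub a, hub b) \<in> F"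
    and X: "X \<subseteq> V'" "card X \<le> 4" and uv: "u \<in> V' - X" "v \<in> V' - X"
  shows "joined E' X u v"
proof -
  have h: "\<exists>a<s. hub a \<notin> X \<and> joined E' X v (hub a)" if "v \<in> V' - X" for v
  proof -
    have "v \<in> V'" using that by blast
    then show ?thesis
    proof (cases rule: V'_cases)
      case (hub a) then show ?thesis using that by auto
    next
      case (cpy i x) then show ?thesis using copy_to_hub[OF X, of i x] that by blast
    qed
  qed
  obtain a where a: "a < s" "hub a \<notin> X" "joined E' X u (hub a)" using h[OF uv(1)] by blast
  obtain b where b: "b < s" "hub b \<notin> X" "joined E' X v (hub b)" using h[OF uv(2)] by blast
  have "joined E' X (hub a) (hub b)"
  proof (cases "a = b")
    case False
    then have "(hub a, hub b) \<in> E'" using K a b by (auto simp: blow_edges_def)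
    then show ?thesis using joined_edge a b by blast
  qed simp
  from joined_trans[OF joined_trans[OF a(3) this] joined_sym[OF sym_E' b(3)]] show ?thesis .
qed

end

section \<open>Long paths\<close>

definition path_bound :: "nat set \<Rightarrow> (nat \<times> nat) set \<Rightarrow> nat \<Rightarrow> bool" where
  "path_bound V E l \<longleftrightarrow> (\<forall>xs. set xs \<subseteq> V \<longrightarrow> distinct xs \<longrightarrow> successively (\<lambda>u v. (u, v) \<in> E) xs \<longrightarrow> length xs \<le> l)"

context template
begin

text \<open>An edge between vertices of copies has no hub as an end, hence comes from the gadget and
  stays in its copy.\<close>

lemma path_within_copy:
  assumes "set xs \<subseteq> (\<Union>i<t. cpy i ` V)" "successively (\<lambda>u v. (u, v) \<in> blow_edges t F E) xs" "xs \<noteq> []"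
  shows "\<exists>i ys. xs = map (cpy i) ys \<and> set ys \<subseteq> V \<and> successively (\<lambda>u v. (u, v) \<in> E) ys"
  using assms
proof (induction xs)
  case (Cons x xs)
  obtain i v where x: "x = cpy i v" "v \<in> V" using Cons.prems(1) by auto
  show ?case
  proof (cases xs)
    case Nil then show ?thesis using x by (intro exI[of _ i] exI[of _ "[v]"]) auto
  next
    case (Cons y zs)
    have "set xs \<subseteq> (\<Union>i<t. cpy i ` V)" "successively (\<lambda>u v. (u, v) \<in> blow_edges t F E) xs" "xs \<noteq> []"
      using Cons.prems Cons by (simp_all add: successively_Cons)
    then obtain j ys where ys: "xs = map (cpy j) ys" "set ys \<subseteq> V" "successively (\<lambda>u v. (u, v) \<in> E) ys"
      using Cons.IH by blast
    obtain b bs where b: "ys = b # bs" using ys(1) Cons by (cases ys) auto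
    have xy: "(x, y) \<in> blow_edges t F E" "y = cpy j b" using Cons.prems(2) Cons ys(1) b by auto
    have "(x, y) \<notin> F" using hubbed[of x y] x xy by auto
    then have "j = i \<and> (v, b) \<in> E" using xy x by (auto simp: blow_edges_def)
    then show ?thesis using x ys b by (intro exI[of _ i] exI[of _ "v # ys"]) auto
  qed
qed simp

lemma path_bound_blow:
  assumes pb: "path_bound V E l"
  shows "path_bound (blow_verts s t V) (blow_edges t F E) (s + (s + 1) * l)"
proof -
  let ?H = "\<lambda>x. x \<in> hub ` {..<s}"
  \<comment> \<open>The bound counts the hubs that actually occur, so that the induction can cut off
    the part up to and including the first hub.\<close>
  have main: "length xs \<le> length (filter ?H xs) + (length (filter ?H xs) + 1) * l"
    if "set xs \<subseteq> blow_verts s t V" "distinct xs" "successively (\<lambda>u v. (u, v) \<in> blow_edges t F E) xs" for xs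
    using that
  proof (induction xs rule: length_induct)
    case (1 xs)
    define ys where "ys = takeWhile (\<lambda>x. \<not> ?H x) xs"
    define zs where "zs = dropWhile (\<lambda>x. \<not> ?H x) xs"
    have xs: "xs = ys @ zs" by (simp add: ys_def zs_def)
    have ysH: "\<not> ?H x" if "x \<in> set ys" for x using set_takeWhileD[of x _ xs] that unfolding ys_def by blast
    have ysl: "length ys \<le> l"
    proof (cases "ys = []")
      case False
      have "set ys \<subseteq> (\<Union>i<t. cpy i ` V)"
      proof
        fix x assume "x \<in> set ys"
        then have "x \<in> blow_verts s t V" "\<not> ?H x" using "1.prems"(1) xs ysH by auto
        then show "x \<in> (\<Union>i<t. cpy i ` V)" unfolding blow_verts_def by blast
      qed
      moreover have "successively (\<lambda>u v. (u, v) \<in> blow_edges t F E) ys"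
        using "1.prems"(3) xs by (simp add: successively_append_iff)
      ultimately obtain i us where us: "ys = map (cpy i) us" "set us \<subseteq> V" "successively (\<lambda>u v. (u, v) \<in> E) us"
        using path_within_copy False by blast
      have "distinct us" using "1.prems"(2) xs us by (simp add: distinct_map)
      then show ?thesis using pb us by (simp add: path_bound_def)
    qed simp
    have fys: "filter ?H ys = []" using ysH by (simp add: filter_empty_conv)
    show ?case
    proof (cases zs)
      case Nil then show ?thesis using xs ysl by simp
    next
      case (Cons z us)
      have "?H z" using Cons unfolding zs_def dropWhile_eq_Cons_conv by blast
      have "length us < length xs" using xs Cons by simp
      moreover have "set us \<subseteq> blow_verts s t V" "distinct us" using "1.prems" xs Cons by auto
      moreover have "successively (\<lambda>u v. (u, v) \<in> blow_edges t F E) us"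
        using "1.prems"(3) xs Cons by (auto simp: successively_append_iff successively_Cons)
      ultimately have "length us \<le> length (filter ?H us) + (length (filter ?H us) + 1) * l"
        using "1.IH" by blast
      moreover have "filter ?H xs = z # filter ?H us" using xs Cons fys \<open>?H z\<close> by simp
      ultimately show ?thesis using xs Cons ysl by simp
    qed
  qed
  show ?thesis unfolding path_bound_def
  proof (intro allI impI)
    fix xs assume xs: "set xs \<subseteq> blow_verts s t V" "distinct xs" "successively (\<lambda>u v. (u, v) \<in> blow_edges t F E) xs"
    have "length (filter ?H xs) = card (set (filter ?H xs))" using distinct_card[OF distinct_filter[OF xs(2)]] by metis
    also have "\<dots> \<le> card (hub ` {..<s})" by (rule card_mono) auto
    also have "\<dots> \<le> s" using card_image_le[of "{..<s}" hub] by simp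
    finally have h: "length (filter ?H xs) \<le> s" .
    have "length xs \<le> length (filter ?H xs) + (length (filter ?H xs) + 1) * l" by (rule main[OF xs])
    also have "\<dots> \<le> s + (s + 1) * l" using h by (intro add_mono mult_mono) auto
    finally show "length xs \<le> s + (s + 1) * l" .
  qed
qed

end

lemma card_blow_verts:
  assumes "finite V" shows "card (blow_verts s t V) = s + t * card V"
proof -
  have "card (\<Union>i<t. cpy i ` V) = (\<Sum>i<t. card (cpy i ` V))"
    by (rule card_UN_disjoint) (use assms in auto)
  also have "\<dots> = t * card V" by (simp add: card_image inj_on_def)
  finally have c: "card (\<Union>i<t. cpy i ` V) = t * card V" .
  have h: "card (hub ` {..<s}) = s" by (simp add: card_image inj_on_def)
  have "card (blow_verts s t V) = card (hub ` {..<s}) + card (\<Union>i<t. cpy i ` V)"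
    unfolding blow_verts_def by (rule card_Un_disjoint) (use assms in auto)
  then show ?thesis using c h by simp
qed

section \<open>Checking a template with integer coordinates\<close>

text \<open>The label \<open>(0, a)\<close> stands for the hub \<open>a\<close>, and \<open>(Suc i, j)\<close> for terminal \<open>j\<close> of copy \<open>i\<close>.
  The checks are written with conditionals in place of conjunctions and disjunctions because the
  simplifier evaluates a branch only after its condition.\<close>

type_synonym label = "nat \<times> nat"
type_synonym point = "int \<times> int"
type_synonym box = "int \<times> int \<times> int \<times> int"
type_synonym shape = "nat \<times> label list \<times> box \<times> point list"

fun vertex_of :: "label \<Rightarrow> nat" where
  "vertex_of (0, a) = hub a"
| "vertex_of (Suc i, j) = cpy i (hub j)"

lemma vertex_of_eq [simp]: "vertex_of l = vertex_of m \<longleftrightarrow> l = m"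
  by (cases l rule: vertex_of.cases; cases m rule: vertex_of.cases) auto

definition pt :: "point \<Rightarrow> complex" where
  "pt z = Complex (of_int (fst z)) (of_int (snd z))"

text \<open>Twice the signed area of the triangle, positive if the third point lies to the left of
  the directed line through the first two.\<close>

fun orient :: "point \<Rightarrow> point \<Rightarrow> point \<Rightarrow> int" where
  "orient (ax, ay) (bx, by') (x, y) = (bx - ax) * (y - ay) - (by' - ay) * (x - ax)"

fun all_left :: "point \<Rightarrow> point \<Rightarrow> point list \<Rightarrow> bool" where
  "all_left a b [] = True"
| "all_left a b (z # zs) = (if 0 \<le> orient a b z then all_left a b zs else False)"

fun all_right :: "point \<Rightarrow> point \<Rightarrow> point list \<Rightarrow> bool" where
  "all_right a b [] = True"
| "all_right a b (z # zs) = (if orient a b z < 0 then all_right a b zs else False)"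

text \<open>The tests are asymmetric because the candidates are side lines of \<open>A\<close>
  itself: \<open>A\<close> touches such a line and lies weakly to its left, so \<open>B\<close> has
  to lie strictly to the right.\<close>

fun line_separates :: "(point \<times> point) list \<Rightarrow> point list \<Rightarrow> point list \<Rightarrow> bool" where
  "line_separates [] A B = False"
| "line_separates ((a, b) # ls) A B =
     (if all_right a b B then if all_left a b A then True else line_separates ls A B
      else line_separates ls A B)"

text \<open>Candidates for a separating axis. The corners of a pentagon are expected
  counterclockwise; a segment contributes its line in both directions because \<open>B\<close> may
  lie on either side of it; a single point contributes none.\<close>

fun side_lines :: "point list \<Rightarrow> (point \<times> point) list" where
  "side_lines [a, b] = [(a, b), (b, a)]"
| "side_lines [a, b, c, d, e] = [(a, b), (b, c), (c, d), (d, e), (e, a)]"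
| "side_lines zs = []"

fun box_apart :: "box \<Rightarrow> box \<Rightarrow> bool" where
  "box_apart (x0, x1, y0, y1) (u0, u1, v0, v1) =
     (if x1 < u0 then True else if u1 < x0 then True else if y1 < v0 then True else v1 < y0)"

fun bounding_box :: "point list \<Rightarrow> box" where
  "bounding_box [] = (0, 0, 0, 0)"
| "bounding_box [(x, y)] = (x, x, y, y)"
| "bounding_box ((x, y) # z # zs) = (case bounding_box (z # zs) of (x0, x1, y0, y1) \<Rightarrow>
     (if x < x0 then x else x0, if x1 < x then x else x1, if y < y0 then y else y0, if y1 < y then y else y1))"

fun is_label_in :: "label \<Rightarrow> label list \<Rightarrow> bool" where
  "is_label_in (a, b) [] = False"
| "is_label_in (a, b) ((c, d) # ls) =
     (if a = c then if b = d then True else is_label_in (a, b) ls else is_label_in (a, b) ls)"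

lemma is_label_in_iff: "is_label_in l ls \<longleftrightarrow> l \<in> set ls"
  by (cases l; induction ls) (auto split: if_splits)

fun labels_meet :: "label list \<Rightarrow> label list \<Rightarrow> bool" where
  "labels_meet [] ms = False"
| "labels_meet (l # ls) ms = (if is_label_in l ms then True else labels_meet ls ms)"

text \<open>Shapes with a common label meet there anyway and are exempt from separation. That they
  meet nowhere else is the matter of \<open>link_touches\<close> for a link and a blob, and follows
  for two links because they are not parallel. A common nonzero tag exempts two links that are to
  cross.\<close>

fun compatible_shapes :: "shape \<Rightarrow> shape \<Rightarrow> bool" where
  "compatible_shapes (k, ls, bx, A) (k', ms, bx', B) =
     (if box_apart bx bx' then True
      else if labels_meet ls ms then ls \<noteq> ms
      else if k = k' then if k = 0 then if line_separates (side_lines A) A B then True else line_separates (side_lines B) B A else True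
      else if line_separates (side_lines A) A B then True else line_separates (side_lines B) B A)"

fun compatible_all :: "shape \<Rightarrow> shape list \<Rightarrow> bool" where
  "compatible_all x [] = True"
| "compatible_all x (y # ys) = (if compatible_shapes x y then compatible_all x ys else False)"

fun compatible_lists :: "shape list \<Rightarrow> shape list \<Rightarrow> bool" where
  "compatible_lists [] ys = True"
| "compatible_lists (x # xs) ys = (if compatible_all x ys then compatible_lists xs ys else False)"

fun pairwise_compatible :: "shape list \<Rightarrow> bool" where
  "pairwise_compatible [] = True"
| "pairwise_compatible (x # xs) = (if compatible_all x xs then pairwise_compatible xs else False)"

text \<open>A group carries a bounding box of all its shapes, so that two distant groups are settled
  by a single comparison.\<close>

type_synonym group = "box \<times> shape list"

fun groups_apart :: "group \<Rightarrow> group list \<Rightarrow> bool" where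
  "groups_apart g [] = True"
| "groups_apart (bx, xs) ((bx', ys) # gs) =
     (if box_apart bx bx' then groups_apart (bx, xs) gs
      else if compatible_lists xs ys then groups_apart (bx, xs) gs else False)"

fun groups_ok :: "group list \<Rightarrow> bool" where
  "groups_ok [] = True"
| "groups_ok ((bx, xs) # gs) =
     (if pairwise_compatible xs then if groups_apart (bx, xs) gs then groups_ok gs else False else False)"

fun mk_shape :: "nat \<Rightarrow> label list \<Rightarrow> point list \<Rightarrow> shape" where
  "mk_shape k ls ps = (k, ls, bounding_box ps, ps)"

fun mk_group :: "shape list \<Rightarrow> group" where
  "mk_group xs = (bounding_box (concat (map (\<lambda>(_, _, _, ps). ps) xs)), xs)"

section \<open>From integer tests to disjoint convex hulls\<close>

definition point_hull :: "point list \<Rightarrow> complex set" where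
  "point_hull A = convex hull (pt ` set A)"

lemma affine_le_hull:
  assumes "\<And>z. z \<in> set A \<Longrightarrow> a * of_int (fst z) + b * of_int (snd z) \<le> (c::real)" "z \<in> point_hull A"
  shows "a * Re z + b * Im z \<le> c"
proof -
  have "convex {z. a * Re z + b * Im z \<le> c}"
  proof -
    have "{z. a * Re z + b * Im z \<le> c} = {z. Complex a b \<bullet> z \<le> c}" by (auto simp: inner_complex_def)
    then show ?thesis by (simp add: convex_halfspace_le)
  qed
  moreover have "pt ` set A \<subseteq> {z. a * Re z + b * Im z \<le> c}" using assms(1) by (auto simp: pt_def)
  ultimately have "point_hull A \<subseteq> {z. a * Re z + b * Im z \<le> c}" unfolding point_hull_def by (intro hull_minimal)
  then show ?thesis using assms(2) by blast
qed

lemma affine_less_hull: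
  assumes "\<And>z. z \<in> set A \<Longrightarrow> a * of_int (fst z) + b * of_int (snd z) < (c::real)" "z \<in> point_hull A"
  shows "a * Re z + b * Im z < c"
proof -
  have "convex {z. a * Re z + b * Im z < c}"
  proof -
    have "{z. a * Re z + b * Im z < c} = {z. Complex a b \<bullet> z < c}" by (auto simp: inner_complex_def)
    then show ?thesis by (simp add: convex_halfspace_lt)
  qed
  moreover have "pt ` set A \<subseteq> {z. a * Re z + b * Im z < c}" using assms(1) by (auto simp: pt_def)
  ultimately have "point_hull A \<subseteq> {z. a * Re z + b * Im z < c}" unfolding point_hull_def by (intro hull_minimal)
  then show ?thesis using assms(2) by blast
qed

text \<open>The function \<open>orient\<close> extended to arbitrary points of the plane. It is
  affine in \<open>z\<close>, so its sign at the corners carries over to the hull.\<close>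

definition corient :: "point \<Rightarrow> point \<Rightarrow> complex \<Rightarrow> real" where
  "corient a b z = of_int (fst b - fst a) * (Im z - of_int (snd a)) - of_int (snd b - snd a) * (Re z - of_int (fst a))"

lemma corient_pt: "corient a b (pt z) = of_int (orient a b z)"
  by (cases a; cases b; cases z) (simp add: corient_def pt_def)

lemma all_left_hull:
  assumes "\<And>z. z \<in> set A \<Longrightarrow> 0 \<le> orient a b z" "z \<in> point_hull A" shows "0 \<le> corient a b z"
proof -
  let ?u = "of_int (snd b - snd a) :: real" and ?v = "- of_int (fst b - fst a) :: real"
  have "?u * Re z + ?v * Im z \<le> ?u * of_int (fst a) + ?v * of_int (snd a)"
  proof (rule affine_le_hull[OF _ assms(2)])
    fix z assume "z \<in> set A"
    then have "0 \<le> corient a b (pt z)" using assms(1) by (simp add: corient_pt)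
    then show "?u * of_int (fst z) + ?v * of_int (snd z) \<le> ?u * of_int (fst a) + ?v * of_int (snd a)"
      by (simp add: corient_def pt_def algebra_simps)
  qed
  then show ?thesis by (simp add: corient_def algebra_simps)
qed

lemma all_right_hull:
  assumes "\<And>z. z \<in> set A \<Longrightarrow> orient a b z < 0" "z \<in> point_hull A" shows "corient a b z < 0"
proof -
  let ?u = "- of_int (snd b - snd a) :: real" and ?v = "of_int (fst b - fst a) :: real"
  have "?u * Re z + ?v * Im z < ?u * of_int (fst a) + ?v * of_int (snd a)"
  proof (rule affine_less_hull[OF _ assms(2)])
    fix z assume "z \<in> set A"
    then have "corient a b (pt z) < 0" using assms(1) by (simp add: corient_pt)
    then show "?u * of_int (fst z) + ?v * of_int (snd z) < ?u * of_int (fst a) + ?v * of_int (snd a)"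
      by (simp add: corient_def pt_def algebra_simps)
  qed
  then show ?thesis by (simp add: corient_def algebra_simps)
qed

lemma all_left_iff: "all_left a b A \<longleftrightarrow> (\<forall>z\<in>set A. 0 \<le> orient a b z)"
  by (induction A) auto

lemma all_right_iff: "all_right a b A \<longleftrightarrow> (\<forall>z\<in>set A. orient a b z < 0)"
  by (induction A) auto

lemma line_separates_disjoint: "line_separates ls A B \<Longrightarrow> point_hull A \<inter> point_hull B = {}"
proof (induction ls)
  case (Cons l ls)
  obtain a b where l: "l = (a, b)" by (cases l)
  show ?case
  proof (cases "all_right a b B \<and> all_left a b A")
    case True
    have "0 \<le> corient a b z" if "z \<in> point_hull A" for z
      using all_left_hull[OF _ that] True by (simp add: all_left_iff)
    moreover have "corient a b z < 0" if "z \<in> point_hull B" for z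
      using all_right_hull[OF _ that] True by (simp add: all_right_iff)
    ultimately show ?thesis by fastforce
  next
    case False then show ?thesis using Cons l by (auto split: if_splits)
  qed
qed simp

definition in_box :: "complex \<Rightarrow> box \<Rightarrow> bool" where
  "in_box z bx \<longleftrightarrow> (case bx of (x0, x1, y0, y1) \<Rightarrow>
     of_int x0 \<le> Re z \<and> Re z \<le> of_int x1 \<and> of_int y0 \<le> Im z \<and> Im z \<le> of_int y1)"

lemma bounding_box_set:
  "bounding_box A = (x0, x1, y0, y1) \<Longrightarrow> z \<in> set A \<Longrightarrow>
     x0 \<le> fst z \<and> fst z \<le> x1 \<and> y0 \<le> snd z \<and> snd z \<le> y1"
  by (induction A arbitrary: x0 x1 y0 y1 rule: bounding_box.induct)
    (fastforce split: prod.splits if_splits)+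

lemma in_bounding_box:
  assumes "z \<in> point_hull A" "set A \<subseteq> set B" shows "in_box z (bounding_box B)"
proof -
  obtain x0 x1 y0 y1 where b: "bounding_box B = (x0, x1, y0, y1)" by (cases "bounding_box B")
  have s: "x0 \<le> fst z \<and> fst z \<le> x1 \<and> y0 \<le> snd z \<and> snd z \<le> y1" if "z \<in> set A" for z
    using bounding_box_set[OF b] assms(2) that by blast
  have "1 * Re z + 0 * Im z \<le> of_int x1" "- 1 * Re z + 0 * Im z \<le> - of_int x0"
    "0 * Re z + 1 * Im z \<le> of_int y1" "0 * Re z + - 1 * Im z \<le> - of_int y0"
    by (rule affine_le_hull[OF _ assms(1)]; use s in simp)+
  then show ?thesis by (simp add: in_box_def b)
qed

lemma box_apart_disjoint: "box_apart bx bx' \<Longrightarrow> in_box z bx \<Longrightarrow> \<not> in_box z bx'"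
  by (cases bx; cases bx') (auto simp: in_box_def split: if_splits)

lemma boxes_disjoint:
  assumes "box_apart (bounding_box A') (bounding_box B')" "set A \<subseteq> set A'" "set B \<subseteq> set B'"
  shows "point_hull A \<inter> point_hull B = {}"
proof -
  have False if "z \<in> point_hull A" "z \<in> point_hull B" for z
    using box_apart_disjoint[OF assms(1)] in_bounding_box[OF that(1) assms(2)]
      in_bounding_box[OF that(2) assms(3)] by blast
  then show ?thesis by blast
qed

definition good_shape :: "shape \<Rightarrow> bool" where
  "good_shape x \<longleftrightarrow> (\<exists>k ls ps. x = mk_shape k ls ps)"

fun shape_tag :: "shape \<Rightarrow> nat" where "shape_tag (k, ls, bx, ps) = k"
fun shape_labels :: "shape \<Rightarrow> label list" where "shape_labels (k, ls, bx, ps) = ls"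
fun shape_hull :: "shape \<Rightarrow> complex set" where "shape_hull (k, ls, bx, ps) = point_hull ps"

text \<open>All that the checks certify about two different shapes. With disjoint labels and a tag 0
  among them, only the last alternative remains, and that is how disjointness is extracted.\<close>

definition harmless :: "shape \<Rightarrow> shape \<Rightarrow> bool" where
  "harmless x y \<longleftrightarrow> shape_tag x = shape_tag y \<and> shape_tag x \<noteq> 0 \<or>
     set (shape_labels x) \<inter> set (shape_labels y) \<noteq> {} \<and> shape_labels x \<noteq> shape_labels y \<or>
     shape_hull x \<inter> shape_hull y = {}"

lemma harmless_sym: "harmless x y \<Longrightarrow> harmless y x"
  unfolding harmless_def by (metis inf_commute)

lemma labels_meet_iff: "labels_meet ls ms \<longleftrightarrow> set ls \<inter> set ms \<noteq> {}"
  by (induction ls) (auto simp: is_label_in_iff)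

lemma compatible_shapes_harmless:
  assumes "compatible_shapes x y" "good_shape x" "good_shape y" shows "harmless x y"
proof -
  obtain k ls A where x: "x = (k, ls, bounding_box A, A)" using assms(2) by (auto simp: good_shape_def)
  obtain k' ms B where y: "y = (k', ms, bounding_box B, B)" using assms(3) by (auto simp: good_shape_def)
  consider "box_apart (bounding_box A) (bounding_box B)" | "labels_meet ls ms" "ls \<noteq> ms" | "k = k'" "k \<noteq> 0"
    | "line_separates (side_lines A) A B" | "line_separates (side_lines B) B A"
    using assms(1) x y by (auto split: if_splits)
  then show ?thesis
  proof cases
    case 1
    then have "point_hull A \<inter> point_hull B = {}" by (rule boxes_disjoint) simp_all
    then show ?thesis by (simp add: harmless_def x y)
  next
    case 2 then show ?thesis by (simp add: harmless_def x y labels_meet_iff)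
  next
    case 3 then show ?thesis by (simp add: harmless_def x y)
  next
    case 4 then show ?thesis using line_separates_disjoint by (simp add: harmless_def x y)
  next
    case 5 then show ?thesis using line_separates_disjoint by (fastforce simp: harmless_def x y)
  qed
qed

lemma compatible_all_iff: "compatible_all x ys \<longleftrightarrow> (\<forall>y\<in>set ys. compatible_shapes x y)"
  by (induction ys) auto

lemma compatible_lists_iff: "compatible_lists xs ys \<longleftrightarrow> (\<forall>x\<in>set xs. \<forall>y\<in>set ys. compatible_shapes x y)"
  by (induction xs) (auto simp: compatible_all_iff)

lemma pairwise_compatible_harmless:
  "pairwise_compatible xs \<Longrightarrow> \<forall>x\<in>set xs. good_shape x \<Longrightarrow> x \<in> set xs \<Longrightarrow> y \<in> set xs \<Longrightarrow> x \<noteq> y \<Longrightarrow> harmless x y"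
proof (induction xs arbitrary: x y)
  case (Cons z xs)
  have z: "harmless z u" if "u \<in> set xs" for u
    using Cons.prems(1,2) that compatible_shapes_harmless by (auto simp: compatible_all_iff split: if_splits)
  have IH: "harmless u v" if "u \<in> set xs" "v \<in> set xs" "u \<noteq> v" for u v
    by (rule Cons.IH[OF _ _ that]) (use Cons.prems(1,2) in \<open>simp_all split: if_splits\<close>)
  have "x = z \<or> x \<in> set xs" "y = z \<or> y \<in> set xs" using Cons.prems(3,4) by simp_all
  then show ?case using IH z harmless_sym Cons.prems(5) by metis
qed simp

lemma shape_points_subset:
  "(k, ls, bx, A) \<in> set xs \<Longrightarrow> set A \<subseteq> set (concat (map (\<lambda>(_, _, _, ps). ps) xs))"
  by (induction xs) auto

lemma groups_apart_mk_group:
  "groups_apart (mk_group xs) (mk_group ys # gs) \<longleftrightarrow>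
     (box_apart (fst (mk_group xs)) (fst (mk_group ys)) \<or> compatible_lists xs ys) \<and> groups_apart (mk_group xs) gs"
  by simp

lemma groups_ok_mk_group:
  "groups_ok (mk_group xs # gs) \<longleftrightarrow> pairwise_compatible xs \<and> groups_apart (mk_group xs) gs \<and> groups_ok gs"
  by simp

lemma groups_apart_harmless:
  "groups_apart (mk_group xs) (map mk_group gs) \<Longrightarrow> \<forall>x\<in>set xs. good_shape x \<Longrightarrow>
     \<forall>x\<in>set (concat gs). good_shape x \<Longrightarrow> x \<in> set xs \<Longrightarrow> y \<in> set (concat gs) \<Longrightarrow> harmless x y"
proof (induction gs)
  case (Cons ys gs)
  let ?P = "\<lambda>xs. concat (map (\<lambda>(_, _, _, ps). ps) xs)"
  have hd: "harmless x y" if y: "y \<in> set ys"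
  proof -
    consider "box_apart (bounding_box (?P xs)) (bounding_box (?P ys))" | "compatible_lists xs ys"
      using Cons.prems(1) unfolding list.map groups_apart_mk_group by auto
    moreover have gx: "good_shape x" using Cons.prems(2,4) by blast
    moreover have gy: "good_shape y" using Cons.prems(3) y by simp
    ultimately show ?thesis
    proof cases
      case 1
      obtain k ls A where x: "x = (k, ls, bounding_box A, A)" using gx by (auto simp: good_shape_def)
      obtain k' ms B where y': "y = (k', ms, bounding_box B, B)" using gy by (auto simp: good_shape_def)
      have "set A \<subseteq> set (?P xs)" by (rule shape_points_subset) (use Cons.prems(4) x in blast)
      moreover have "set B \<subseteq> set (?P ys)" by (rule shape_points_subset) (use y y' in blast)
      ultimately have "point_hull A \<inter> point_hull B = {}" by (rule boxes_disjoint[OF 1])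
      then show ?thesis by (simp add: harmless_def x y')
    next
      case 2
      then have "compatible_shapes x y" using Cons.prems(4) y by (simp add: compatible_lists_iff)
      then show ?thesis using gx gy by (rule compatible_shapes_harmless)
    qed
  qed
  have "groups_apart (mk_group xs) (map mk_group gs)" using Cons.prems(1) unfolding list.map groups_apart_mk_group by blast
  then have "harmless x y" if "y \<in> set (concat gs)"
    by (rule Cons.IH[OF _ Cons.prems(2) _ Cons.prems(4) that]) (use Cons.prems(3) in simp)
  moreover have "y \<in> set ys \<or> y \<in> set (concat gs)" using Cons.prems(5) by simp
  ultimately show ?case using hd by metis
qed simp

lemma groups_ok_harmless:
  "groups_ok (map mk_group gs) \<Longrightarrow> \<forall>x\<in>set (concat gs). good_shape x \<Longrightarrow>
    x \<in> set (concat gs) \<Longrightarrow> y \<in> set (concat gs) \<Longrightarrow> x \<noteq> y \<Longrightarrow> harmless x y"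
proof (induction gs)
  case (Cons xs gs)
  have 1: "pairwise_compatible xs" "groups_apart (mk_group xs) (map mk_group gs)" "groups_ok (map mk_group gs)"
    using Cons.prems(1) unfolding list.map groups_ok_mk_group by blast+
  have 2: "\<forall>x\<in>set xs. good_shape x" "\<forall>x\<in>set (concat gs). good_shape x" using Cons.prems(2) by auto
  note a = pairwise_compatible_harmless[OF 1(1) 2(1)] groups_apart_harmless[OF 1(2) 2] Cons.IH[OF 1(3) 2(2)]
  have "x \<in> set xs \<or> x \<in> set (concat gs)" "y \<in> set xs \<or> y \<in> set (concat gs)" using Cons.prems by auto
  then show ?case using a Cons.prems(5) harmless_sym by metis
qed simp

section \<open>Templates as labelled integer data, and the soundness of their checks\<close>

fun label_pos :: "point list \<Rightarrow> point list \<Rightarrow> (int \<times> int \<times> int) list \<Rightarrow> label \<Rightarrow> point" where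
  "label_pos tau hp bp (0, a) = hp ! a"
| "label_pos tau hp bp (Suc i, j) =
     (case bp ! i of (x, y, b) \<Rightarrow> case tau ! j of (u, v) \<Rightarrow> (x + b * u, y + b * v))"

text \<open>A link is an edge with a tag: \<open>0\<close> if nothing crosses it, and \<open>Suc n\<close> if it takes part in the
  crossing number \<open>n\<close>. A crossing \<open>(a, b, c, d)\<close> is that of the edges \<open>a c\<close> and \<open>b d\<close>; the only pair
  that need not be an edge is \<open>c d\<close>. The group number \<open>i\<close> of links collects those at copy \<open>i - 1\<close>,
  and the group \<open>0\<close> those between hubs.\<close>

type_synonym link = "nat \<times> label \<times> label"

fun link_shape :: "(label \<Rightarrow> point) \<Rightarrow> link \<Rightarrow> shape" where
  "link_shape f (k, l, m) = mk_shape k [l, m] [f l, f m]"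

definition hub_shape :: "(label \<Rightarrow> point) \<Rightarrow> nat \<Rightarrow> shape" where
  "hub_shape f a = mk_shape 0 [(0, a)] [f (0, a)]"

definition blob_labels :: "nat \<Rightarrow> label list" where
  "blob_labels i = [(Suc i, 0), (Suc i, 1), (Suc i, 2), (Suc i, 3), (Suc i, 4)]"

definition blob_shape :: "(label \<Rightarrow> point) \<Rightarrow> nat \<Rightarrow> shape" where
  "blob_shape f i = mk_shape 0 (blob_labels i) (map f (blob_labels i))"

fun group_shapes :: "(label \<Rightarrow> point) \<Rightarrow> nat \<Rightarrow> nat \<Rightarrow> link list list \<Rightarrow> shape list list" where
  "group_shapes f s i [] = []"
| "group_shapes f s 0 (g # gs) = (map (link_shape f) g @ map (hub_shape f) [0..<s]) # group_shapes f s 1 gs"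
| "group_shapes f s (Suc i) (g # gs) = (blob_shape f i # map (link_shape f) g) # group_shapes f s (Suc (Suc i)) gs"

text \<open>For a link that ends at its own blob: some side line of the blob passes through the
  terminal \<open>q\<close> and has the blob weakly on one side and the far end \<open>p\<close>
  strictly on the other.\<close>

fun touches_only :: "(point \<times> point) list \<Rightarrow> point list \<Rightarrow> point \<Rightarrow> point \<Rightarrow> bool" where
  "touches_only [] Q q p = False"
| "touches_only ((a, b) # ls) Q q p =
     (if orient a b p < 0 then if orient a b q = 0 then if all_left a b Q then True
      else touches_only ls Q q p else touches_only ls Q q p else touches_only ls Q q p)"

fun link_touches :: "(label \<Rightarrow> point) \<Rightarrow> link \<Rightarrow> bool" where
  "link_touches f (k, l, (0, a)) = True"
| "link_touches f (k, l, (Suc i, j)) =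
     touches_only (side_lines (map f (blob_labels i))) (map f (blob_labels i)) (f (Suc i, j)) (f l)"

fun link_valid :: "nat \<Rightarrow> nat \<Rightarrow> link \<Rightarrow> bool" where
  "link_valid s t (k, (h, a), (i, b)) \<longleftrightarrow> h = 0 \<and> a < s \<and> (if i = 0 then b < s \<and> a \<noteq> b else i \<le> t \<and> b < 5)"

fun tag_ok :: "(label \<times> label \<times> label \<times> label) list \<Rightarrow> link \<Rightarrow> bool" where
  "tag_ok Xs (0, l, m) = True"
| "tag_ok Xs (Suc k, l, m) \<longleftrightarrow> k < length Xs \<and>
     (case Xs ! k of (a, b, c, d) \<Rightarrow> (l = a \<and> m = c) \<or> (l = b \<and> m = d))"

text \<open>Only the group belonging to \<open>m\<close> is searched, so in a link at a blob the
  terminal has to be the second argument.\<close>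

definition linked :: "link list list \<Rightarrow> label \<Rightarrow> label \<Rightarrow> bool" where
  "linked eg l m \<longleftrightarrow> list_ex (\<lambda>(k, x, y). (x = l \<and> y = m) \<or> (x = m \<and> y = l)) (eg ! fst m)"

fun crossing_ok :: "link list list \<Rightarrow> label \<times> label \<times> label \<times> label \<Rightarrow> bool" where
  "crossing_ok eg (a, b, c, d) \<longleftrightarrow> distinct [a, b, c, d] \<and> fst b < length eg \<and> fst c < length eg \<and> fst d < length eg \<and>
     linked eg a b \<and> linked eg a c \<and> linked eg a d \<and> linked eg b c \<and> linked eg b d"

definition link_graph :: "link list list \<Rightarrow> (nat \<times> nat) set" where
  "link_graph eg = (\<Union>(k, l, m)\<in>set (concat eg). {(vertex_of l, vertex_of m), (vertex_of m, vertex_of l)})"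

locale template_data =
  fixes s t :: nat and tau hp :: "point list" and bp :: "(int \<times> int \<times> int) list" and eg :: "link list list"
    and Xs :: "(label \<times> label \<times> label \<times> label) list" and f :: "label \<Rightarrow> point"
  defines "f \<equiv> label_pos tau hp bp"
  assumes lengths: "length tau = 5" "length hp = s" "length bp = t" "length eg = Suc t"
    and tau_distinct: "distinct tau"
    and scales: "list_all (\<lambda>(x, y, b). b \<noteq> 0) bp"
    and valid: "list_all (link_valid s t) (concat eg)"
    and shapes_ok: "groups_ok (map mk_group (group_shapes f s 0 eg))"
    and touches: "list_all (link_touches f) (concat eg)"
    and tags: "list_all (tag_ok Xs) (concat eg)"
    and crossings: "list_all (crossing_ok eg) Xs"
begin

abbreviation "F \<equiv> link_graph eg"
abbreviation "links \<equiv> set (concat eg)"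
abbreviation "q \<equiv> \<lambda>a. pt (hp ! a)"
abbreviation "\<tau> \<equiv> \<lambda>j. pt (tau ! j)"
abbreviation "ctr \<equiv> \<lambda>i. case bp ! i of (x, y, b) \<Rightarrow> pt (x, y)"
abbreviation "\<beta> \<equiv> \<lambda>i. case bp ! i of (x, y, b) \<Rightarrow> complex_of_int b"
abbreviation "P \<equiv> blow_pos q ctr \<beta> (terminal_pos \<tau>)"
abbreviation "K \<equiv> \<lambda>i. (\<lambda>z. ctr i + \<beta> i * z) ` (convex hull (\<tau> ` {..<5}))"

definition valid_label :: "label \<Rightarrow> bool" where
  "valid_label l \<longleftrightarrow> (if fst l = 0 then snd l < s else fst l \<le> t \<and> snd l < 5)"

lemma P_vertex: "P (vertex_of l) = pt (f l)"
  by (cases l rule: vertex_of.cases)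
    (auto simp: f_def terminal_pos_def pt_def complex_eq_iff split: prod.splits)

lemma K_eq: "K i = point_hull (map f (blob_labels i))"
proof -
  have "K i = convex hull ((\<lambda>z. ctr i + \<beta> i * z) ` \<tau> ` {..<5})"
    by (rule affine_image_hull)
  also have "(\<lambda>z. ctr i + \<beta> i * z) ` \<tau> ` {..<5} = (\<lambda>j. pt (f (Suc i, j))) ` {..<5}"
    unfolding image_image
    by (rule image_cong) (auto simp: f_def pt_def complex_eq_iff split: prod.splits)
  also have "\<dots> = pt ` set (map f (blob_labels i))"
  proof -
    have "{..<5::nat} = {0, 1, 2, 3, 4}" by auto
    then show ?thesis by (simp add: blob_labels_def)
  qed
  finally show ?thesis by (simp add: point_hull_def)
qed

lemma link_validD:
  assumes "(k, l, m) \<in> links"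
  shows "fst l = 0" "valid_label l" "valid_label m" "l \<noteq> m"
proof -
  have "link_valid s t (k, l, m)" using valid assms unfolding list_all_iff by blast
  then show "fst l = 0" "valid_label l" "valid_label m" "l \<noteq> m"
    by (cases l; cases m; auto simp: valid_label_def split: if_splits)+
qed

lemma F_link:
  assumes "(u, v) \<in> F"
  obtains k l m where "(k, l, m) \<in> links" "(u = vertex_of l \<and> v = vertex_of m) \<or> (u = vertex_of m \<and> v = vertex_of l)"
  using assms unfolding link_graph_def by blast

lemma link_F: "(k, l, m) \<in> links \<Longrightarrow> (vertex_of l, vertex_of m) \<in> F \<and> (vertex_of m, vertex_of l) \<in> F"
  unfolding link_graph_def by blast

lemma vertex_of_node: "valid_label l \<Longrightarrow> vertex_of l \<in> template_nodes s t"
  by (cases l rule: vertex_of.cases) (auto simp: valid_label_def template_nodes_def)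

lemma F_nodes: "F \<subseteq> template_nodes s t \<times> template_nodes s t"
proof clarify
  fix u v assume "(u, v) \<in> F"
  then obtain k l m where "(k, l, m) \<in> links" "(u = vertex_of l \<and> v = vertex_of m) \<or> (u = vertex_of m \<and> v = vertex_of l)"
    by (rule F_link)
  then show "u \<in> template_nodes s t \<and> v \<in> template_nodes s t"
    using link_validD vertex_of_node by blast
qed

lemma group_shapes_concat:
  "set (concat (group_shapes f s i gs)) =
     link_shape f ` set (concat gs) \<union> (if i = 0 \<and> gs \<noteq> [] then hub_shape f ` {..<s} else {})
       \<union> blob_shape f ` {n. i \<le> Suc n \<and> Suc n < i + length gs}"
proof (induction f s i gs rule: group_shapes.induct)
  case (2 f s g gs)
  have "{n. 1 \<le> Suc n \<and> Suc n < 1 + length gs} = {n. 0 \<le> Suc n \<and> Suc n < 0 + length (g # gs)}" by auto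
  then show ?case using 2 by (auto simp: atLeast0LessThan)
next
  case (3 f s i g gs)
  have "{n. Suc i \<le> Suc n \<and> Suc n < Suc i + length (g # gs)} =
     insert i {n. Suc (Suc i) \<le> Suc n \<and> Suc n < Suc (Suc i) + length gs}" by auto
  then show ?case using 3 by auto
qed auto

abbreviation "shapes \<equiv> set (concat (group_shapes f s 0 eg))"

lemma shapes: "shapes = link_shape f ` links \<union> hub_shape f ` {..<s} \<union> blob_shape f ` {..<t}"
proof -
  have "eg \<noteq> []" using lengths(4) by auto
  moreover have "{n. 0 \<le> Suc n \<and> Suc n < 0 + length eg} = {..<t}" using lengths(4) by auto
  ultimately show ?thesis unfolding group_shapes_concat by simp
qed

lemma harmless: "x \<in> shapes \<Longrightarrow> y \<in> shapes \<Longrightarrow> x \<noteq> y \<Longrightarrow> harmless x y"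
proof (rule groups_ok_harmless[OF shapes_ok])
  show "\<forall>x\<in>shapes. good_shape x"
  proof -
    have "good_shape (link_shape f e)" for e
      by (cases e) (auto simp: good_shape_def simp del: mk_shape.simps)
    moreover have "good_shape (hub_shape f a)" "good_shape (blob_shape f i)" for a i
      unfolding good_shape_def hub_shape_def blob_shape_def by blast+
    ultimately show ?thesis unfolding shapes by blast
  qed
qed

lemma disjoint_shapes:
  assumes "x \<in> shapes" "y \<in> shapes" "set (shape_labels x) \<inter> set (shape_labels y) = {}"
    "shape_tag x = 0 \<or> shape_tag y = 0" "shape_labels x \<noteq> []"
  shows "shape_hull x \<inter> shape_hull y = {}"
proof -
  have "x \<noteq> y" using assms(3,5) by (cases "shape_labels x") auto
  then show ?thesis using harmless[OF assms(1,2)] assms(3,4) unfolding harmless_def by metis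
qed

lemma link_in_shapes: "(k, l, m) \<in> links \<Longrightarrow> link_shape f (k, l, m) \<in> shapes"
  and hub_in_shapes: "a < s \<Longrightarrow> hub_shape f a \<in> shapes"
  and blob_in_shapes: "i < t \<Longrightarrow> blob_shape f i \<in> shapes"
  unfolding shapes by blast+

lemma shape_simps:
  "shape_tag (link_shape f (k, l, m)) = k" "shape_labels (link_shape f (k, l, m)) = [l, m]"
  "shape_hull (link_shape f (k, l, m)) = closed_segment (P (vertex_of l)) (P (vertex_of m))"
  "shape_tag (hub_shape f a) = 0" "shape_labels (hub_shape f a) = [(0, a)]" "shape_hull (hub_shape f a) = {q a}"
  "shape_tag (blob_shape f i) = 0" "shape_labels (blob_shape f i) = blob_labels i" "shape_hull (blob_shape f i) = K i"
  unfolding P_vertex K_eq by (simp_all add: hub_shape_def blob_shape_def point_hull_def segment_convex_hull)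
    (simp add: f_def)

lemma hub_off_blob: "a < s \<Longrightarrow> i < t \<Longrightarrow> q a \<notin> K i"
  using disjoint_shapes[OF hub_in_shapes blob_in_shapes, of a i] by (simp add: shape_simps blob_labels_def)

lemma blobs_disjoint: "i < t \<Longrightarrow> j < t \<Longrightarrow> i \<noteq> j \<Longrightarrow> K i \<inter> K j = {}"
  using disjoint_shapes[OF blob_in_shapes blob_in_shapes, of i j] by (simp add: shape_simps blob_labels_def)

lemma inj_q: "inj_on q {..<s}"
proof (rule inj_onI)
  fix a b assume ab: "a \<in> {..<s}" "b \<in> {..<s}" "q a = q b"
  show "a = b"
  proof (rule ccontr)
    assume "a \<noteq> b"
    then have "{q a} \<inter> {q b} = {}"
      using disjoint_shapes[OF hub_in_shapes hub_in_shapes, of a b] ab by (simp add: shape_simps)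
    then show False using ab by simp
  qed
qed

lemma touches_only_line:
  "touches_only ls Q q' p \<Longrightarrow> \<exists>a b. orient a b p < 0 \<and> orient a b q' = 0 \<and> (\<forall>z\<in>set Q. 0 \<le> orient a b z)"
proof (induction ls)
  case (Cons l ls)
  obtain a b where l: "l = (a, b)" by (cases l)
  show ?case
  proof (cases "orient a b p < 0 \<and> orient a b q' = 0 \<and> all_left a b Q")
    case True then show ?thesis unfolding all_left_iff by blast
  next
    case False
    then have "touches_only ls Q q' p" using Cons.prems l by (auto split: if_splits)
    then show ?thesis by (rule Cons.IH)
  qed
qed simp

lemma corient_segment:
  assumes "z \<in> open_segment x y" "corient a b x < 0" "corient a b y = 0" shows "corient a b z < 0"
proof -
  obtain u where u: "0 < u" "u < 1" "z = (1 - u) *\<^sub>R x + u *\<^sub>R y" using assms(1) by (auto simp: in_segment)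
  have "corient a b z = (1 - u) * corient a b x + u * corient a b y"
    unfolding u(3) corient_def by (simp add: algebra_simps)
  then show ?thesis using u assms(2,3) by (simp add: mult_pos_neg)
qed

text \<open>A blob without an end of the link is disjoint from it by the pairwise checks. At its own
  blob, the side line found by \<open>link_touches\<close> keeps the open segment strictly
  outside.\<close>

lemma link_off_blob:
  assumes "(k, l, m) \<in> links" "i < t"
  shows "open_segment (P (vertex_of l)) (P (vertex_of m)) \<inter> K i = {}"
proof (cases "fst m = Suc i")
  case False
  have "set [l, m] \<inter> set (blob_labels i) = {}"
    using link_validD(1)[OF assms(1)] False by (auto simp: blob_labels_def)
  then have "closed_segment (P (vertex_of l)) (P (vertex_of m)) \<inter> K i = {}"
    using disjoint_shapes[OF link_in_shapes[OF assms(1)] blob_in_shapes[OF assms(2)]]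
    unfolding shape_simps by blast
  then show ?thesis using segment_open_subset_closed by blast
next
  case True
  obtain j where m: "m = (Suc i, j)" using True by (cases m) auto
  have "link_touches f (k, l, m)" using touches assms(1) unfolding list_all_iff by blast
  then obtain a b where ab: "orient a b (f l) < 0" "orient a b (f m) = 0"
    "\<And>z. z \<in> set (map f (blob_labels i)) \<Longrightarrow> 0 \<le> orient a b z"
    unfolding m link_touches.simps using touches_only_line by blast
  have "corient a b z < 0" if "z \<in> open_segment (P (vertex_of l)) (P (vertex_of m))" for z
    using corient_segment[OF that] ab(1,2) by (simp add: P_vertex corient_pt)
  moreover have "0 \<le> corient a b z" if "z \<in> K i" for z
    using all_left_hull[OF ab(3)] that unfolding K_eq by blast
  ultimately show ?thesis by fastforce
qed

lemma hub_off_link: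
  assumes "(k, l, m) \<in> links" "a < s"
  shows "q a \<notin> open_segment (P (vertex_of l)) (P (vertex_of m))"
proof (cases "(0, a) \<in> {l, m}")
  case True
  then have "q a \<in> {P (vertex_of l), P (vertex_of m)}" by (auto simp: P_vertex f_def)
  then show ?thesis by (auto simp: open_segment_def)
next
  case False
  then have "set [l, m] \<inter> set [(0, a)] = {}" by auto
  then have "closed_segment (P (vertex_of l)) (P (vertex_of m)) \<inter> {q a} = {}"
    using disjoint_shapes[OF link_in_shapes[OF assms(1)] hub_in_shapes[OF assms(2)]]
    unfolding shape_simps by blast
  then show ?thesis using segment_open_subset_closed by blast
qed

lemma terminal_in_K: "j < 5 \<Longrightarrow> P (vertex_of (Suc i, j)) \<in> K i"
  unfolding K_eq point_hull_def P_vertex by (rule hull_inc) (auto simp: blob_labels_def less_Suc_eq numeral_eq_Suc)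

lemma node_off_link:
  assumes "(k, l, m) \<in> links" "valid_label n"
  shows "P (vertex_of n) \<notin> open_segment (P (vertex_of l)) (P (vertex_of m))"
proof (cases n rule: vertex_of.cases)
  case (1 a) then show ?thesis using hub_off_link[OF assms(1), of a] assms(2) by (simp add: valid_label_def)
next
  case (2 i j)
  then have "i < t" "P (vertex_of n) \<in> K i" using assms(2) terminal_in_K by (auto simp: valid_label_def)
  then show ?thesis using link_off_blob[OF assms(1)] by blast
qed

lemma P_inj:
  assumes "valid_label l" "valid_label m" "P (vertex_of l) = P (vertex_of m)" shows "l = m"
proof (cases l rule: vertex_of.cases)
  case l: (1 a)
  then have a: "a < s" using assms by (simp add: valid_label_def)
  show ?thesis
  proof (cases m rule: vertex_of.cases)
    case (1 b) then show ?thesis using l a assms inj_q by (auto simp: valid_label_def inj_on_def)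
  next
    case (2 i j) then show ?thesis using l a assms hub_off_blob[of a i] terminal_in_K[of j i] by (auto simp: valid_label_def)
  qed
next
  case l: (2 i j)
  then have ij: "i < t" "j < 5" using assms by (auto simp: valid_label_def)
  show ?thesis
  proof (cases m rule: vertex_of.cases)
    case (1 b) then show ?thesis using l ij assms hub_off_blob[of b i] terminal_in_K[of j i] by (auto simp: valid_label_def)
  next
    case (2 i' j')
    then have ij': "i' < t" "j' < 5" using assms by (auto simp: valid_label_def)
    have ii: "i' = i"
      using blobs_disjoint[OF ij(1) ij'(1)] terminal_in_K[OF ij(2), of i] terminal_in_K[OF ij'(2), of i'] assms(3) l 2
      by auto
    obtain x y b where b: "bp ! i = (x, y, b)" by (cases "bp ! i")
    have "b \<noteq> 0" using scales b lengths(3) ij(1) unfolding list_all_length by fastforce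
    then have "pt (tau ! j) = pt (tau ! j')" using assms(3) l 2 ii b by (simp add: terminal_pos_def)
    then have "tau ! j = tau ! j'" by (auto simp: pt_def prod_eq_iff)
    then have "j = j'" using tau_distinct lengths(1) ij ij' by (simp add: nth_eq_iff_index_eq)
    then show ?thesis using l 2 ii by simp
  qed
qed

text \<open>No node lies inside a link, so links that meet in their interiors are not parallel and
  have only one common point. It is interior to both, so they share no end, and of the alternatives
  in \<open>harmless\<close> only the equal nonzero tag is left.\<close>

lemma meet_tags:
  assumes e: "(k, l, m) \<in> links" "(k', l', m') \<in> links" and ne: "{l, m} \<noteq> {l', m'}"
    and x: "x \<in> open_segment (P (vertex_of l)) (P (vertex_of m))" "x \<in> open_segment (P (vertex_of l')) (P (vertex_of m'))"
  shows "k = k' \<and> k \<noteq> 0"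
proof -
  note v = link_validD[OF e(1)] link_validD[OF e(2)]
  have PP: "{P (vertex_of l), P (vertex_of m)} \<noteq> {P (vertex_of l'), P (vertex_of m')}"
    using ne P_inj v unfolding doubleton_eq_iff by blast
  have D: "cdet (P (vertex_of m) - P (vertex_of l)) (P (vertex_of m') - P (vertex_of l')) \<noteq> 0"
    by (rule segments_meet_not_parallel[OF x _ _ _ _ PP]) (use node_off_link e v in blast)+
  have xc: "x \<in> closed_segment (P (vertex_of l)) (P (vertex_of m))" "x \<in> closed_segment (P (vertex_of l')) (P (vertex_of m'))"
    using x open_closed_segment by blast+
  have "set [l, m] \<inter> set [l', m'] = {}"
  proof (rule ccontr)
    assume "set [l, m] \<inter> set [l', m'] \<noteq> {}"
    then obtain n where "n \<in> set [l, m]" "n \<in> set [l', m']" by blast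
    then have n: "n \<in> {l, m}" "n \<in> {l', m'}" by simp_all
    have "P (vertex_of n) \<in> closed_segment (P (vertex_of l)) (P (vertex_of m))"
      "P (vertex_of n) \<in> closed_segment (P (vertex_of l')) (P (vertex_of m'))" using n by auto
    then have "x = P (vertex_of n)" using segments_meet_once[OF D] xc by blast
    then show False using n(1) x(1) by (auto simp: open_segment_def)
  qed
  moreover have "link_shape f (k, l, m) \<noteq> link_shape f (k', l', m')" using ne by auto
  ultimately show ?thesis
    using harmless[OF link_in_shapes[OF e(1)] link_in_shapes[OF e(2)]] xc
    unfolding harmless_def shape_simps by blast
qed

lemma tag_crossing:
  assumes "(k, l, m) \<in> links" "k \<noteq> 0"
  obtains n a b c d where "k = Suc n" "n < length Xs" "Xs ! n = (a, b, c, d)" "(l = a \<and> m = c) \<or> (l = b \<and> m = d)"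
proof -
  obtain n where n: "k = Suc n" using assms(2) by (cases k) auto
  obtain a b c d where X: "Xs ! n = (a, b, c, d)" by (cases "Xs ! n")
  have "tag_ok Xs (k, l, m)" using tags assms(1) unfolding list_all_iff by blast
  then have "n < length Xs" "(l = a \<and> m = c) \<or> (l = b \<and> m = d)" unfolding n by (simp_all add: X)
  then show thesis using that n X by blast
qed

lemma linked_F:
  assumes "linked eg l m" "fst m < length eg" shows "(vertex_of l, vertex_of m) \<in> F"
proof -
  obtain k x y where "(k, x, y) \<in> set (eg ! fst m)" and xy: "(x = l \<and> y = m) \<or> (x = m \<and> y = l)"
    using assms(1) by (auto simp: linked_def list_ex_iff)
  then have "(k, x, y) \<in> links" using assms(2) by (auto intro: nth_mem)
  then show ?thesis using link_F xy by blast
qed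

text \<open>The tag determines the quadruple \<open>a\<close>, \<open>b\<close>, \<open>c\<close>,
  \<open>d\<close> and allows only the links \<open>a c\<close> and \<open>b d\<close>, so two
  different links with this tag are these two.\<close>

lemma crossing_near:
  assumes "(k, l, m) \<in> links" "(k, l', m') \<in> links" "k \<noteq> 0" "(l, m) \<noteq> (l', m')"
  shows "near_K4 F {vertex_of l, vertex_of m, vertex_of l', vertex_of m'}"
proof -
  obtain n a b c d where n: "k = Suc n" "n < length Xs" and X: "Xs ! n = (a, b, c, d)"
    and 1: "(l = a \<and> m = c) \<or> (l = b \<and> m = d)"
    using tag_crossing[OF assms(1,3)] .
  obtain n' a' b' c' d' where n': "k = Suc n'" "Xs ! n' = (a', b', c', d')"
    "(l' = a' \<and> m' = c') \<or> (l' = b' \<and> m' = d')"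
    using tag_crossing[OF assms(2,3)] .
  have 2: "(l' = a \<and> m' = c) \<or> (l' = b \<and> m' = d)" using n(1) X n' by simp
  have "l = a \<and> m = c \<and> l' = b \<and> m' = d \<or> l = b \<and> m = d \<and> l' = a \<and> m' = c"
    using 1 2 assms(4) by auto
  then have lm: "{l, m, l', m'} = {a, b, c, d}" by (elim disjE conjE; hypsubst) blast+
  have "list_all (crossing_ok eg) Xs" by (rule crossings)
  then have "crossing_ok eg (Xs ! n)" using n(2) unfolding list_all_length by blast
  then have ok: "distinct [a, b, c, d]" "fst b < length eg" "fst c < length eg" "fst d < length eg"
    "linked eg a b" "linked eg a c" "linked eg a d" "linked eg b c" "linked eg b d"
    unfolding X crossing_ok.simps by blast+
  have "distinct [vertex_of a, vertex_of b, vertex_of c, vertex_of d]" using ok(1) by simp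
  then have "near_K4 F {vertex_of a, vertex_of b, vertex_of c, vertex_of d}"
    unfolding near_K4_def using ok(5-9)[THEN linked_F] ok(2-4) by blast
  moreover have "{vertex_of l, vertex_of m, vertex_of l', vertex_of m'} = vertex_of ` {l, m, l', m'}" by simp
  ultimately show ?thesis unfolding lm by simp
qed

lemma F_rep:
  assumes "(u, v) \<in> F"
  obtains k l m where "(k, l, m) \<in> links" "{u, v} = vertex_of ` {l, m}"
    "open_segment (P u) (P v) = open_segment (P (vertex_of l)) (P (vertex_of m))"
proof -
  obtain k l m where e: "(k, l, m) \<in> links" "(u = vertex_of l \<and> v = vertex_of m) \<or> (u = vertex_of m \<and> v = vertex_of l)"
    using F_link[OF assms] .
  show thesis
    by (rule that[OF e(1)]) (use e(2) open_segment_commute in auto)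
qed

lemma drawn: "drawn_template s t F q ctr \<beta> \<tau>"
proof
  show "\<beta> i \<noteq> 0" if "i < t" for i
  proof -
    obtain x y b where b: "bp ! i = (x, y, b)" by (cases "bp ! i")
    have "b \<noteq> 0" using scales b lengths(3) that unfolding list_all_length by fastforce
    then show ?thesis using b by simp
  qed
  show "F \<subseteq> template_nodes s t \<times> template_nodes s t" by (rule F_nodes)
  show "sym F"
  proof (rule symI)
    fix u v assume "(u, v) \<in> F"
    then obtain k l m where "(k, l, m) \<in> links" "(u = vertex_of l \<and> v = vertex_of m) \<or> (u = vertex_of m \<and> v = vertex_of l)"
      by (rule F_link)
    then show "(v, u) \<in> F" using link_F by blast
  qed
  show "(u, u) \<notin> F" for u
  proof
    assume "(u, u) \<in> F"
    then obtain k l m where "(k, l, m) \<in> links" "(u = vertex_of l \<and> u = vertex_of m) \<or> (u = vertex_of m \<and> u = vertex_of l)"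
      by (rule F_link)
    then show False using link_validD(4)[of k l m] by auto
  qed
  show "inj_on q {..<s}" by (rule inj_q)
  show "q a \<notin> K i" if "a < s" "i < t" for a i by (rule hub_off_blob[OF that])
  show "K i \<inter> K j = {}" if "i < t" "j < t" "i \<noteq> j" for i j by (rule blobs_disjoint[OF that])
  show "open_segment (P u) (P v) \<inter> K i = {}" if "(u, v) \<in> F" "i < t" for u v i
    using that(1)
  proof (rule F_rep)
    fix k l m assume "(k, l, m) \<in> links" "open_segment (P u) (P v) = open_segment (P (vertex_of l)) (P (vertex_of m))"
    then show ?thesis using link_off_blob[OF _ that(2)] by metis
  qed
  show "q a \<notin> open_segment (P u) (P v)" if "(u, v) \<in> F" "a < s" for u v a
    using that(1)
  proof (rule F_rep)
    fix k l m assume "(k, l, m) \<in> links" "open_segment (P u) (P v) = open_segment (P (vertex_of l)) (P (vertex_of m))"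
    then show ?thesis using hub_off_link[OF _ that(2)] by metis
  qed
  show "near_K4 F {u, v, x, y}"
    if e: "(u, v) \<in> F" "(x, y) \<in> F" "{u, v} \<noteq> {x, y}" "segs_meet P (u, v) (x, y)" for u v x y
  proof -
    obtain k l m where 1: "(k, l, m) \<in> links" "{u, v} = vertex_of ` {l, m}"
      "open_segment (P u) (P v) = open_segment (P (vertex_of l)) (P (vertex_of m))" using F_rep[OF e(1)] .
    obtain k' l' m' where 2: "(k', l', m') \<in> links" "{x, y} = vertex_of ` {l', m'}"
      "open_segment (P x) (P y) = open_segment (P (vertex_of l')) (P (vertex_of m'))" using F_rep[OF e(2)] .
    have ne: "{l, m} \<noteq> {l', m'}" using e(3) 1(2) 2(2) by metis
    obtain z where z: "z \<in> open_segment (P u) (P v)" "z \<in> open_segment (P x) (P y)"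
      using e(4) by (auto simp: segs_meet_def)
    have "k = k' \<and> k \<noteq> 0" by (rule meet_tags[OF 1(1) 2(1) ne]) (use z 1(3) 2(3) in simp_all)
    then have k: "k = k'" "k \<noteq> 0" by simp_all
    have "near_K4 F {vertex_of l, vertex_of m, vertex_of l', vertex_of m'}"
      by (rule crossing_near[OF 1(1) 2(1)[folded k(1)] k(2)]) (use ne in auto)
    moreover have "{u, v, x, y} = {u, v} \<union> {x, y}" by auto
    ultimately show ?thesis unfolding 1(2) 2(2) by (simp add: insert_commute)
  qed
  show "{x, y} = {x', y'}"
    if e: "(u, v) \<in> F" "(x, y) \<in> F" "(x', y') \<in> F" "{u, v} \<noteq> {x, y}" "{u, v} \<noteq> {x', y'}"
      "segs_meet P (u, v) (x, y)" "segs_meet P (u, v) (x', y')" for u v x y x' y'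
  proof -
    obtain k l m where 1: "(k, l, m) \<in> links" "{u, v} = vertex_of ` {l, m}"
      "open_segment (P u) (P v) = open_segment (P (vertex_of l)) (P (vertex_of m))" using F_rep[OF e(1)] .
    obtain k1 l1 m1 where 2: "(k1, l1, m1) \<in> links" "{x, y} = vertex_of ` {l1, m1}"
      "open_segment (P x) (P y) = open_segment (P (vertex_of l1)) (P (vertex_of m1))" using F_rep[OF e(2)] .
    obtain k2 l2 m2 where 3: "(k2, l2, m2) \<in> links" "{x', y'} = vertex_of ` {l2, m2}"
      "open_segment (P x') (P y') = open_segment (P (vertex_of l2)) (P (vertex_of m2))" using F_rep[OF e(3)] .
    have ne: "{l, m} \<noteq> {l1, m1}" "{l, m} \<noteq> {l2, m2}" using e(4,5) 1(2) 2(2) 3(2) by metis+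
    obtain z where z: "z \<in> open_segment (P u) (P v)" "z \<in> open_segment (P x) (P y)"
      using e(6) by (auto simp: segs_meet_def)
    have "k = k1 \<and> k \<noteq> 0" by (rule meet_tags[OF 1(1) 2(1) ne(1)]) (use z 1(3) 2(3) in simp_all)
    then have k: "k1 = k" "k \<noteq> 0" by simp_all
    obtain z where z: "z \<in> open_segment (P u) (P v)" "z \<in> open_segment (P x') (P y')"
      using e(7) by (auto simp: segs_meet_def)
    have "k = k2 \<and> k \<noteq> 0" by (rule meet_tags[OF 1(1) 3(1) ne(2)]) (use z 1(3) 3(3) in simp_all)
    then have k': "k2 = k" by simp
    obtain n a b c d where n: "k = Suc n" and X: "Xs ! n = (a, b, c, d)"
      and t0: "(l = a \<and> m = c) \<or> (l = b \<and> m = d)"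
      using tag_crossing[OF 1(1) k(2)] .
    obtain n1 a1 b1 c1 d1 where "k = Suc n1" "Xs ! n1 = (a1, b1, c1, d1)"
      "(l1 = a1 \<and> m1 = c1) \<or> (l1 = b1 \<and> m1 = d1)"
      using tag_crossing[OF 2(1)[unfolded k(1)] k(2)] .
    then have t1: "(l1 = a \<and> m1 = c) \<or> (l1 = b \<and> m1 = d)" using n X by simp
    obtain n2 a2 b2 c2 d2 where "k = Suc n2" "Xs ! n2 = (a2, b2, c2, d2)"
      "(l2 = a2 \<and> m2 = c2) \<or> (l2 = b2 \<and> m2 = d2)"
      using tag_crossing[OF 3(1)[unfolded k'] k(2)] .
    then have t2: "(l2 = a \<and> m2 = c) \<or> (l2 = b \<and> m2 = d)" using n X by simp
    \<comment> \<open>Each tag belongs to just two links, so both partners of \<open>(l, m)\<close>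
      are the other one.\<close>
    have "(l, m) \<noteq> (l1, m1)" "(l, m) \<noteq> (l2, m2)" using ne by auto
    then have "(l1, m1) = (l2, m2)" using t0 t1 t2 by (elim disjE conjE) simp_all
    then show ?thesis using 2(2) 3(2) by simp
  qed
qed

end

section \<open>Gadgets given by integer data\<close>

text \<open>\<open>prim ! i ! j\<close> is the hub at the chosen wire of terminal \<open>j\<close>
  of copy \<open>i\<close>: one wire per terminal, selected from the possibly larger number of
  links.\<close>

definition wires_ok :: "link list list \<Rightarrow> nat list list \<Rightarrow> nat \<Rightarrow> bool" where
  "wires_ok eg prim i \<longleftrightarrow> distinct (prim ! i) \<and> length (prim ! i) = 5 \<and>
     list_all (\<lambda>j. linked eg (0, prim ! i ! j) (Suc i, j)) [0..<5]"

definition nodes_linked :: "nat \<Rightarrow> link list list \<Rightarrow> nat list list \<Rightarrow> nat \<Rightarrow> nat \<Rightarrow> bool" where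
  "nodes_linked s eg prim m n \<longleftrightarrow>
     (if s \<le> m then n \<in> set (prim ! (m - s)) else if s \<le> n then m \<in> set (prim ! (n - s))
      else linked eg (0, m) (0, n))"

fun fan_ok :: "nat \<Rightarrow> nat \<Rightarrow> link list list \<Rightarrow> nat list list \<Rightarrow> nat \<times> nat list list \<Rightarrow> bool" where
  "fan_ok s t eg prim (a, ps) \<longleftrightarrow> length ps = 5 \<and> distinct (concat ps) \<and>
     list_all (\<lambda>n. n < s + t) (concat ps) \<and>
     list_all (\<lambda>p. p \<noteq> [] \<and> successively (nodes_linked s eg prim) (a # p) \<and> last p < 5) ps"

definition corner_degree_ok :: "link list list \<Rightarrow> label list list \<Rightarrow> nat \<Rightarrow> bool" where
  "corner_degree_ok eg degs j \<longleftrightarrow> length (degs ! j) = 4 \<and> distinct (degs ! j) \<and>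
     list_all (\<lambda>l. fst l < length eg \<and> l \<noteq> (0, j) \<and> linked eg (0, j) l) (degs ! j)"

fun scale_point :: "int \<Rightarrow> point \<Rightarrow> point" where
  "scale_point r (x, y) = (r * x, r * y)"

definition in_triangle :: "point \<Rightarrow> point \<Rightarrow> point \<Rightarrow> point \<Rightarrow> bool" where
  "in_triangle a b c p \<longleftrightarrow> 0 < orient a b c \<and> 0 \<le> orient a b p \<and> 0 \<le> orient b c p \<and> 0 \<le> orient c a p"

text \<open>The enlarged pentagon is triangulated by the diagonals from corner 0.\<close>

definition in_pentagon :: "point list \<Rightarrow> int \<Rightarrow> point \<Rightarrow> bool" where
  "in_pentagon tau r p \<longleftrightarrow> list_ex (\<lambda>k. in_triangle (scale_point r (tau ! 0)) (scale_point r (tau ! k))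
     (scale_point r (tau ! Suc k)) p) [1, 2, 3]"

text \<open>The barycentric coordinates of \<open>p\<close> are the areas of the three triangles
  that \<open>p\<close> spans with the sides, divided by the area of the whole.\<close>

lemma in_triangle_hull:
  assumes "in_triangle a b c p" shows "pt p \<in> convex hull {pt a, pt b, pt c}"
proof -
  define D U V W where "D = orient a b c" and "U = orient b c p" and "V = orient c a p" and "W = orient a b p"
  note defs = D_def U_def V_def W_def
  have D: "0 < D" "0 \<le> U" "0 \<le> V" "0 \<le> W" using assms by (simp_all add: in_triangle_def defs)
  obtain ax ay bx by' cx cy x y where e: "a = (ax, ay)" "b = (bx, by')" "c = (cx, cy)" "p = (x, y)"
    by (cases a; cases b; cases c; cases p)
  have s: "U + V + W = D" and X: "U * ax + V * bx + W * cx = D * x" and Y: "U * ay + V * by' + W * cy = D * y"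
    unfolding defs e orient.simps by algebra+
  define u v w where "u = real_of_int U / D" and "v = real_of_int V / D" and "w = real_of_int W / D"
  have nn: "0 \<le> u" "0 \<le> v" "0 \<le> w" using D by (simp_all add: u_def v_def w_def)
  have 1: "u + v + w = 1"
    using arg_cong[OF s, of real_of_int] D by (simp add: u_def v_def w_def flip: add_divide_distrib)
  have "real_of_int U * ax + real_of_int V * bx + real_of_int W * cx = D * x"
    "real_of_int U * ay + real_of_int V * by' + real_of_int W * cy = D * y"
    using arg_cong[OF X, of real_of_int] arg_cong[OF Y, of real_of_int] by simp_all
  then have "u * ax + v * bx + w * cx = x" "u * ay + v * by' + w * cy = y"
    using D(1) by (simp_all add: u_def v_def w_def flip: add_divide_distrib)
  then have 2: "pt p = u *\<^sub>R pt a + v *\<^sub>R pt b + w *\<^sub>R pt c"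
    unfolding e pt_def complex_eq_iff by simp
  show ?thesis unfolding convex_hull_3 using nn 1 2 by blast
qed

locale linked_template = template_data +
  fixes prim :: "nat list list"
  assumes prim_length: "length prim = t" and wires: "list_all (wires_ok eg prim) [0..<t]"
begin

lemma linked_hub_terminal:
  assumes "i < t" "n \<in> set (prim ! i)" obtains j where "j < 5" "prim ! i ! j = n" "(hub n, cpy i (hub j)) \<in> F"
proof -
  have w: "wires_ok eg prim i" using wires assms(1) by (simp add: list_all_iff)
  then obtain j where j: "j < 5" "prim ! i ! j = n" using assms(2) by (auto simp: wires_ok_def in_set_conv_nth)
  have "linked eg (0, prim ! i ! j) (Suc i, j)" using w j(1) by (auto simp: wires_ok_def list_all_iff)
  then have "(vertex_of (0, prim ! i ! j), vertex_of (Suc i, j)) \<in> F"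
    by (rule linked_F) (use assms(1) lengths(4) in simp)
  then show thesis using that j by simp
qed

lemma sym_link_graph: "sym F"
  using drawn unfolding drawn_template_def by blast

lemma template: "template s t F (\<lambda>i j. prim ! i ! j)"
proof
  show "F \<subseteq> template_nodes s t \<times> template_nodes s t" by (rule F_nodes)
  show "sym F" by (rule sym_link_graph)
  show "u \<in> hub ` {..<s} \<or> v \<in> hub ` {..<s}" if "(u, v) \<in> F" for u v
    using that
  proof (rule F_link)
    fix k l m assume e: "(k, l, m) \<in> links" and uv: "(u = vertex_of l \<and> v = vertex_of m) \<or> (u = vertex_of m \<and> v = vertex_of l)"
    have "vertex_of l \<in> hub ` {..<s}"
      using link_validD(1,2)[OF e] by (cases l) (auto simp: valid_label_def)
    then show ?thesis using uv by blast
  qed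
  show "(cpy i (hub j), hub (prim ! i ! j)) \<in> F" if "i < t" "j < 5" for i j
  proof -
    have w: "wires_ok eg prim i" using wires that(1) by (simp add: list_all_iff)
    then have "linked eg (0, prim ! i ! j) (Suc i, j)" using that(2) by (auto simp: wires_ok_def list_all_iff)
    then have "(vertex_of (0, prim ! i ! j), vertex_of (Suc i, j)) \<in> F"
      by (rule linked_F) (use that(1) lengths(4) in simp)
    then show ?thesis using symD[OF sym_link_graph] by simp
  qed
  show "inj_on (\<lambda>j. prim ! i ! j) {..<5}" if "i < t" for i
  proof -
    have "distinct (prim ! i)" "length (prim ! i) = 5"
      using wires that by (simp_all add: list_all_iff wires_ok_def)
    then show ?thesis by (simp add: inj_on_nth)
  qed
qed

lemma nodes_linked_adj:
  assumes "nodes_linked s eg prim m n" "m < s + t" "n < s + t"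
  shows "node_adj s F m n"
proof -
  have copy: "node_adj s F a b \<and> node_adj s F b a" if b: "s \<le> b" "a \<in> set (prim ! (b - s))" "b < s + t" for a b
  proof -
    have "b - s < t" using b by simp
    then obtain j where "(hub a, cpy (b - s) (hub j)) \<in> F" using linked_hub_terminal b(2) by blast
    moreover from this have "(cpy (b - s) (hub j), hub a) \<in> F" using symD[OF sym_link_graph] by blast
    ultimately show ?thesis unfolding node_adj_def using b(1) by (force intro!: bexI)
  qed
  consider "s \<le> m" "n \<in> set (prim ! (m - s))" | "s \<le> n" "m \<in> set (prim ! (n - s))" | "linked eg (0, m) (0, n)"
    using assms(1) by (auto simp: nodes_linked_def split: if_splits)
  then show ?thesis
  proof cases
    case 3
    then have "(vertex_of (0, m), vertex_of (0, n)) \<in> F" by (rule linked_F) (use lengths(4) in simp)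
    then show ?thesis unfolding node_adj_def by (force intro!: bexI)
  qed (use copy assms in blast)+
qed

lemma fan_ok_fan:
  assumes ok: "fan_ok s t eg prim (a, ps)" and a: "a < s"
  shows "fan_to_terminals s F a ps"
  unfolding fan_to_terminals_def
proof (intro conjI ballI)
  show "length ps = 5" "distinct (concat ps)" using ok by simp_all
  fix p assume p: "p \<in> set ps"
  then show "p \<noteq> []" "last p < 5" using ok by (auto simp: list_all_iff)
  have b: "n < s + t" if "n \<in> set (a # p)" for n
    using ok p that a by (auto simp: list_all_iff)
  have "successively (nodes_linked s eg prim) (a # p)" using ok p by (auto simp: list_all_iff)
  then show "successively (node_adj s F) (a # p)"
    by (rule successively_mono) (use b nodes_linked_adj in blast)
qed

end

text \<open>What a template needs for its blow-up to be a gadget again: fans, the ring and degrees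
  of the terminals, and containment in a pentagon with the terminals at its corners. The outermost
  template is a mere \<open>linked_template\<close>, since it is not inserted anywhere.\<close>

locale gadget_data = linked_template +
  fixes fans :: "(nat \<times> nat list list) list" and degs :: "label list list" and r :: int
  assumes fans: "list_all (fan_ok s t eg prim) fans" "map fst fans = [5..<s]"
    and rings: "list_all (\<lambda>j. linked eg (0, j) (0, (j + 1) mod 5)) [0..<5]"
    and degrees: "list_all (corner_degree_ok eg degs) [0..<5]"
    and r_pos: "0 < r" and five: "5 \<le> s"
    and corners: "list_all (\<lambda>j. hp ! j = scale_point r (tau ! j)) [0..<5]"
    and hubs_inside: "list_all (in_pentagon tau r) hp"
    and blobs_inside: "list_all (\<lambda>i. list_all (\<lambda>l. in_pentagon tau r (f l)) (blob_labels i)) [0..<t]"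
begin

lemma connected_step:
  assumes "connected_gadget V E"
  shows "connected_gadget (blow_verts s t V) (blow_edges t F E)"
proof -
  interpret tp: template s t F "\<lambda>i j. prim ! i ! j" by (rule template)
  interpret cg: connected_gadget V E by fact
  interpret template_gadget s t F "\<lambda>i j. prim ! i ! j" V E by unfold_locales
  show ?thesis
  proof (rule connected_gadget_blow)
    show "5 \<le> s" by (rule five)
    show "\<exists>ps. fan_to_terminals s F a ps" if "5 \<le> a" "a < s" for a
    proof -
      have "a \<in> set (map fst fans)" unfolding fans(2) using that by simp
      then obtain ps where "(a, ps) \<in> set fans" by auto
      then have "fan_ok s t eg prim (a, ps)" using fans(1) unfolding list_all_iff by blast
      then show ?thesis using fan_ok_fan that(2) by blast
    qed
    show "(hub j, hub ((j + 1) mod 5)) \<in> F" if "j < 5" for j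
    proof -
      have "linked eg (0, j) (0, (j + 1) mod 5)" using rings that unfolding list_all_iff by simp
      then have "(vertex_of (0, j), vertex_of (0, (j + 1) mod 5)) \<in> F"
        by (rule linked_F) (simp add: lengths(4))
      then show ?thesis by simp
    qed
    show "\<exists>N. card N = 4 \<and> hub j \<notin> N \<and> (\<forall>v\<in>N. (hub j, v) \<in> F)" if "j < 5" for j
    proof (intro exI conjI ballI)
      have d: "length (degs ! j) = 4" "distinct (degs ! j)"
        "\<And>l. l \<in> set (degs ! j) \<Longrightarrow> fst l < length eg \<and> l \<noteq> (0, j) \<and> linked eg (0, j) l"
        using degrees that unfolding list_all_iff corner_degree_ok_def by simp_all
      have i: "inj vertex_of" by (simp add: inj_def)
      show "card (vertex_of ` set (degs ! j)) = 4"
        using card_image[OF inj_on_subset[OF i subset_UNIV], of "set (degs ! j)"] distinct_card[OF d(2)] d(1) by simp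
      show "hub j \<notin> vertex_of ` set (degs ! j)"
      proof
        assume "hub j \<in> vertex_of ` set (degs ! j)"
        then obtain l where "l \<in> set (degs ! j)" "vertex_of (0, j) = vertex_of l" by auto
        then have "l = (0, j)" unfolding vertex_of_eq by simp
        then show False using d(3)[OF \<open>l \<in> set (degs ! j)\<close>] by simp
      qed
      fix v assume "v \<in> vertex_of ` set (degs ! j)"
      then obtain l where l: "l \<in> set (degs ! j)" "v = vertex_of l" by blast
      have "(vertex_of (0, j), vertex_of l) \<in> F" using linked_F d(3)[OF l(1)] by blast
      then show "(hub j, v) \<in> F" using l(2) by simp
    qed
  qed
qed

lemma pt_scale: "pt (scale_point r z) = of_int r * pt z"
  by (cases z) (simp add: pt_def complex_eq_iff)

lemma in_pentagon_hull:
  assumes "in_pentagon tau r z"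
  shows "pt z \<in> (\<lambda>z. of_int r * z) ` (convex hull (\<tau> ` {..<5}))"
proof -
  obtain k where k: "k \<in> set [1, 2, 3::nat]"
    "in_triangle (scale_point r (tau ! 0)) (scale_point r (tau ! k)) (scale_point r (tau ! Suc k)) z"
    using assms unfolding in_pentagon_def list_ex_iff by blast
  have "pt z \<in> convex hull {of_int r * \<tau> 0, of_int r * \<tau> k, of_int r * \<tau> (Suc k)}"
    using in_triangle_hull[OF k(2)] by (simp only: pt_scale)
  also have "\<dots> \<subseteq> convex hull ((\<lambda>z. 0 + of_int r * z) ` \<tau> ` {..<5})"
    by (rule hull_mono) (use k(1) in auto)
  also have "\<dots> = (\<lambda>z. 0 + of_int r * z) ` (convex hull (\<tau> ` {..<5}))"
    by (rule affine_image_hull[symmetric])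
  finally show ?thesis by simp
qed

lemma straight_step:
  assumes "t = 0 \<or> straight_gadget V E p \<tau>"
  shows "\<exists>p'. straight_gadget (blow_verts s t V) (blow_edges t F E) p' \<tau>"
proof -
  obtain V0 E0 p0 where g: "straight_gadget V0 E0 p0 \<tau>" "blow_verts s t V0 = blow_verts s t V"
    "blow_edges t F E0 = blow_edges t F E"
  proof (cases "t = 0")
    case True
    \<comment> \<open>Without blobs the inserted gadget leaves no trace, so five isolated terminals
      serve as a placeholder.\<close>
    have "straight_gadget (hub ` {..<5}) {} (terminal_pos \<tau>) \<tau>"
    proof
      show "inj_on (terminal_pos \<tau>) (hub ` {..<5})"
      proof (rule inj_onI)
        fix u v assume "u \<in> hub ` {..<5}" "v \<in> hub ` {..<5}" and e: "terminal_pos \<tau> u = terminal_pos \<tau> v"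
        then obtain i j where ij: "i < 5" "j < 5" "u = hub i" "v = hub j" by auto
        then have "pt (tau ! i) = pt (tau ! j)" using e by (simp add: terminal_pos_def)
        then have "tau ! i = tau ! j" by (simp add: pt_def prod_eq_iff)
        then show "u = v" using tau_distinct lengths(1) ij by (simp add: nth_eq_iff_index_eq)
      qed
      show "terminal_pos \<tau> v \<in> convex hull \<tau> ` {..<5}" if "v \<in> hub ` {..<5}" for v
        using that by (auto simp: terminal_pos_def intro!: hull_inc)
    qed (auto simp: terminal_pos_def sym_def)
    then show thesis using that True by (simp add: blow_verts_def blow_edges_def)
  next
    case False then show thesis using that assms by blast
  qed
  interpret dt: drawn_template s t F q ctr \<beta> \<tau> K P by (rule drawn)
  interpret sg: straight_gadget V0 E0 p0 \<tau> by (rule g(1))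
  interpret blow_up s t F q ctr \<beta> \<tau> K P V0 E0 p0 by unfold_locales
  let ?H = "(\<lambda>z. of_int r * z) ` (convex hull (\<tau> ` {..<5}))"
  have "straight_gadget (blow_verts s t V0) (blow_edges t F E0) (\<lambda>v. blow_pos q ctr \<beta> p0 v / of_int r) \<tau>"
  proof (rule straight_gadget_blow[OF straight_drawing_blow])
    show "of_int r \<noteq> (0::complex)" using r_pos by simp
    show "hub j \<in> blow_verts s t V0" if "j < 5" for j using that five by (auto simp: blow_verts_def)
    show "blow_pos q ctr \<beta> p0 (hub j) = of_int r * \<tau> j" if "j < 5" for j
    proof -
      have "hp ! j = scale_point r (tau ! j)" using corners that by (simp add: list_all_iff)
      then show ?thesis by (simp add: pt_scale)
    qed
    show "blow_pos q ctr \<beta> p0 v \<in> ?H" if "v \<in> blow_verts s t V0" for v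
    proof (rule blow_in_hull[OF _ _ _ that])
      show "q a \<in> ?H" if "a < s" for a
        using in_pentagon_hull hubs_inside that lengths(2) unfolding list_all_length by blast
      show "ctr i + \<beta> i * \<tau> j \<in> ?H" if "i < t" "j < 5" for i j
      proof -
        have l: "(Suc i, j) \<in> set (blob_labels i)" using that(2) by (auto simp: blob_labels_def)
        have "list_all (\<lambda>l. in_pentagon tau r (f l)) (blob_labels i)"
          using blobs_inside that(1) by (simp add: list_all_iff)
        then have "in_pentagon tau r (f (Suc i, j))" using l unfolding list_all_iff by blast
        then have "pt (f (Suc i, j)) \<in> ?H" by (rule in_pentagon_hull)
        then have "P (vertex_of (Suc i, j)) \<in> ?H" unfolding P_vertex .
        then show ?thesis using that(2) by (simp add: terminal_pos_def)
      qed
      show "convex ?H"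
        using convex_linear_image[of "\<lambda>z. of_int r * z" "convex hull (\<tau> ` {..<5})"]
        by (simp add: bounded_linear.linear bounded_linear_mult_right)
    qed
  qed
  then show ?thesis using g(2,3) by metis
qed

lemma path_bound_step:
  "path_bound V E l \<Longrightarrow> path_bound (blow_verts s t V) (blow_edges t F E) (s + (s + 1) * l)"
  by (rule template.path_bound_blow[OF template])

end

section \<open>From relations to graphs\<close>

lemma pawalk_verts_successively:
  assumes "pcas u p v" "set p \<subseteq> E"
  shows "successively (\<lambda>x y. (x, y) \<in> E) (pawalk_verts u p) \<and> hd (pawalk_verts u p) = u \<and> pawalk_verts u p \<noteq> []"
  using assms
proof (induction p arbitrary: u)
  case (Cons e p)
  then have "successively (\<lambda>x y. (x, y) \<in> E) (pawalk_verts (snd e) p) \<and> hd (pawalk_verts (snd e) p) = snd e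
     \<and> pawalk_verts (snd e) p \<noteq> []" by simp
  moreover have "e \<in> E" "fst e = u" using Cons.prems by auto
  ultimately show ?case by (auto simp: successively_Cons)
qed simp

lemma pawalk_verts_subset:
  assumes "u \<in> V" "set p \<subseteq> E" "E \<subseteq> V \<times> V" shows "set (pawalk_verts u p) \<subseteq> V"
  using assms
proof (induction p arbitrary: u)
  case (Cons e p)
  have "fst e \<in> V" "snd e \<in> V" using Cons.prems by auto
  then show ?case using Cons by simp
qed simp

lemma length_pawalk_verts: "length (pawalk_verts u p) = Suc (length p)"
  by (induction p arbitrary: u) auto

lemma not_traceable_if_path_bound:
  assumes "path_bound V E l" "E \<subseteq> V \<times> V" "l < card V"
  shows "\<not> traceable \<lparr>pverts = V, parcs = E\<rparr>"
proof
  let ?G = "\<lparr>pverts = V, parcs = E\<rparr>"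
  assume "traceable ?G"
  then obtain u p v where p: "pre_digraph.apath (with_proj ?G) u p v"
    "set (pre_digraph.awalk_verts (with_proj ?G) u p) = pverts ?G"
    unfolding traceable_def by blast
  then have u: "u \<in> V" "set p \<subseteq> E" "pcas u p v" "distinct (pawalk_verts u p)" "set (pawalk_verts u p) = V"
    unfolding pre_digraph.apath_def pre_digraph.awalk_def cas_with_proj_eq awalk_verts_with_proj_eq by auto
  have "length (pawalk_verts u p) \<le> l"
    using assms(1) u pawalk_verts_successively[OF u(3,2)] unfolding path_bound_def by blast
  then show False using distinct_card[OF u(4)] u(5) assms(3) by simp
qed

text \<open>Dropping the first entry of the closed vertex sequence leaves a path with as many
  vertices as the cycle has arcs.\<close>

lemma circ_le_path_bound:
  assumes "path_bound V E l" "E \<subseteq> V \<times> V"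
  shows "circ \<lparr>pverts = V, parcs = E\<rparr> \<le> l"
proof -
  let ?G = "\<lparr>pverts = V, parcs = E\<rparr>"
  have "length p \<le> l" if cyc: "pre_digraph.cycle (with_proj ?G) p" for p
  proof -
    obtain u where "pre_digraph.awalk (with_proj ?G) u p u"
      "distinct (tl (pre_digraph.awalk_verts (with_proj ?G) u p))"
      using cyc unfolding pre_digraph.cycle_def by blast
    then have u: "u \<in> V" "set p \<subseteq> E" "pcas u p u" "distinct (tl (pawalk_verts u p))"
      unfolding pre_digraph.awalk_def cas_with_proj_eq awalk_verts_with_proj_eq by simp_all
    have s: "successively (\<lambda>x y. (x, y) \<in> E) (pawalk_verts u p)" "pawalk_verts u p \<noteq> []"
      using pawalk_verts_successively[OF u(3,2)] by blast+
    have "successively (\<lambda>x y. (x, y) \<in> E) (tl (pawalk_verts u p))"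
      using s by (cases "pawalk_verts u p") (auto simp: successively_Cons)
    moreover have "set (tl (pawalk_verts u p)) \<subseteq> V"
      using pawalk_verts_subset[OF u(1,2) assms(2)] list.set_sel(2)[OF s(2)] by blast
    ultimately have "length (tl (pawalk_verts u p)) \<le> l"
      using assms(1) u(4) unfolding path_bound_def by blast
    then show ?thesis by (simp add: length_pawalk_verts)
  qed
  then have b: "x \<le> l" if "x \<in> {length p | p. pre_digraph.cycle (with_proj ?G) p \<and> 3 \<le> length p}" for x
    using that by blast
  show ?thesis unfolding circ_def
  proof (cases "{length p | p. pre_digraph.cycle (with_proj ?G) p \<and> 3 \<le> length p} = {}")
    case True then show "Sup {length p | p. pre_digraph.cycle (with_proj ?G) p \<and> 3 \<le> length p} \<le> l"
      by (simp only: Sup_nat_empty)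
  next
    case False then show "Sup {length p | p. pre_digraph.cycle (with_proj ?G) p \<and> 3 \<le> length p} \<le> l"
      using b by (rule cSup_least)
  qed
qed

lemma joined_rtrancl_on:
  assumes "joined E X u v" "E \<subseteq> V \<times> V" "u \<in> V - X"
  shows "(u, v) \<in> rtrancl_on (V - X) {e. e \<in> E \<and> fst e \<in> V - X \<and> snd e \<in> V - X}"
  using assms(1) unfolding joined_def
proof (induction rule: rtrancl_induct)
  case base then show ?case using assms(3) by blast
next
  case (step y z)
  then have yz: "(y, z) \<in> {e. e \<in> E \<and> fst e \<in> V - X \<and> snd e \<in> V - X}" using assms(2) by auto
  then have "z \<in> V - X" by auto
  with step.IH yz show ?case by (rule rtrancl_on_into_rtrancl_on)
qed

lemma k_connected_if_joined:
  assumes "finite V" "E \<subseteq> V \<times> V" "k < card V"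
    and j: "\<And>X u v. X \<subseteq> V \<Longrightarrow> card X < k \<Longrightarrow> u \<in> V - X \<Longrightarrow> v \<in> V - X \<Longrightarrow> joined E X u v"
  shows "k_connected k \<lparr>pverts = V, parcs = E\<rparr>"
  unfolding k_connected_def
proof (intro conjI allI impI)
  let ?G = "\<lparr>pverts = V, parcs = E\<rparr>"
  show "k < card (pverts ?G)" using assms(3) by simp
  fix X assume X: "X \<subseteq> pverts ?G" "card X < k"
  let ?H = "mk_symmetric (with_proj ?G \<restriction> (pverts ?G - X))"
  have v: "verts (with_proj ?H) = V - X"
    by (simp add: mk_symmetric_def induce_subgraph_def)
  have "{e. e \<in> E \<and> fst e \<in> V - X \<and> snd e \<in> V - X} \<subseteq> arcs_ends (with_proj ?H)"
    by (auto simp: mk_symmetric_def induce_subgraph_def)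
  then have r: "(x, y) \<in> rtrancl_on (V - X) (arcs_ends (with_proj ?H))"
    if "(x, y) \<in> rtrancl_on (V - X) {e. e \<in> E \<and> fst e \<in> V - X \<and> snd e \<in> V - X}" for x y
    using rtrancl_on_mono[OF _ subset_refl that] by blast
  show "Digraph_Component.connected (with_proj ?G \<restriction> (pverts ?G - X))"
    unfolding connected_def strongly_connected_def
  proof (intro conjI ballI)
    have "\<not> V \<subseteq> X" using X assms(1,3) card_mono[of X V] finite_subset by fastforce
    then show "verts (with_proj ?H) \<noteq> {}" unfolding v by blast
    fix x y assume "x \<in> verts (with_proj ?H)" "y \<in> verts (with_proj ?H)"
    then have xy: "x \<in> V - X" "y \<in> V - X" unfolding v by blast+
    have "joined E X x y" using j[OF _ X(2) xy] X(1) by simp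
    from joined_rtrancl_on[OF this assms(2) xy(1)] have "(x, y) \<in> rtrancl_on (V - X) (arcs_ends (with_proj ?H))"
      using r by blast
    then show "x \<rightarrow>\<^sup>*\<^bsub>with_proj ?H\<^esub> y" unfolding reachable_def v .
  qed
qed

lemma weakly_locally_maximal_imp_one_planar:
  "weakly_locally_maximal_one_planar G \<Longrightarrow> one_planar G"
  unfolding weakly_locally_maximal_one_planar_def one_planar_def by blast

section \<open>Isomorphism classes and the shortness exponent\<close>

lemma iso_rel_card: "(G, H) \<in> iso_rel \<Longrightarrow> card (pverts H) = card (pverts G)"
proof -
  assume "(G, H) \<in> iso_rel"
  then obtain f where f: "pre_digraph.digraph_isomorphism (with_proj G) f" "with_proj H = app_iso f (with_proj G)"
    by (auto simp: iso_rel_def digraph_iso_def)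
  have "pverts H = iso_verts f ` pverts G"
    using arg_cong[OF f(2), of verts] by simp
  moreover have "inj_on (iso_verts f) (pverts G)"
    using f(1) unfolding pre_digraph.digraph_isomorphism_def by simp
  ultimately show ?thesis by (simp add: card_image)
qed

lemma iso_rel_refl: "pair_graph G \<Longrightarrow> (G, G) \<in> iso_rel"
proof -
  assume "pair_graph G"
  then interpret pair_graph G .
  let ?f = "\<lparr>iso_verts = id, iso_arcs = id, iso_head = snd, iso_tail = fst\<rparr>"
  have "pre_digraph.digraph_isomorphism (with_proj G) ?f"
    unfolding pre_digraph.digraph_isomorphism_def using wf_digraph by simp
  moreover have "with_proj G = app_iso ?f (with_proj G)" by (simp add: app_iso_def with_proj_def)
  ultimately show ?thesis unfolding iso_rel_def digraph_iso_def by blast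
qed

text \<open>The order is constant on a class, so finitely many classes admit only finitely many
  orders. Reflexivity ensures that choosing a representative with \<open>SOME\<close>
  succeeds.\<close>

lemma infinite_iso_classes:
  assumes "\<And>G. G \<in> A \<Longrightarrow> pair_graph G" "infinite ((\<lambda>G. card (pverts G)) ` A)"
  shows "infinite (A // iso_rel)"
proof
  assume fin: "finite (A // iso_rel)"
  define h where "h = (\<lambda>C :: nat pair_pre_digraph set. card (pverts (SOME G. G \<in> C)))"
  have "h (iso_rel `` {G}) = card (pverts G)" if "G \<in> A" for G
  proof -
    have "G \<in> iso_rel `` {G}" using iso_rel_refl assms(1) that by blast
    then have "(SOME H. H \<in> iso_rel `` {G}) \<in> iso_rel `` {G}" by (rule someI)
    then show ?thesis unfolding h_def using iso_rel_card by blast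
  qed
  then have "(\<lambda>G. card (pverts G)) ` A \<subseteq> h ` (A // iso_rel)"
    unfolding quotient_def by (force simp: image_iff)
  then show False using fin assms(2) finite_subset by blast
qed

text \<open>A sequence in the class whose orders tend to infinity induces a finer filter, and the
  lower limit along a finer filter is at least that of the class.\<close>

lemma shortness_exponent_le:
  assumes G: "\<And>k. G k \<in> \<Gamma>" and lim: "filterlim (\<lambda>k. card (pverts (G k))) at_top sequentially"
    and bd: "\<And>k. ln (real (circ (G k))) / ln (real (card (pverts (G k)))) \<le> b k" and b: "b \<longlonglongrightarrow> c"
  shows "shortness_exponent \<Gamma> \<le> ereal c"
proof -
  let ?F = "inf (filtercomap (\<lambda>G. card (pverts G)) at_top) (principal \<Gamma>)"
  let ?f = "\<lambda>G. ereal (ln (real (circ G)) / ln (real (card (pverts G))))"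
  have "filterlim G ?F sequentially"
    using G lim by (simp add: filterlim_inf filterlim_filtercomap_iff comp_def filterlim_principal)
  then have le: "filtermap G sequentially \<le> ?F" by (simp add: filterlim_def)
  have "Liminf ?F ?f \<le> Liminf (filtermap G sequentially) ?f"
    unfolding Liminf_def using le by (intro SUP_subset_mono) (auto simp: le_filter_def)
  also have "\<dots> \<le> Liminf sequentially (\<lambda>k. ?f (G k))" by (rule Liminf_filtermap_le)
  also have "\<dots> \<le> Liminf sequentially (\<lambda>k. ereal (b k))"
    by (rule Liminf_mono) (simp add: bd)
  also have "\<dots> = ereal c" by (rule lim_imp_Liminf) (use b in simp_all)
  finally show ?thesis unfolding shortness_exponent_def .
qed

section \<open>The templates\<close>

text \<open>Convex, with the corners counterclockwise as the side tests require, and integral so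
  that all checks are exact.\<close>

definition pentagon :: "point list" where
  "pentagon = [(0, 3), (-3, 1), (-2, -2), (2, -2), (3, 1)]"

text \<open>The main template has concentric rings of 5, 7 and 8 hubs and a path of three hubs in the
  centre, separated by rings of 8, 10 and 8 blobs. Where two consecutive blobs of a ring face an edge
  of a neighbouring hub ring, both diagonals of the quadrangle are wires. The coordinates come from a
  Tutte embedding, improved by a random local search.\<close>

definition main_hubs :: "point list" where
  "main_hubs =
    [(0, 240), (-240, 80), (-160, -160), (160, -160), (240, 80), (-55, 154), (-148, 20), (-121,
    -116), (99, -116), (134, -90), (184, 58), (62, 130), (-28, 95), (-69, 7), (-85, -65), (9, -63),
    (74, -65), (128, 31), (67, 68), (32, 85), (-11, 26), (22, 11), (56, -4)]"

text \<open>A scale of \<open>-1\<close> is a half-turn, which preserves the orientation of the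
  pentagon. It points the corners so that two terminals rather than one face a given side.\<close>

definition main_blobs :: "(int \<times> int \<times> int) list" where
  "main_blobs =
    [(-3, 212, 1), (-207, 76, 1), (-176, 19, 1), (-141, -138, -1), (119, -138, -1), (150, -114, -1),
    (212, 69, -1), (73, 150, -1), (-42, 125, 1), (-89, 28, 1), (-121, 4, 1), (-101, -91, 1), (12,
    -86, -1), (86, -90, -1), (117, -67, 1), (155, 46, 1), (77, 90, 1), (43, 109, 1), (-14, 62, -1),
    (-44, 5, 1), (-40, -32, -1), (10, -39, -1), (59, -38, 1), (89, 19, 1), (54, 44, -1), (24, 58,
    1)]"

definition main_links :: "link list list" where
  "main_links =
    [[(0, (0, 0), (0, 1)), (0, (0, 1), (0, 2)), (0, (0, 2), (0, 3)), (0, (0, 3), (0, 4)), (0, (0,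
    0), (0, 4)), (0, (0, 5), (0, 6)), (0, (0, 6), (0, 7)), (0, (0, 7), (0, 8)), (0, (0, 8), (0, 9)),
    (0, (0, 9), (0, 10)), (0, (0, 10), (0, 11)), (0, (0, 5), (0, 11)), (0, (0, 12), (0, 13)), (0,
    (0, 13), (0, 14)), (0, (0, 14), (0, 15)), (0, (0, 15), (0, 16)), (0, (0, 16), (0, 17)), (0, (0,
    17), (0, 18)), (0, (0, 18), (0, 19)), (0, (0, 12), (0, 19)), (0, (0, 20), (0, 21)), (0, (0, 21),
    (0, 22))], [(1, (0, 1), (1, 1)), (5, (0, 4), (1, 4)), (12, (0, 11), (1, 3)), (0, (0, 5), (1,
    2)), (0, (0, 0), (1, 0)), (0, (0, 0), (1, 1)), (0, (0, 5), (1, 3)), (0, (0, 0), (1, 4))], [(1,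
    (0, 0), (2, 0)), (2, (0, 2), (2, 2)), (6, (0, 6), (2, 3)), (0, (0, 5), (2, 4)), (0, (0, 1), (2,
    1)), (0, (0, 1), (2, 2)), (0, (0, 5), (2, 3)), (0, (0, 1), (2, 0))], [(2, (0, 1), (3, 1)), (6,
    (0, 5), (3, 0)), (7, (0, 7), (3, 3)), (0, (0, 2), (3, 2)), (0, (0, 6), (3, 4)), (0, (0, 6), (3,
    3)), (0, (0, 6), (3, 0)), (0, (0, 2), (3, 1))], [(3, (0, 3), (4, 0)), (7, (0, 6), (4, 3)), (8,
    (0, 8), (4, 1)), (0, (0, 2), (4, 4)), (0, (0, 7), (4, 2)), (0, (0, 2), (4, 0)), (0, (0, 7), (4,
    1)), (0, (0, 7), (4, 3))], [(3, (0, 2), (5, 0)), (8, (0, 7), (5, 4)), (9, (0, 9), (5, 2)), (0,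
    (0, 3), (5, 1)), (0, (0, 8), (5, 3)), (0, (0, 3), (5, 0)), (0, (0, 8), (5, 2)), (0, (0, 8), (5,
    4))], [(4, (0, 4), (6, 1)), (9, (0, 8), (6, 4)), (10, (0, 10), (6, 2)), (0, (0, 3), (6, 0)), (0,
    (0, 9), (6, 3)), (0, (0, 9), (6, 4)), (0, (0, 3), (6, 1)), (0, (0, 9), (6, 2))], [(4, (0, 3),
    (7, 1)), (10, (0, 9), (7, 0)), (11, (0, 11), (7, 3)), (0, (0, 10), (7, 4)), (0, (0, 4), (7, 2)),
    (0, (0, 10), (7, 0)), (0, (0, 4), (7, 1)), (0, (0, 10), (7, 3))], [(5, (0, 0), (8, 2)), (11, (0,
    10), (8, 0)), (12, (0, 5), (8, 3)), (0, (0, 11), (8, 4)), (0, (0, 4), (8, 1)), (0, (0, 11), (8,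
    0)), (0, (0, 4), (8, 2)), (0, (0, 11), (8, 3))], [(19, (0, 11), (9, 0)), (20, (0, 13), (9, 2)),
    (27, (0, 19), (9, 4)), (0, (0, 12), (9, 3)), (0, (0, 5), (9, 1)), (0, (0, 12), (9, 2)), (0, (0,
    12), (9, 4)), (0, (0, 5), (9, 0))], [(13, (0, 6), (10, 1)), (20, (0, 12), (10, 4)), (21, (0,
    14), (10, 2)), (0, (0, 13), (10, 3)), (0, (0, 5), (10, 0)), (0, (0, 5), (10, 1)), (0, (0, 13),
    (10, 2)), (0, (0, 13), (10, 4))], [(13, (0, 5), (11, 0)), (14, (0, 7), (11, 2)), (21, (0, 13),
    (11, 4)), (0, (0, 14), (11, 3)), (0, (0, 6), (11, 1)), (0, (0, 6), (11, 2)), (0, (0, 14), (11,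
    4)), (0, (0, 6), (11, 0))], [(14, (0, 6), (12, 1)), (15, (0, 8), (12, 3)), (22, (0, 15), (12,
    4)), (0, (0, 7), (12, 2)), (0, (0, 14), (12, 0)), (0, (0, 7), (12, 3)), (0, (0, 14), (12, 4)),
    (0, (0, 7), (12, 1))], [(15, (0, 7), (13, 0)), (22, (0, 14), (13, 4)), (23, (0, 16), (13, 2)),
    (0, (0, 8), (13, 1)), (0, (0, 15), (13, 3)), (0, (0, 8), (13, 0)), (0, (0, 15), (13, 2)), (0,
    (0, 15), (13, 4))], [(16, (0, 9), (14, 1)), (23, (0, 15), (14, 4)), (24, (0, 17), (14, 2)), (0,
    (0, 8), (14, 0)), (0, (0, 16), (14, 3)), (0, (0, 8), (14, 1)), (0, (0, 16), (14, 2)), (0, (0,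
    16), (14, 4))], [(16, (0, 8), (15, 2)), (17, (0, 10), (15, 4)), (24, (0, 16), (15, 1)), (0, (0,
    9), (15, 3)), (0, (0, 17), (15, 0)), (0, (0, 9), (15, 2)), (0, (0, 9), (15, 4)), (0, (0, 17),
    (15, 1))], [(17, (0, 9), (16, 3)), (18, (0, 11), (16, 0)), (25, (0, 18), (16, 1)), (0, (0, 17),
    (16, 2)), (0, (0, 10), (16, 4)), (0, (0, 10), (16, 3)), (0, (0, 10), (16, 0)), (0, (0, 17), (16,
    1))], [(18, (0, 10), (17, 4)), (25, (0, 17), (17, 3)), (26, (0, 19), (17, 1)), (0, (0, 18), (17,
    2)), (0, (0, 11), (17, 0)), (0, (0, 18), (17, 1)), (0, (0, 18), (17, 3)), (0, (0, 11), (17,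
    4))], [(19, (0, 5), (18, 0)), (26, (0, 18), (18, 3)), (27, (0, 12), (18, 1)), (0, (0, 19), (18,
    2)), (0, (0, 11), (18, 4)), (0, (0, 19), (18, 1)), (0, (0, 19), (18, 3)), (0, (0, 11), (18,
    0))], [(28, (0, 13), (19, 4)), (35, (0, 19), (19, 2)), (39, (0, 21), (19, 1)), (0, (0, 20), (19,
    0)), (0, (0, 12), (19, 3)), (0, (0, 12), (19, 4)), (0, (0, 20), (19, 1)), (0, (0, 12), (19,
    2))], [(28, (0, 12), (20, 0)), (29, (0, 14), (20, 2)), (36, (0, 21), (20, 3)), (0, (0, 20), (20,
    4)), (0, (0, 13), (20, 1)), (0, (0, 13), (20, 2)), (0, (0, 20), (20, 3)), (0, (0, 13), (20,
    0))], [(29, (0, 13), (21, 3)), (30, (0, 15), (21, 0)), (36, (0, 20), (21, 2)), (0, (0, 14), (21,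
    4)), (0, (0, 21), (21, 1)), (0, (0, 14), (21, 0)), (0, (0, 21), (21, 2)), (0, (0, 14), (21,
    3))], [(30, (0, 14), (22, 4)), (31, (0, 16), (22, 1)), (37, (0, 22), (22, 2)), (0, (0, 15), (22,
    0)), (0, (0, 21), (22, 3)), (0, (0, 15), (22, 4)), (0, (0, 15), (22, 1)), (0, (0, 21), (22,
    2))], [(31, (0, 15), (23, 2)), (32, (0, 17), (23, 4)), (37, (0, 21), (23, 1)), (0, (0, 16), (23,
    3)), (0, (0, 22), (23, 0)), (0, (0, 16), (23, 2)), (0, (0, 16), (23, 4)), (0, (0, 22), (23,
    1))], [(32, (0, 16), (24, 3)), (33, (0, 18), (24, 0)), (38, (0, 21), (24, 1)), (0, (0, 22), (24,
    2)), (0, (0, 17), (24, 4)), (0, (0, 22), (24, 1)), (0, (0, 17), (24, 3)), (0, (0, 17), (24,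
    0))], [(33, (0, 17), (25, 1)), (34, (0, 19), (25, 3)), (38, (0, 22), (25, 0)), (0, (0, 21), (25,
    4)), (0, (0, 18), (25, 2)), (0, (0, 21), (25, 0)), (0, (0, 18), (25, 1)), (0, (0, 18), (25,
    3))], [(34, (0, 18), (26, 4)), (35, (0, 12), (26, 1)), (39, (0, 20), (26, 2)), (0, (0, 21), (26,
    3)), (0, (0, 19), (26, 0)), (0, (0, 21), (26, 2)), (0, (0, 19), (26, 4)), (0, (0, 19), (26,
    1))]]"

text \<open>In each of the 39 crossings \<open>a b\<close> is an edge between consecutive hubs of a
  ring or of the central path, and \<open>c\<close>, \<open>d\<close> are terminals of different
  copies. Copies are never joined, so all these crossings are almost full.\<close>

definition main_crossings :: "(label \<times> label \<times> label \<times> label) list" where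
  "main_crossings =
    [((0, 0), (0, 1), (2, 0), (1, 1)), ((0, 1), (0, 2), (3, 1), (2, 2)), ((0, 2), (0, 3), (5, 0),
    (4, 0)), ((0, 3), (0, 4), (7, 1), (6, 1)), ((0, 4), (0, 0), (1, 4), (8, 2)), ((0, 5), (0, 6),
    (3, 0), (2, 3)), ((0, 6), (0, 7), (4, 3), (3, 3)), ((0, 7), (0, 8), (5, 4), (4, 1)), ((0, 8),
    (0, 9), (6, 4), (5, 2)), ((0, 9), (0, 10), (7, 0), (6, 2)), ((0, 10), (0, 11), (8, 0), (7, 3)),
    ((0, 11), (0, 5), (1, 3), (8, 3)), ((0, 5), (0, 6), (11, 0), (10, 1)), ((0, 6), (0, 7), (12, 1),
    (11, 2)), ((0, 7), (0, 8), (13, 0), (12, 3)), ((0, 8), (0, 9), (15, 2), (14, 1)), ((0, 9), (0,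
    10), (16, 3), (15, 4)), ((0, 10), (0, 11), (17, 4), (16, 0)), ((0, 11), (0, 5), (9, 0), (18,
    0)), ((0, 12), (0, 13), (10, 4), (9, 2)), ((0, 13), (0, 14), (11, 4), (10, 2)), ((0, 14), (0,
    15), (13, 4), (12, 4)), ((0, 15), (0, 16), (14, 4), (13, 2)), ((0, 16), (0, 17), (15, 1), (14,
    2)), ((0, 17), (0, 18), (17, 3), (16, 1)), ((0, 18), (0, 19), (18, 3), (17, 1)), ((0, 19), (0,
    12), (9, 4), (18, 1)), ((0, 12), (0, 13), (20, 0), (19, 4)), ((0, 13), (0, 14), (21, 3), (20,
    2)), ((0, 14), (0, 15), (22, 4), (21, 0)), ((0, 15), (0, 16), (23, 2), (22, 1)), ((0, 16), (0,
    17), (24, 3), (23, 4)), ((0, 17), (0, 18), (25, 1), (24, 0)), ((0, 18), (0, 19), (26, 4), (25,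
    3)), ((0, 19), (0, 12), (19, 2), (26, 1)), ((0, 20), (0, 21), (21, 2), (20, 3)), ((0, 21), (0,
    22), (23, 1), (22, 2)), ((0, 22), (0, 21), (25, 0), (24, 1)), ((0, 21), (0, 20), (19, 1), (26,
    2))]"

definition main_wires :: "nat list list" where
  "main_wires =
    [[0, 1, 5, 11, 4], [0, 1, 2, 6, 5], [5, 1, 2, 7, 6], [3, 8, 7, 6, 2], [2, 3, 9, 8, 7], [3, 4,
    10, 9, 8], [9, 3, 4, 11, 10], [10, 4, 0, 5, 11], [11, 5, 13, 12, 19], [5, 6, 14, 13, 12], [5, 6,
    7, 14, 13], [14, 6, 7, 8, 15], [7, 8, 16, 15, 14], [8, 9, 17, 16, 15], [17, 16, 8, 9, 10], [11,
    18, 17, 9, 10], [11, 19, 18, 17, 10], [5, 12, 19, 18, 11], [20, 21, 19, 12, 13], [12, 13, 14,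
    21, 20], [15, 21, 20, 13, 14], [15, 16, 22, 21, 14], [22, 21, 15, 16, 17], [18, 21, 22, 16, 17],
    [22, 17, 18, 19, 21], [19, 12, 20, 21, 18]]"

text \<open>A node \<open>n\<close> from 23 on denotes copy \<open>n - 23\<close>. The hubs 0 to 4
  are terminals themselves and have no fan.\<close>

definition main_fans :: "(nat \<times> nat list list) list" where
  "main_fans =
    [(5, [[6, 26, 3], [23, 0], [24, 1], [25, 2], [30, 4]]), (6, [[5, 23, 4], [7, 27, 3], [24, 0],
    [25, 1], [26, 2]]), (7, [[6, 24, 0], [8, 28, 4], [25, 1], [26, 2], [27, 3]]), (8, [[7, 25, 1],
    [9, 10, 30, 0], [26, 2], [27, 3], [28, 4]]), (9, [[8, 7, 25, 1], [10, 30, 0], [27, 2], [28, 3],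
    [29, 4]]), (10, [[9, 27, 2], [11, 23, 1], [28, 3], [29, 4], [30, 0]]), (11, [[5, 24, 1], [10, 9,
    27, 2], [23, 0], [29, 3], [30, 4]]), (12, [[13, 33, 7, 25, 2], [19, 39, 10, 28, 4], [31, 5, 23,
    0], [32, 6, 24, 1], [40, 11, 29, 3]]), (13, [[12, 40, 11, 29, 3], [14, 34, 8, 28, 4], [31, 5,
    23, 0], [32, 6, 24, 1], [33, 7, 25, 2]]), (14, [[13, 31, 11, 29, 4], [32, 5, 23, 0], [33, 6, 24,
    1], [34, 7, 25, 2], [35, 8, 26, 3]]), (15, [[14, 32, 5, 23, 4], [16, 37, 9, 27, 3], [34, 6, 24,
    0], [35, 7, 25, 1], [36, 8, 26, 2]]), (16, [[15, 34, 6, 24, 0], [17, 38, 10, 28, 4], [35, 7, 25,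
    1], [36, 8, 26, 2], [37, 9, 27, 3]]), (17, [[16, 35, 7, 25, 1], [36, 8, 26, 2], [37, 9, 27, 3],
    [38, 10, 28, 4], [39, 11, 23, 0]]), (18, [[17, 16, 35, 7, 25, 1], [19, 31, 11, 29, 4], [38, 9,
    27, 2], [39, 10, 28, 3], [40, 5, 23, 0]]), (19, [[12, 32, 6, 24, 1], [18, 38, 9, 27, 2], [31, 5,
    23, 0], [39, 10, 28, 3], [40, 11, 29, 4]]), (20, [[21, 44, 15, 34, 8, 28, 4], [41, 12, 31, 5,
    23, 0], [42, 13, 32, 6, 24, 1], [43, 14, 33, 7, 25, 2], [48, 18, 38, 9, 27, 3]]), (21, [[41, 12,
    31, 5, 23, 0], [42, 13, 32, 6, 24, 1], [43, 14, 33, 7, 25, 2], [44, 15, 34, 8, 26, 3], [45, 16,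
    36, 9, 28, 4]]), (22, [[21, 41, 12, 31, 11, 29, 4], [44, 14, 32, 5, 23, 0], [45, 15, 34, 6, 24,
    1], [46, 16, 35, 7, 25, 2], [47, 17, 36, 8, 26, 3]])]"

definition main_degrees :: "label list list" where
  "main_degrees =
    [[(0, 1), (0, 4), (2, 0), (8, 2)], [(0, 0), (0, 2), (1, 1), (3, 1)], [(0, 1), (0, 3), (2, 2),
    (5, 0)], [(0, 2), (0, 4), (4, 0), (7, 1)], [(0, 3), (0, 0), (6, 1), (1, 4)]]"

text \<open>The icosahedron without one of its vertices.\<close>

definition base_hubs :: "point list" where
  "base_hubs =
    [(0, 30), (-30, 10), (-20, -20), (20, -20), (30, 10), (-8, 10), (-12, -3), (0, -10), (12, -3),
    (8, 10), (0, 0)]"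

definition base_blobs :: "(int \<times> int \<times> int) list" where
  "base_blobs =
    []"

definition base_links :: "link list list" where
  "base_links =
    [[(0, (0, 0), (0, 1)), (0, (0, 1), (0, 2)), (0, (0, 2), (0, 3)), (0, (0, 3), (0, 4)), (0, (0,
    0), (0, 4)), (0, (0, 5), (0, 6)), (0, (0, 6), (0, 7)), (0, (0, 7), (0, 8)), (0, (0, 8), (0, 9)),
    (0, (0, 5), (0, 9)), (0, (0, 0), (0, 5)), (0, (0, 1), (0, 6)), (0, (0, 2), (0, 7)), (0, (0, 3),
    (0, 8)), (0, (0, 4), (0, 9)), (0, (0, 1), (0, 5)), (0, (0, 2), (0, 6)), (0, (0, 3), (0, 7)), (0,
    (0, 4), (0, 8)), (0, (0, 0), (0, 9)), (0, (0, 5), (0, 10)), (0, (0, 6), (0, 10)), (0, (0, 7),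
    (0, 10)), (0, (0, 8), (0, 10)), (0, (0, 9), (0, 10))]]"

definition base_crossings :: "(label \<times> label \<times> label \<times> label) list" where
  "base_crossings =
    []"

definition base_wires :: "nat list list" where
  "base_wires =
    []"

definition base_fans :: "(nat \<times> nat list list) list" where
  "base_fans =
    [(5, [[0], [1], [6, 2], [9, 4], [10, 7, 3]]), (6, [[1], [2], [5, 0], [7, 3], [10, 8, 4]]), (7,
    [[2], [3], [6, 1], [8, 4], [10, 5, 0]]), (8, [[3], [4], [7, 2], [9, 0], [10, 5, 1]]), (9, [[0],
    [4], [5, 1], [8, 3], [10, 6, 2]]), (10, [[5, 0], [6, 1], [7, 2], [8, 3], [9, 4]])]"

definition base_degrees :: "label list list" where
  "base_degrees =
    [[(0, 1), (0, 4), (0, 5), (0, 9)], [(0, 0), (0, 2), (0, 6), (0, 5)], [(0, 1), (0, 3), (0, 7),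
    (0, 6)], [(0, 2), (0, 4), (0, 8), (0, 7)], [(0, 3), (0, 0), (0, 9), (0, 8)]]"

text \<open>The hub 0 lies above a trapezoid with crossing diagonals, and the blob between them; the wires
  to the lower corners cross the two edges from the hub 0 to the upper corners.\<close>

definition top_hubs :: "point list" where
  "top_hubs =
    [(0, 160), (-120, 0), (-30, 40), (30, 40), (120, 0)]"

definition top_blobs :: "(int \<times> int \<times> int) list" where
  "top_blobs =
    [(0, 80, 3)]"

definition top_links :: "link list list" where
  "top_links =
    [[(1, (0, 2), (0, 4)), (1, (0, 3), (0, 1)), (2, (0, 0), (0, 2)), (3, (0, 0), (0, 3)), (0, (0,
    0), (0, 4)), (0, (0, 0), (0, 1)), (0, (0, 2), (0, 3)), (0, (0, 2), (0, 1)), (0, (0, 3), (0, 4)),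
    (0, (0, 4), (0, 1))], [(0, (0, 0), (1, 0)), (0, (0, 2), (1, 2)), (0, (0, 3), (1, 3)), (2, (0,
    1), (1, 1)), (3, (0, 4), (1, 4)), (0, (0, 0), (1, 1)), (0, (0, 0), (1, 4))]]"

text \<open>The diagonals of the trapezoid cross fully because the five hubs form \<open>K5\<close>.
  In the other two crossings the missing pair consists of an upper corner of the trapezoid and a
  terminal of the blob.\<close>

definition top_crossings :: "(label \<times> label \<times> label \<times> label) list" where
  "top_crossings =
    [((0, 2), (0, 3), (0, 4), (0, 1)), ((0, 0), (0, 1), (0, 2), (1, 1)), ((0, 0), (0, 4), (0, 3),
    (1, 4))]"

definition top_wires :: "nat list list" where
  "top_wires =
    [[0, 1, 2, 3, 4]]"

lemma main_shapes:
  "groups_ok (map mk_group (group_shapes (label_pos pentagon main_hubs main_blobs) 23 0 main_links))"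
  by code_simp

lemma main_crossings: "list_all (crossing_ok main_links) main_crossings"
  by code_simp

lemma main_touches: "list_all (link_touches (label_pos pentagon main_hubs main_blobs)) (concat main_links)"
  by code_simp

lemma main_fans: "list_all (fan_ok 23 26 main_links main_wires) main_fans"
  by code_simp

lemma main_wires: "list_all (wires_ok main_links main_wires) [0..<26]"
  by code_simp

text \<open>The final argument is the enlargement \<open>r\<close>: 80 times \<open>pentagon\<close>
  gives the first five main hubs, as 10 times \<open>pentagon\<close> gives those of the base
  below.\<close>

interpretation main: gadget_data 23 26 pentagon main_hubs main_blobs main_links main_crossings
  "label_pos pentagon main_hubs main_blobs" main_wires main_fans main_degrees 80
  by unfold_locales (rule reflexive main_shapes main_crossings main_touches main_fans main_wires | code_simp)+

interpretation base: gadget_data 11 0 pentagon base_hubs base_blobs base_links base_crossings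
  "label_pos pentagon base_hubs base_blobs" base_wires base_fans base_degrees 10
  by unfold_locales (rule reflexive | code_simp)+

interpretation top: linked_template 5 1 pentagon top_hubs top_blobs top_links top_crossings
  "label_pos pentagon top_hubs top_blobs" top_wires
  by unfold_locales (rule reflexive | code_simp)+

lemma top_complete:
  assumes "a < 5" "b < 5" "a \<noteq> b" shows "(hub a, hub b) \<in> link_graph top_links"
proof -
  have "list_all (\<lambda>a. list_all (\<lambda>b. a = b \<or> linked top_links (0, a) (0, b)) [0..<5]) [0..<5]"
    by code_simp
  moreover have "a \<in> set [0..<5]" "b \<in> set [0..<5]" using assms by simp_all
  ultimately have "linked top_links (0, a) (0, b)" using assms(3) unfolding list_all_iff by blast
  then have "(vertex_of (0, a), vertex_of (0, b)) \<in> link_graph top_links"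
    by (rule top.linked_F) (simp add: top.lengths(4))
  then show ?thesis by simp
qed

section \<open>The graphs\<close>

lemma (in template_data) straight_drawing_step:
  assumes "straight_gadget V E p \<tau>"
  shows "\<exists>p'. straight_drawing (blow_verts s t V) (blow_edges t F E) p'"
proof -
  interpret dt: drawn_template s t F q ctr \<beta> \<tau> K P by (rule drawn)
  interpret sg: straight_gadget V E p \<tau> by fact
  interpret blow_up s t F q ctr \<beta> \<tau> K P V E p by unfold_locales
  show ?thesis using straight_drawing_blow by blast
qed

text \<open>A placeholder for the base template: that has no copies, so any connected gadget starts
  the induction, and \<open>K5\<close> is the simplest.\<close>

lemma complete_connected_gadget:
  "connected_gadget (hub ` {..<5}) {(hub i, hub j) | i j. i < 5 \<and> j < 5 \<and> i \<noteq> j}"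
proof
  let ?E = "{(hub i, hub j) | i j. i < 5 \<and> j < 5 \<and> i \<noteq> j}"
  show "?E \<subseteq> hub ` {..<5} \<times> hub ` {..<5}" by auto
  show "sym ?E" by (rule symI) auto
  fix X u v assume "u \<in> hub ` {..<5} - X" "v \<in> hub ` {..<5} - X"
  then obtain i j where ij: "i < 5" "j < 5" "u = hub i" "v = hub j" "u \<notin> X" "v \<notin> X" by auto
  show "joined ?E X u v"
  proof (cases "i = j")
    case False then show ?thesis using ij by (intro joined_edge) auto
  qed (use ij in simp)
qed auto

section \<open>The iterated gadgets and the witnesses built from them\<close>

primrec gadget_verts :: "nat \<Rightarrow> nat set" where
  "gadget_verts 0 = blow_verts 11 0 {}"
| "gadget_verts (Suc k) = blow_verts 23 26 (gadget_verts k)"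

primrec gadget_edges :: "nat \<Rightarrow> (nat \<times> nat) set" where
  "gadget_edges 0 = blow_edges 0 (link_graph base_links) {}"
| "gadget_edges (Suc k) = blow_edges 26 (link_graph main_links) (gadget_edges k)"

lemma straight_gadget_k: "\<exists>p. straight_gadget (gadget_verts k) (gadget_edges k) p (\<lambda>j. pt (pentagon ! j))"
proof (induction k)
  case 0 show ?case using base.straight_step by simp
next
  case (Suc k) then show ?case using main.straight_step by auto
qed

lemma connected_gadget_k: "connected_gadget (gadget_verts k) (gadget_edges k)"
proof (induction k)
  case 0
  show ?case using base.connected_step[OF complete_connected_gadget]
    by (simp add: blow_verts_def blow_edges_def)
next
  case (Suc k) then show ?case using main.connected_step by simp
qed

lemma finite_gadget_verts: "finite (gadget_verts k)"
  using connected_gadget_k connected_gadget.fin_V by blast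

lemma card_gadget_verts: "11 * 26 ^ k \<le> card (gadget_verts k)"
proof (induction k)
  case 0 show ?case by (simp add: card_blow_verts)
next
  case (Suc k) then show ?case using card_blow_verts[OF finite_gadget_verts[of k], of 23 26] by simp
qed

text \<open>The recursion from \<open>l\<close> to \<open>23 + 24 * l\<close> multiplies
  \<open>l + 1\<close> by 24, and the base with its 11 vertices starts at
  \<open>l + 1 = 12\<close>.\<close>

lemma path_bound_gadget: "path_bound (gadget_verts k) (gadget_edges k) (12 * 24 ^ k - 1)"
proof (induction k)
  case 0
  have "length xs \<le> 11" if "set xs \<subseteq> gadget_verts 0" "distinct xs" for xs
    using card_mono[OF finite_gadget_verts[of 0] that(1)] distinct_card[OF that(2)]
    by (simp add: card_blow_verts)
  then show ?case unfolding path_bound_def by simp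
next
  case (Suc k)
  \<comment> \<open>Writing the power as a successor resolves the truncated subtraction.\<close>
  obtain m where m: "(24::nat) ^ k = Suc m" using gr0_conv_Suc[of "24 ^ k"] by auto
  have "23 + (23 + 1) * (12 * 24 ^ k - 1) = (12 * 24 ^ Suc k - 1 :: nat)"
    unfolding power_Suc m by simp
  then show ?case using main.path_bound_step[OF Suc] by simp
qed

definition witness_verts :: "nat \<Rightarrow> nat set" where
  "witness_verts k = blow_verts 5 1 (gadget_verts k)"

definition witness_edges :: "nat \<Rightarrow> (nat \<times> nat) set" where
  "witness_edges k = blow_edges 1 (link_graph top_links) (gadget_edges k)"

definition witness :: "nat \<Rightarrow> nat pair_pre_digraph" where
  "witness k = \<lparr>pverts = witness_verts k, parcs = witness_edges k\<rparr>"

lemma card_witness: "5 + 11 * 26 ^ k \<le> card (pverts (witness k))"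
  using card_gadget_verts[of k] card_blow_verts[OF finite_gadget_verts[of k], of 5 1]
  by (simp add: witness_def witness_verts_def)

text \<open>Five more hubs multiply \<open>l + 1\<close> by 6, whence
  \<open>72 = 6 * 12\<close>.\<close>

lemma path_bound_witness: "path_bound (witness_verts k) (witness_edges k) (72 * 24 ^ k - 1)"
proof -
  obtain m where m: "(24::nat) ^ k = Suc m" using gr0_conv_Suc[of "24 ^ k"] by auto
  have "5 + (5 + 1) * (12 * 24 ^ k - 1) = (72 * 24 ^ k - 1 :: nat)" unfolding m by simp
  then show ?thesis
    using template.path_bound_blow[OF top.template path_bound_gadget[of k]]
    by (simp add: witness_verts_def witness_edges_def)
qed

lemma witness_drawing: "\<exists>p. straight_drawing (witness_verts k) (witness_edges k) p"
  using straight_gadget_k[of k] top.straight_drawing_step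
  unfolding witness_verts_def witness_edges_def by blast

lemma witness_edges_subset: "witness_edges k \<subseteq> witness_verts k \<times> witness_verts k"
  using witness_drawing[of k] straight_drawing.E_sub by blast

lemma pair_graph_witness: "pair_graph (witness k)"
  using witness_drawing[of k] straight_drawing.pair_graph_G unfolding witness_def by blast

lemma wlm_witness: "weakly_locally_maximal_one_planar (witness k)"
  using witness_drawing[of k] straight_drawing.wlm_G unfolding witness_def by blast

lemma k_connected_witness: "k_connected 5 (witness k)"
  unfolding witness_def
proof (rule k_connected_if_joined)
  interpret tp: template 5 1 "link_graph top_links" "\<lambda>i j. top_wires ! i ! j" by (rule top.template)
  interpret cg: connected_gadget "gadget_verts k" "gadget_edges k" by (rule connected_gadget_k)
  interpret template_gadget 5 1 "link_graph top_links" "\<lambda>i j. top_wires ! i ! j" "gadget_verts k" "gadget_edges k"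
    by unfold_locales
  show "finite (witness_verts k)" unfolding witness_verts_def by (rule finite_V')
  show "witness_edges k \<subseteq> witness_verts k \<times> witness_verts k" by (rule witness_edges_subset)
  show "5 < card (witness_verts k)"
  proof -
    have "0 < (26::nat) ^ k" by simp
    then show ?thesis using card_witness[of k] unfolding witness_def pair_pre_digraph.simps by linarith
  qed
  fix X u v assume "X \<subseteq> witness_verts k" "card X < 5" "u \<in> witness_verts k - X" "v \<in> witness_verts k - X"
  then show "joined (witness_edges k) X u v"
    unfolding witness_verts_def witness_edges_def
    by (intro joined_if_hubs_complete) (auto intro: top_complete)
qed

lemma circ_witness: "circ (witness k) \<le> 72 * 24 ^ k - 1"
  unfolding witness_def by (rule circ_le_path_bound[OF path_bound_witness witness_edges_subset])

text \<open>The exponent 24 is the least one with \<open>72 * 24 ^ k \<le> 11 * 26 ^ k\<close>; from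
  there on the ratio can only improve.\<close>

lemma not_traceable_witness:
  assumes "24 \<le> k" shows "\<not> traceable (witness k)"
proof -
  have "(72::nat) * 24 ^ k \<le> 11 * 26 ^ k"
    using assms by (induction k rule: dec_induct) simp_all
  moreover have "0 < (24::nat) ^ k" by simp
  ultimately have "72 * 24 ^ k - 1 < card (witness_verts k)"
    using card_witness[of k] unfolding witness_def pair_pre_digraph.simps by linarith
  then show ?thesis unfolding witness_def
    by (rule not_traceable_if_path_bound[OF path_bound_witness witness_edges_subset])
qed

lemma card_witness_ge: "k \<le> card (pverts (witness k))"
proof -
  have "k < 26 ^ k" by (rule power_gt_expt) simp
  then show ?thesis using card_witness[of k] by linarith
qed

section \<open>Asymptotics of circumference against order, with the fraction 49/50 lying between the
  two quotients of logarithms\<close>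

lemma ln_ratio_le: "ln 24 / ln 26 \<le> (ln 20 / ln 21 :: real)"
proof -
  have "ln ((24::real) ^ 50) \<le> ln (26 ^ 49)" "ln ((21::real) ^ 49) \<le> ln (20 ^ 50)"
    by (subst ln_le_cancel_iff; simp)+
  moreover have "ln ((24::real) ^ 50) = 50 * ln 24" "ln ((26::real) ^ 49) = 49 * ln 26"
    "ln ((21::real) ^ 49) = 49 * ln 21" "ln ((20::real) ^ 50) = 50 * ln 20"
    by (subst ln_realpow; simp)+
  ultimately have 1: "50 * ln 24 \<le> 49 * ln (26::real)" "49 * ln 21 \<le> 50 * ln (20::real)"
    by (simp_all only:)
  have p: "0 < ln (26::real)" "0 < ln (21::real)" by simp_all
  have "ln 24 / ln 26 \<le> (49 / 50 :: real)" using 1(1) p(1) by (simp add: field_simps)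
  also have "\<dots> \<le> ln 20 / ln 21" using 1(2) p(2) by (simp add: field_simps)
  finally show ?thesis .
qed

lemma ln_circ_witness:
  "ln (real (circ (witness k))) / ln (real (card (pverts (witness k))))
     \<le> (ln 72 + real k * ln 24) / (ln 11 + real k * ln 26)"
proof (rule frac_le)
  have l: "ln (72 * 24 ^ k :: real) = ln 72 + real k * ln 24" "ln (11 * 26 ^ k :: real) = ln 11 + real k * ln 26"
    by (simp_all add: ln_mult ln_realpow)
  show "0 \<le> ln 72 + real k * ln 24" by simp
  show "ln (real (circ (witness k))) \<le> ln 72 + real k * ln 24"
  proof (cases "circ (witness k) = 0")
    \<comment> \<open>The convention \<open>ln 0 = 0\<close> makes the bound hold even here.\<close>
    case True then show ?thesis by simp
  next
    case False
    have "circ (witness k) \<le> 72 * 24 ^ k" using circ_witness[of k] by linarith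
    then have "real (circ (witness k)) \<le> real (72 * 24 ^ k)" by (rule of_nat_mono)
    then have "ln (real (circ (witness k))) \<le> ln (72 * 24 ^ k)" using False by (subst ln_le_cancel_iff) auto
    then show ?thesis by (simp only: l)
  qed
  show "0 < ln 11 + real k * ln 26" by (intro add_pos_nonneg mult_nonneg_nonneg) simp_all
  have "11 * 26 ^ k \<le> card (pverts (witness k))" using card_witness[of k] by linarith
  then have "real (11 * 26 ^ k) \<le> real (card (pverts (witness k)))" by (rule of_nat_mono)
  then have m: "11 * 26 ^ k \<le> real (card (pverts (witness k)))" by simp
  have "0 < 11 * (26::real) ^ k" by simp
  with m have "ln (11 * 26 ^ k) \<le> ln (real (card (pverts (witness k))))"
    by (subst ln_le_cancel_iff) linarith+
  then show "ln 11 + real k * ln 26 \<le> ln (real (card (pverts (witness k))))" by (simp only: l)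
qed

lemma ratio_limit: "(\<lambda>k. (ln 72 + real k * ln 24) / (ln 11 + real k * ln 26)) \<longlonglongrightarrow> ln 24 / ln (26::real)"
proof -
  have "(\<lambda>k. (ln 72 / real k + ln 24) / (ln 11 / real k + ln 26)) \<longlonglongrightarrow> (0 + ln 24) / (0 + ln (26::real))"
    by (intro tendsto_intros lim_const_over_n) simp
  \<comment> \<open>Cancelling \<open>real k\<close> requires \<open>k > 0\<close>, so the two
    sequences agree only eventually.\<close>
  moreover have "\<forall>\<^sub>F k in sequentially. (ln 72 / real k + ln 24) / (ln 11 / real k + ln 26)
      = (ln 72 + real k * ln 24) / (ln 11 + real k * ln (26::real))"
    using eventually_gt_at_top[of 0]
  proof eventually_elim
    case (elim k)
    have "(ln 72 / real k + ln 24) / (ln 11 / real k + ln 26)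
       = (real k * (ln 72 / real k + ln 24)) / (real k * (ln 11 / real k + ln (26::real)))"
      using elim by simp
    also have "\<dots> = (ln 72 + real k * ln 24) / (ln 11 + real k * ln 26)"
      using elim by (simp add: distrib_left)
    finally show ?case .
  qed
  ultimately show ?thesis using Lim_transform_eventually by fastforce
qed

theorem theorem2:
  shows "infinite ({G :: nat pair_pre_digraph.
             pair_graph G \<and> k_connected 5 G \<and>
             weakly_locally_maximal_one_planar G \<and> \<not> traceable G} // iso_rel)
       \<and> shortness_exponent {G. pair_graph G \<and> k_connected 5 G \<and> one_planar G}
           \<le> ereal (ln 20 / ln 21)"
proof
  let ?A = "{G :: nat pair_pre_digraph. pair_graph G \<and> k_connected 5 G \<and>
             weakly_locally_maximal_one_planar G \<and> \<not> traceable G}"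
  show "infinite (?A // iso_rel)"
  proof (rule infinite_iso_classes)
    show "infinite ((\<lambda>G. card (pverts G)) ` ?A)"
      unfolding infinite_nat_iff_unbounded
    proof
      fix m
      \<comment> \<open>The shift by 24 excludes traceability, and with it the order exceeds
        \<open>m\<close>.\<close>
      have "witness (m + 24) \<in> ?A"
        using pair_graph_witness k_connected_witness wlm_witness not_traceable_witness by simp
      moreover have "m < card (pverts (witness (m + 24)))" using card_witness_ge[of "m + 24"] by linarith
      ultimately show "\<exists>n>m. n \<in> (\<lambda>G. card (pverts G)) ` ?A" by blast
    qed
  qed simp
  have "shortness_exponent {G. pair_graph G \<and> k_connected 5 G \<and> one_planar G} \<le> ereal (ln 24 / ln 26)"
  proof (rule shortness_exponent_le[OF _ _ ln_circ_witness ratio_limit])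
    show "witness k \<in> {G. pair_graph G \<and> k_connected 5 G \<and> one_planar G}" for k
      using pair_graph_witness k_connected_witness weakly_locally_maximal_imp_one_planar[OF wlm_witness] by simp
    show "filterlim (\<lambda>k. card (pverts (witness k))) at_top sequentially"
      by (rule filterlim_at_top_mono[OF filterlim_ident]) (simp add: card_witness_ge)
  qed
  also have "ereal (ln 24 / ln 26) \<le> ereal (ln 20 / ln 21)" using ln_ratio_le by simp
  finally show "shortness_exponent {G. pair_graph G \<and> k_connected 5 G \<and> one_planar G}
           \<le> ereal (ln 20 / ln 21)" .
qed

end
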